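(* Let $L$ be a principal ideal domain without $2$-torsion. Then for $n\geq5$ there is an isomorphism of $L$-modules $$H^1(\mathrm{Out}\,F_n,V_L)\cong L.$$
   Context: $F_n$ is the free group of rank $n$; $\mathrm{Aut}\,F_n$ acts on $F_n$ from the right, written $x^{\sigma}$, so $x^{\sigma\tau}=(x^\sigma)^\tau$. $\mathrm{Inn}\,F_n$ is the group of inner automorphisms and $\mathrm{Out}\,F_n:=\mathrm{Aut}\,F_n/\mathrm{Inn}\,F_n$. $H$ is the abelianization of $F_n$, $[x]\in H$ is the class of $x\in F_n$, and $H^*=\mathrm{Hom}_{\mathbf{Z}}(H,\mathbf{Z})$. $H$ is a left $\mathrm{Aut}\,F_n$-module via $\sigma\cdot[x]:=[x^{\sigma^{-1}}]$; $H^*$ carries the dual action, and $H^*\otimes_{\mathbf{Z}}\Lambda^2H$ the induced diagonal action. $\mathrm{IA}_n$ is the kernel of the natural homomorphism $\mathrm{Aut}\,F_n\to\mathrm{Aut}\,H=\mathrm{GL}(n,\mathbf{Z})$. $V:=\mathrm{IA}_n^{\mathrm{ab}}$ is identified, as a $\mathrm{GL}(n,\mathbf{Z})$-module (known result), with $H^*\otimes_{\mathbf{Z}}\Lambda^2H$ via the first Johnson homomorphism $\sigma\mapsto([x]\mapsto x^{-1}x^\sigma)$, where the class of $x^{-1}x^\sigma\in[F_n,F_n]$ is taken in $[F_n,F_n]/[F_n,[F_n,F_n]]\cong\Lambda^2H$. $V_L:=V\otimes_{\mathbf{Z}}L$ with $L$ a trivial module; since the action of $\mathrm{Aut}\,F_n$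 on $V_L$ factors through $\mathrm{GL}(n,\mathbf{Z})$, inner automorphisms act trivially and $V_L$ is an $\mathrm{Out}\,F_n$-module. "Without $2$-torsion" means that $2a=0$ with $a\in L$ implies $a=0$. *)

theory Defs
  imports "HOL-Algebra.Algebra"
begin

section \<open>Free groups\<close>

text \<open>Elements are reduced words; the letter \<open>(a, True)\<close> is the generator \<open>a\<close>
  and \<open>(a, False)\<close> is its inverse.\<close>

fun red_cons :: "'a \<times> bool \<Rightarrow> ('a \<times> bool) list \<Rightarrow> ('a \<times> bool) list" where
  "red_cons x [] = [x]"
| "red_cons x (y # w) = (if fst x = fst y \<and> snd x \<noteq> snd y then w else x # y # w)"

definition reduced :: "('a \<times> bool) list \<Rightarrow> bool" where
  "reduced w \<longleftrightarrow> successively (\<lambda>x y. \<not> (fst x = fst y \<and> snd x \<noteq> snd y)) w"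

definition free_group :: "'a set \<Rightarrow> ('a \<times> bool) list monoid" where
  "free_group S = \<lparr>carrier = {w. fst ` set w \<subseteq> S \<and> reduced w},
                   monoid.mult = (\<lambda>u v. foldr red_cons u v), one = []\<rparr>"

section \<open>Automorphisms, acting from the right\<close>

text \<open>The product \<open>\<sigma>\<tau>\<close> applies \<open>\<sigma>\<close> first: this is the opposite of \<^const>\<open>AutoGroup\<close>.\<close>

definition right_Aut :: "('a, 'b) monoid_scheme \<Rightarrow> ('a \<Rightarrow> 'a) monoid" where
  "right_Aut G = \<lparr>carrier = auto G, monoid.mult = (\<lambda>\<sigma> \<tau>. compose (carrier G) \<tau> \<sigma>),
                  one = (\<lambda>x\<in>carrier G. x)\<rparr>"

definition Inn :: "('a, 'b) monoid_scheme \<Rightarrow> ('a \<Rightarrow> 'a) set" where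
  "Inn G = {\<lambda>x\<in>carrier G. inv\<^bsub>G\<^esub> g \<otimes>\<^bsub>G\<^esub> x \<otimes>\<^bsub>G\<^esub> g | g. g \<in> carrier G}"

definition Out :: "('a, 'b) monoid_scheme \<Rightarrow> ('a \<Rightarrow> 'a) set monoid" where
  "Out G = right_Aut G Mod Inn G"

section \<open>Abelianization, dual, tensor product and exterior square\<close>

text \<open>For a homomorphism \<open>f\<close> from a group \<open>G\<close> to \<open>K\<close> that maps a normal subgroup \<open>M\<close> into \<open>N\<close>,
  \<open>induced K N f\<close> is the induced homomorphism from \<open>G Mod M\<close> to \<open>K Mod N\<close>: all the cosets
  formed for \<open>x \<in> C\<close> agree.\<close>

definition induced :: "('b, 'c) monoid_scheme \<Rightarrow> 'b set \<Rightarrow> ('a \<Rightarrow> 'b) \<Rightarrow> 'a set \<Rightarrow> 'b set" where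
  "induced K N f C = the_elem ((\<lambda>x. N #>\<^bsub>K\<^esub> f x) ` C)"

definition abelianization :: "('a, 'b) monoid_scheme \<Rightarrow> 'a set monoid" where
  "abelianization G = G Mod derived G (carrier G)"

definition dual_group :: "('a, 'b) monoid_scheme \<Rightarrow> ('a \<Rightarrow> int) monoid" where
  "dual_group A = \<lparr>carrier = hom A integer_group \<inter> extensional (carrier A),
                   monoid.mult = (\<lambda>\<phi> \<psi>. \<lambda>x\<in>carrier A. \<phi> x + \<psi> x),
                   one = (\<lambda>x\<in>carrier A. 0)\<rparr>"

definition bilin_rels ::
  "('a, 'c) monoid_scheme \<Rightarrow> ('b, 'd) monoid_scheme \<Rightarrow> ('a \<times> 'b \<Rightarrow>\<^sub>0 int) set" where
  "bilin_rels A B =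
     {frag_of (a \<otimes>\<^bsub>A\<^esub> a', b) - frag_of (a, b) - frag_of (a', b) | a a' b.
        a \<in> carrier A \<and> a' \<in> carrier A \<and> b \<in> carrier B} \<union>
     {frag_of (a, b \<otimes>\<^bsub>B\<^esub> b') - frag_of (a, b) - frag_of (a, b') | a b b'.
        a \<in> carrier A \<and> b \<in> carrier B \<and> b' \<in> carrier B}"

definition tensor_sub ::
  "('a, 'c) monoid_scheme \<Rightarrow> ('b, 'd) monoid_scheme \<Rightarrow> ('a \<times> 'b \<Rightarrow>\<^sub>0 int) set" where
  "tensor_sub A B =
     generate (free_Abelian_group (carrier A \<times> carrier B)) (bilin_rels A B)"

text \<open>The tensor product over the integers of two abelian groups.\<close>

definition tensor ::
  "('a, 'c) monoid_scheme \<Rightarrow> ('b, 'd) monoid_scheme \<Rightarrow> ('a \<times> 'b \<Rightarrow>\<^sub>0 int) set monoid" where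
  "tensor A B = free_Abelian_group (carrier A \<times> carrier B) Mod tensor_sub A B"

text \<open>The map \<open>f \<otimes> g\<close> into \<open>tensor A B\<close>, for homomorphisms \<open>f\<close> into \<open>A\<close> and \<open>g\<close> into \<open>B\<close>.\<close>

definition tensor_map ::
  "('a, 'c) monoid_scheme \<Rightarrow> ('b, 'd) monoid_scheme \<Rightarrow> ('e \<Rightarrow> 'a) \<Rightarrow> ('f \<Rightarrow> 'b)
    \<Rightarrow> ('e \<times> 'f \<Rightarrow>\<^sub>0 int) set \<Rightarrow> ('a \<times> 'b \<Rightarrow>\<^sub>0 int) set" where
  "tensor_map A B f g =
     induced (free_Abelian_group (carrier A \<times> carrier B)) (tensor_sub A B)
       (frag_extend (\<lambda>(a, b). frag_of (f a, g b)))"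

definition ext_square_sub :: "('a, 'c) monoid_scheme \<Rightarrow> ('a \<times> 'a \<Rightarrow>\<^sub>0 int) set" where
  "ext_square_sub A =
     generate (free_Abelian_group (carrier A \<times> carrier A))
       (bilin_rels A A \<union> {frag_of (a, a) | a. a \<in> carrier A})"

definition ext_square :: "('a, 'c) monoid_scheme \<Rightarrow> ('a \<times> 'a \<Rightarrow>\<^sub>0 int) set monoid" where
  "ext_square A = free_Abelian_group (carrier A \<times> carrier A) Mod ext_square_sub A"

definition ext_square_map ::
  "('a, 'c) monoid_scheme \<Rightarrow> ('e \<Rightarrow> 'a) \<Rightarrow> ('e \<times> 'e \<Rightarrow>\<^sub>0 int) set \<Rightarrow> ('a \<times> 'a \<Rightarrow>\<^sub>0 int) set" where
  "ext_square_map A f =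
     induced (free_Abelian_group (carrier A \<times> carrier A)) (ext_square_sub A)
       (frag_extend (\<lambda>(a, b). frag_of (f a, f b)))"

section \<open>The left modules over the automorphism group\<close>

text \<open>In \<open>act_H\<close>, \<open>\<sigma>\<close> sends \<open>[x]\<close> to \<open>[x\<^sup>\<tau>]\<close> with \<open>\<tau>\<close> the inverse of \<open>\<sigma>\<close>; this makes
  it a left action.\<close>

definition act_H :: "('a, 'b) monoid_scheme \<Rightarrow> ('a \<Rightarrow> 'a) \<Rightarrow> 'a set \<Rightarrow> 'a set" where
  "act_H G \<sigma> = induced G (derived G (carrier G)) (inv\<^bsub>right_Aut G\<^esub> \<sigma>)"

definition act_dual ::
  "('a, 'b) monoid_scheme \<Rightarrow> ('a \<Rightarrow> 'a) \<Rightarrow> ('a set \<Rightarrow> int) \<Rightarrow> ('a set \<Rightarrow> int)" where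
  "act_dual G \<sigma> \<phi> =
     (\<lambda>x\<in>carrier (abelianization G). \<phi> (act_H G (inv\<^bsub>right_Aut G\<^esub> \<sigma>) x))"

type_synonym 'a V_elem =
  "(('a set \<Rightarrow> int) \<times> ('a set \<times> 'a set \<Rightarrow>\<^sub>0 int) set \<Rightarrow>\<^sub>0 int) set"

text \<open>For \<open>G\<close> free of finite rank, \<open>V_group G\<close> is the abelianization of the \<open>IA\<close>-automorphism
  group of \<open>G\<close>, identified through the first Johnson homomorphism with the tensor product of
  the dual of \<open>H\<close> and the exterior square of \<open>H\<close>.\<close>

definition V_group :: "('a, 'b) monoid_scheme \<Rightarrow> 'a V_elem monoid" where
  "V_group G = tensor (dual_group (abelianization G)) (ext_square (abelianization G))"

definition act_V :: "('a, 'b) monoid_scheme \<Rightarrow> ('a \<Rightarrow> 'a) \<Rightarrow> 'a V_elem \<Rightarrow> 'a V_elem" where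
  "act_V G \<sigma> =
     tensor_map (dual_group (abelianization G)) (ext_square (abelianization G))
       (act_dual G \<sigma>) (ext_square_map (abelianization G) (act_H G \<sigma>))"

type_synonym ('a, 'l) VL_elem = "('a V_elem \<times> 'l \<Rightarrow>\<^sub>0 int) set"

text \<open>The fields \<open>mult\<close> and \<open>one\<close> of a module record play no role in a module.\<close>

definition V_mod ::
  "('a, 'b) monoid_scheme \<Rightarrow> ('l, 'd) ring_scheme \<Rightarrow> ('l, ('a, 'l) VL_elem) module" where
  "V_mod G L =
     (let T = tensor (V_group G) (add_monoid L) in
      \<lparr>carrier = carrier T, monoid.mult = undefined, one = undefined,
       ring.zero = \<one>\<^bsub>T\<^esub>, ring.add = monoid.mult T,
       smult = (\<lambda>r. tensor_map (V_group G) (add_monoid L) (\<lambda>v. v) (\<lambda>a. r \<otimes>\<^bsub>L\<^esub> a))\<rparr>)"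

definition act_VL ::
  "('a, 'b) monoid_scheme \<Rightarrow> ('l, 'd) ring_scheme \<Rightarrow> ('a \<Rightarrow> 'a)
    \<Rightarrow> ('a, 'l) VL_elem \<Rightarrow> ('a, 'l) VL_elem" where
  "act_VL G L \<sigma> = tensor_map (V_group G) (add_monoid L) (act_V G \<sigma>) (\<lambda>a. a)"

text \<open>Inner automorphisms act trivially, so all \<open>\<sigma>\<close> in a class \<open>S\<close> act in the same way.\<close>

definition out_act_VL ::
  "('a, 'b) monoid_scheme \<Rightarrow> ('l, 'd) ring_scheme \<Rightarrow> ('a \<Rightarrow> 'a) set
    \<Rightarrow> ('a, 'l) VL_elem \<Rightarrow> ('a, 'l) VL_elem" where
  "out_act_VL G L S v = the_elem ((\<lambda>\<sigma>. act_VL G L \<sigma> v) ` S)"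

section \<open>First group cohomology\<close>

definition quot_module :: "('l, 'm, 'c) module_scheme \<Rightarrow> 'm set \<Rightarrow> ('l, 'm set) module" where
  "quot_module M N =
     \<lparr>carrier = a_rcosets\<^bsub>M\<^esub> N, monoid.mult = undefined, one = undefined,
      ring.zero = N, ring.add = set_add M,
      smult = (\<lambda>r C. the_elem ((\<lambda>x. N +>\<^bsub>M\<^esub> (r \<odot>\<^bsub>M\<^esub> x)) ` C))\<rparr>"

definition crossed_homs ::
  "('g, 'b) monoid_scheme \<Rightarrow> ('l, 'm, 'c) module_scheme \<Rightarrow> ('g \<Rightarrow> 'm \<Rightarrow> 'm)
    \<Rightarrow> ('l, 'g \<Rightarrow> 'm) module" where
  "crossed_homs G M \<rho> =
     \<lparr>carrier = {f \<in> carrier G \<rightarrow>\<^sub>E carrier M. \<forall>x\<in>carrier G. \<forall>y\<in>carrier G.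
                   f (x \<otimes>\<^bsub>G\<^esub> y) = f x \<oplus>\<^bsub>M\<^esub> \<rho> x (f y)},
      monoid.mult = undefined, one = undefined,
      ring.zero = (\<lambda>x\<in>carrier G. \<zero>\<^bsub>M\<^esub>),
      ring.add = (\<lambda>f g. \<lambda>x\<in>carrier G. f x \<oplus>\<^bsub>M\<^esub> g x),
      smult = (\<lambda>r f. \<lambda>x\<in>carrier G. r \<odot>\<^bsub>M\<^esub> f x)\<rparr>"

definition principal_crossed_homs ::
  "('g, 'b) monoid_scheme \<Rightarrow> ('l, 'm, 'c) module_scheme \<Rightarrow> ('g \<Rightarrow> 'm \<Rightarrow> 'm)
    \<Rightarrow> ('g \<Rightarrow> 'm) set" where
  "principal_crossed_homs G M \<rho> = {\<lambda>x\<in>carrier G. \<rho> x m \<ominus>\<^bsub>M\<^esub> m | m. m \<in> carrier M}"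

text \<open>The first cohomology of the inhomogeneous cochain complex of \<open>G\<close> with coefficients in
  the module \<open>M\<close>, on which \<open>G\<close> acts linearly from the left through \<open>\<rho>\<close>.\<close>

definition H1 ::
  "('g, 'b) monoid_scheme \<Rightarrow> ('l, 'm, 'c) module_scheme \<Rightarrow> ('g \<Rightarrow> 'm \<Rightarrow> 'm)
    \<Rightarrow> ('l, ('g \<Rightarrow> 'm) set) module" where
  "H1 G M \<rho> = quot_module (crossed_homs G M \<rho>) (principal_crossed_homs G M \<rho>)"

section \<open>Module isomorphisms\<close>

definition regular_module :: "('l, 'd) ring_scheme \<Rightarrow> ('l, 'l) module" where
  "regular_module L =
     \<lparr>carrier = carrier L, monoid.mult = monoid.mult L, one = \<one>\<^bsub>L\<^esub>,
      ring.zero = \<zero>\<^bsub>L\<^esub>, ring.add = add L, smult = monoid.mult L\<rparr>"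

definition mod_hom ::
  "('l, 'd) ring_scheme \<Rightarrow> ('l, 'm, 'c) module_scheme \<Rightarrow> ('l, 'n, 'e) module_scheme
    \<Rightarrow> ('m \<Rightarrow> 'n) set" where
  "mod_hom R M N =
     {h \<in> carrier M \<rightarrow> carrier N.
        (\<forall>x\<in>carrier M. \<forall>y\<in>carrier M. h (x \<oplus>\<^bsub>M\<^esub> y) = h x \<oplus>\<^bsub>N\<^esub> h y) \<and>
        (\<forall>r\<in>carrier R. \<forall>x\<in>carrier M. h (r \<odot>\<^bsub>M\<^esub> x) = r \<odot>\<^bsub>N\<^esub> h x)}"

definition mod_isomorphic ::
  "('l, 'd) ring_scheme \<Rightarrow> ('l, 'm, 'c) module_scheme \<Rightarrow> ('l, 'n, 'e) module_scheme \<Rightarrow> bool" where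
  "mod_isomorphic R M N \<longleftrightarrow> (\<exists>h\<in>mod_hom R M N. bij_betw h (carrier M) (carrier N))"

end

theory Submission
  imports Defs
begin

text \<open>Restricting a crossed homomorphism \<open>f\<close> of \<open>Aut F\<^sub>n\<close> to the automorphism \<open>K\<close> that conjugates \<open>x\<^sub>0\<close>
  by \<open>x\<^sub>1\<close> is injective on cohomology: \<open>\<iota>: x\<^sub>i \<mapsto> x\<^sub>i\<^sup>-\<^sup>1\<close> acts on \<open>V\<^sub>L\<close> as \<open>-1\<close> and commutes with the Nielsen
  generators up to \<open>K\<close>, so that \<open>f(K) = 0\<close> forces \<open>2f(\<sigma>) = f(\<iota>) - \<sigma>f(\<iota>)\<close> on generators, and the
  coordinates of \<open>f(\<iota>)\<close> are then all divisible by \<open>2\<close>. The relations of \<open>K\<close> with the signed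
  permutations give \<open>f(K) = a e\<^sub>0\<^sup>* \<otimes> (e\<^sub>0 \<and> e\<^sub>1) + b \<Sum>\<^sub>i e\<^sub>i\<^sup>* \<otimes> (e\<^sub>i \<and> e\<^sub>1)\<close>; the same congruences modulo \<open>2\<close> show
  that \<open>a\<close> is even, and \<open>f\<close> vanishes on inner automorphisms only if \<open>a = -(n-1)b\<close>. So \<open>b\<close> embeds the
  cohomology of \<open>Out F\<^sub>n\<close> into \<open>{b. (n-1)b \<in> 2L}\<close>, which is \<open>L\<close> for odd \<open>n\<close> and \<open>2L\<close> for even \<open>n\<close>. Every
  such \<open>b\<close> occurs: if \<open>g\<close> is the crossed homomorphism with \<open>g(\<sigma>)(x) = \<sigma>\<lambda>(x\<^sup>\<sigma>) - \<lambda>(x)\<close>, where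
  \<open>\<lambda>(xy) = \<lambda>(x) + \<lambda>(y) + [x] \<and> [y]\<close>, and \<open>C\<close> and \<open>\<Omega>\<close> are the contraction \<open>V \<rightarrow> H\<close> and the insertion \<open>H \<rightarrow> V\<close>,
  then \<open>\<Omega>Cg - (n-1)g\<close> vanishes on inner automorphisms, and for odd \<open>n\<close> it is twice a crossed
  homomorphism up to a coboundary.\<close>

section \<open>Tensor products of abelian groups\<close>

text \<open>Were \<iota> central in Out F_n, the relation \<sigma>\<iota> = \<iota>\<sigma> would
  give 2f(\<sigma>) = f(\<iota>) - \<sigma>f(\<iota>) for all \<sigma>, and twice the cohomology
  would vanish. It commutes with the transvection only up to K, so f(K) is the obstruction, and one
  coordinate of it measures the whole cohomology. The second obstacle is that 2 can be cancelled in
  L but perhaps not inverted. Each step from 2f to f needs a divisibility, read off coordinate by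
  coordinate: V is free on e_i^* \<otimes> (e_j \<and> e_k) with j < k, so V_L has coordinates in L.
  Equality with a coboundary is checked only on signed permutations and one transvection. That these
  generate Aut F_n is proved by Nielsen reduction, which is why cancellation of words is studied.
  The factor n - 1 comes from C\<Omega> = n - 1: on conjugation by x the map g takes the value
  2\<Omega>[x], and \<Omega>C\<Omega> = (n-1)\<Omega>. For odd n, \<Omega>Cg itself cannot be
  halved, since Cg has an odd coordinate at the transvection; subtracting the coboundary of the sum
  of the basis vectors of H makes it even.\<close>

lemma hom_eq_on_generate:
  assumes "group G" "group K" "h \<in> hom G K" "h' \<in> hom G K"
    and S: "S \<subseteq> carrier G" "\<And>x. x \<in> S \<Longrightarrow> h x = h' x" and "x \<in> generate G S"
  shows "h x = h' x"
proof -
  interpret a: group_hom G K h using assms by (simp add: group_hom_def group_hom_axioms_def)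
  interpret b: group_hom G K h' using assms by (simp add: group_hom_def group_hom_axioms_def)
  have "x \<in> carrier G \<and> h x = h' x"
    using \<open>x \<in> generate G S\<close> by induction (use S in auto)
  then show ?thesis ..
qed

text \<open>Two representatives of a coset of \<open>M\<close> differ by an element of
  \<open>M\<close>, whose image lies in \<open>N\<close>; so \<open>the_elem\<close> is taken of a
  singleton. Every map built with \<open>induced\<close> is handled through this lemma.\<close>

lemma induced_hom:
  assumes G: "M \<lhd> G" and K: "N \<lhd> K" and f: "f \<in> hom G K" and MN: "f ` M \<subseteq> N"
  shows induced_rcos: "x \<in> carrier G \<Longrightarrow> induced K N f (M #>\<^bsub>G\<^esub> x) = N #>\<^bsub>K\<^esub> f x"
    and "induced K N f \<in> hom (G Mod M) (K Mod N)"
proof -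
  interpret M: normal M G by fact
  interpret N: normal N K by fact
  have c: "induced K N f (M #>\<^bsub>G\<^esub> x) = N #>\<^bsub>K\<^esub> f x" if x: "x \<in> carrier G" for x
  proof -
    have fx: "f x \<in> carrier K" using f x by (auto simp: hom_def)
    have "N #>\<^bsub>K\<^esub> f y = N #>\<^bsub>K\<^esub> f x" if "y \<in> M #>\<^bsub>G\<^esub> x" for y
    proof -
      from that obtain m where m: "m \<in> M" "y = m \<otimes>\<^bsub>G\<^esub> x" by (auto simp: r_coset_def)
      have "f y = f m \<otimes>\<^bsub>K\<^esub> f x" using f m x by (auto simp: hom_def M.mem_carrier)
      moreover have "f m \<in> N" using m MN by auto
      ultimately show ?thesis using fx
        by (metis N.coset_mult_assoc N.mem_carrier N.rcos_const N.subset N.is_group)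
    qed
    moreover have "x \<in> M #>\<^bsub>G\<^esub> x" using M.rcos_self x M.subgroup_axioms by simp
    ultimately have "(\<lambda>x. N #>\<^bsub>K\<^esub> f x) ` (M #>\<^bsub>G\<^esub> x) = {N #>\<^bsub>K\<^esub> f x}"
      by (intro subset_antisym subsetI) blast+
    then show ?thesis by (simp add: induced_def)
  qed
  show "x \<in> carrier G \<Longrightarrow> induced K N f (M #>\<^bsub>G\<^esub> x) = N #>\<^bsub>K\<^esub> f x" by (rule c)
  show "induced K N f \<in> hom (G Mod M) (K Mod N)"
  proof (rule homI)
    fix u assume "u \<in> carrier (G Mod M)"
    then obtain x where "x \<in> carrier G" "u = M #>\<^bsub>G\<^esub> x" by (auto simp: carrier_FactGroup)
    then show "induced K N f u \<in> carrier (K Mod N)"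
      using f by (auto simp: c carrier_FactGroup hom_def)
  next
    fix u v assume "u \<in> carrier (G Mod M)" "v \<in> carrier (G Mod M)"
    then obtain x y where x: "x \<in> carrier G" "u = M #>\<^bsub>G\<^esub> x" and y: "y \<in> carrier G" "v = M #>\<^bsub>G\<^esub> y"
      by (auto simp: carrier_FactGroup)
    moreover have "f x \<in> carrier K" "f y \<in> carrier K" "f (x \<otimes>\<^bsub>G\<^esub> y) = f x \<otimes>\<^bsub>K\<^esub> f y"
      using f x y by (auto simp: hom_def)
    ultimately show "induced K N f (u \<otimes>\<^bsub>G Mod M\<^esub> v)
        = induced K N f u \<otimes>\<^bsub>K Mod N\<^esub> induced K N f v"
      by (simp add: M.rcos_sum N.rcos_sum c)
  qed
qed

section \<open>Abelian groups given by generators and relators\<close>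

definition presented :: "'a set \<Rightarrow> ('a \<Rightarrow>\<^sub>0 int) set \<Rightarrow> ('a \<Rightarrow>\<^sub>0 int) set monoid" where
  "presented Q R = free_Abelian_group Q Mod generate (free_Abelian_group Q) R"

text \<open>Pure tensors and wedges are both classes of this kind, so generation, lifting and
  functoriality are proved once for arbitrary relators.\<close>

definition gen_class :: "'a set \<Rightarrow> ('a \<Rightarrow>\<^sub>0 int) set \<Rightarrow> 'a \<Rightarrow> ('a \<Rightarrow>\<^sub>0 int) set" where
  "gen_class Q R x = generate (free_Abelian_group Q) R #>\<^bsub>free_Abelian_group Q\<^esub> frag_of x"

context
  fixes Q :: "'a set" and R :: "('a \<Rightarrow>\<^sub>0 int) set"
  assumes R: "R \<subseteq> carrier (free_Abelian_group Q)"
begin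

abbreviation (input) "FQ \<equiv> free_Abelian_group Q"
abbreviation (input) "NQ \<equiv> generate FQ R"

lemma normal_generate_rels: "NQ \<lhd> FQ"
  using R by (simp add: abelian_free_Abelian_group comm_group.subgroup_imp_normal
      group.generate_is_subgroup)

lemma comm_group_presented: "comm_group (presented Q R)"
  unfolding presented_def
  using R abelian_free_Abelian_group comm_group.abelian_FactGroup group.generate_is_subgroup
    group_free_Abelian_group by blast

lemma gen_class_closed: "x \<in> Q \<Longrightarrow> gen_class Q R x \<in> carrier (presented Q R)"
  unfolding presented_def gen_class_def carrier_FactGroup by force

lemma gen_class_hom: "(\<lambda>c. NQ #>\<^bsub>FQ\<^esub> c) \<in> hom FQ (presented Q R)"
  unfolding presented_def by (rule normal.r_coset_hom_Mod[OF normal_generate_rels])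

lemma rel_eq_one: "r \<in> R \<Longrightarrow> NQ #>\<^bsub>FQ\<^esub> r = \<one>\<^bsub>presented Q R\<^esub>"
  using subsetD[OF R] unfolding presented_def one_FactGroup
  by (intro group.coset_join2) (auto intro: generate.incl group.generate_is_subgroup[OF _ R] simp del: carrier_free_Abelian_group_iff)

lemma presented_generated:
  "generate (presented Q R) (gen_class Q R ` Q) = carrier (presented Q R)"
proof -
  interpret P: comm_group "presented Q R" by (rule comm_group_presented)
  interpret p: group_hom FQ "presented Q R" "\<lambda>c. NQ #>\<^bsub>FQ\<^esub> c"
    by (simp add: group_hom_def group_hom_axioms_def gen_class_hom P.is_group)
  let ?P = "\<lambda>c. NQ #>\<^bsub>FQ\<^esub> c \<in> generate (presented Q R) (gen_class Q R ` Q)"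
  have sub: "gen_class Q R ` Q \<subseteq> carrier (presented Q R)" using gen_class_closed by auto
  have "NQ #>\<^bsub>FQ\<^esub> c \<in> generate (presented Q R) (gen_class Q R ` Q)"
    if "Poly_Mapping.keys c \<subseteq> Q" for c
  proof (rule free_Abelian_group_induct[OF that])
    show "?P 0" using p.hom_one by (simp add: generate.one)
  next
    fix x y assume xy: "Poly_Mapping.keys x \<subseteq> Q" "Poly_Mapping.keys y \<subseteq> Q" "?P x" "?P y"
    have "x - y = x \<otimes>\<^bsub>FQ\<^esub> inv\<^bsub>FQ\<^esub> y" using xy by simp
    then have "NQ #>\<^bsub>FQ\<^esub> (x - y) = (NQ #>\<^bsub>FQ\<^esub> x) \<otimes>\<^bsub>presented Q R\<^esub>
        inv\<^bsub>presented Q R\<^esub> (NQ #>\<^bsub>FQ\<^esub> y)"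
      using xy by (metis carrier_free_Abelian_group_iff p.hom_inv p.hom_mult p.G.inv_closed)
    then show "?P (x - y)" using xy sub by (simp add: generate.eng P.generate_m_inv_closed)
  next
    fix a assume "a \<in> Q"
    then show "?P (frag_of a)" by (force intro: generate.incl simp: gen_class_def)
  qed
  then have "carrier (presented Q R) \<subseteq> generate (presented Q R) (gen_class Q R ` Q)"
    by (auto simp: presented_def carrier_FactGroup)
  then show ?thesis using P.generate_incl[OF sub] by auto
qed

text \<open>The extension of \<open>f\<close> to the free abelian group is only obtained inside the
  proof. Hence \<open>rels\<close> asks that every such extension kill the relators, and an
  application has to evaluate a relator from the values on generators alone.\<close>

lemma presented_lift:
  assumes G: "comm_group G" and f: "f \<in> Q \<rightarrow> carrier G"
    and rels: "\<And>h r. \<lbrakk>h \<in> hom FQ G; \<And>x. x \<in> Q \<Longrightarrow> h (frag_of x) = f x; r \<in> R\<rbrakk> \<Longrightarrow> h r = \<one>\<^bsub>G\<^esub>"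
  obtains g where "g \<in> hom (presented Q R) G" "\<And>x. x \<in> Q \<Longrightarrow> g (gen_class Q R x) = f x"
proof -
  interpret G: comm_group G by fact
  obtain h where h: "h \<in> hom FQ G" "\<And>x. x \<in> Q \<Longrightarrow> h (frag_of x) = f x"
    using G.free_Abelian_group_universal[of f Q] f by blast
  interpret h: group_hom FQ G h
    by (simp add: group_hom_def group_hom_axioms_def h G.is_group)
  interpret N: normal NQ FQ by (rule normal_generate_rels)
  have one: "h c = \<one>\<^bsub>G\<^esub>" if "c \<in> NQ" for c
  proof -
    have "NQ \<subseteq> kernel FQ G h"
      by (rule group.generate_subgroup_incl)
        (use subsetD[OF R] rels[OF h] h.subgroup_kernel in \<open>auto simp: kernel_def simp del: carrier_free_Abelian_group_iff\<close>)
    then show ?thesis using that by (auto simp: kernel_def)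
  qed
  have "h x = h y" if x: "x \<in> carrier FQ" and y: "y \<in> carrier FQ" and e: "NQ #>\<^bsub>FQ\<^esub> x = NQ #>\<^bsub>FQ\<^esub> y" for x y
  proof -
    have "x \<in> NQ #>\<^bsub>FQ\<^esub> y" using e group.rcos_self[OF _ x N.subgroup_axioms] by auto
    then obtain c where c: "c \<in> NQ" "x = c \<otimes>\<^bsub>FQ\<^esub> y" by (auto simp: r_coset_def)
    then have "h x = h c \<otimes>\<^bsub>G\<^esub> h y" using y by (metis N.mem_carrier h.hom_mult)
    then show ?thesis using one[OF c(1)] y by simp
  qed
  then obtain g where "g \<in> hom (FQ Mod NQ) G" "\<And>x. x \<in> carrier FQ \<Longrightarrow> g (NQ #>\<^bsub>FQ\<^esub> x) = h x"
    using FactGroup_universal[OF h(1) normal_generate_rels] by metis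
  then show thesis
    using that[of g] h(2) unfolding presented_def gen_class_def by simp
qed

end

lemma hom_presented_eqI:
  assumes R: "R \<subseteq> carrier (free_Abelian_group Q)" and "group G"
    and "h \<in> hom (presented Q R) G" "h' \<in> hom (presented Q R) G"
    and "\<And>x. x \<in> Q \<Longrightarrow> h (gen_class Q R x) = h' (gen_class Q R x)"
    and "t \<in> carrier (presented Q R)"
  shows "h t = h' t"
  using hom_eq_on_generate[OF _ assms(2-4), of "gen_class Q R ` Q" t] assms
    comm_group_presented[OF R] presented_generated[OF R] gen_class_closed[OF R]
  by (auto simp: comm_group_def)

text \<open>Relators need only land in the subgroup generated by the target relators; since the
  extended map is a homomorphism, the subgroup generated by the source relators then lands there
  too.\<close>

lemma induced_presented:
  assumes R: "R \<subseteq> carrier (free_Abelian_group Q)" and S: "S \<subseteq> carrier (free_Abelian_group Y)"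
    and u: "u \<in> Q \<rightarrow> Y"
    and RS: "frag_extend (\<lambda>x. frag_of (u x)) ` R \<subseteq> generate (free_Abelian_group Y) S"
  defines "h \<equiv> induced (free_Abelian_group Y) (generate (free_Abelian_group Y) S)
                (frag_extend (\<lambda>x. frag_of (u x)))"
  shows induced_presented_hom: "h \<in> hom (presented Q R) (presented Y S)"
    and induced_presented_class: "x \<in> Q \<Longrightarrow> h (gen_class Q R x) = gen_class Y S (u x)"
proof -
  let ?e = "frag_extend (\<lambda>x. frag_of (u x))"
  have e: "?e \<in> hom (free_Abelian_group Q) (free_Abelian_group Y)"
  proof (rule homI)
    fix c assume "c \<in> carrier (free_Abelian_group Q)"
    then show "?e c \<in> carrier (free_Abelian_group Y)"
      using keys_frag_extend[of "\<lambda>x. frag_of (u x)" c] u by fastforce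
  qed (simp add: frag_extend_add)
  interpret e: group_hom "free_Abelian_group Q" "free_Abelian_group Y" ?e
    by (simp add: group_hom_def group_hom_axioms_def e)
  have "?e ` generate (free_Abelian_group Q) R = generate (free_Abelian_group Y) (?e ` R)"
    using e.generate_img[OF R] by simp
  also have "\<dots> \<subseteq> generate (free_Abelian_group Y) S"
    by (rule group.generate_subgroup_incl[OF _ RS])
       (simp_all add: group.generate_is_subgroup S)
  finally have sub: "?e ` generate (free_Abelian_group Q) R \<subseteq> generate (free_Abelian_group Y) S" .
  note ind = induced_hom[OF normal_generate_rels[OF R] normal_generate_rels[OF S] e sub]
  show "h \<in> hom (presented Q R) (presented Y S)"
    unfolding h_def presented_def by (rule ind)
  show "x \<in> Q \<Longrightarrow> h (gen_class Q R x) = gen_class Y S (u x)"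
    unfolding h_def gen_class_def by (subst ind) auto
qed

section \<open>Universal properties of the tensor product and the exterior square\<close>

definition bilinear ::
  "('a, 'c) monoid_scheme \<Rightarrow> ('b, 'd) monoid_scheme \<Rightarrow> ('e, 'f) monoid_scheme \<Rightarrow> ('a \<Rightarrow> 'b \<Rightarrow> 'e) \<Rightarrow> bool" where
  "bilinear A B G \<beta> \<longleftrightarrow>
     (\<forall>a\<in>carrier A. (\<lambda>b. \<beta> a b) \<in> hom B G) \<and> (\<forall>b\<in>carrier B. (\<lambda>a. \<beta> a b) \<in> hom A G)"

lemma bilinearD:
  assumes "bilinear A B G \<beta>"
  shows bilinear_closed: "\<lbrakk>a \<in> carrier A; b \<in> carrier B\<rbrakk> \<Longrightarrow> \<beta> a b \<in> carrier G"
    and bilinear_left: "b \<in> carrier B \<Longrightarrow> (\<lambda>a. \<beta> a b) \<in> hom A G"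
    and bilinear_right: "a \<in> carrier A \<Longrightarrow> \<beta> a \<in> hom B G"
  using assms by (auto simp: bilinear_def intro: hom_in_carrier)

definition ptensor ::
  "('a, 'c) monoid_scheme \<Rightarrow> ('b, 'd) monoid_scheme \<Rightarrow> 'a \<Rightarrow> 'b \<Rightarrow> ('a \<times> 'b \<Rightarrow>\<^sub>0 int) set" where
  "ptensor A B a b = gen_class (carrier A \<times> carrier B) (bilin_rels A B) (a, b)"

definition wedge :: "('a, 'c) monoid_scheme \<Rightarrow> 'a \<Rightarrow> 'a \<Rightarrow> ('a \<times> 'a \<Rightarrow>\<^sub>0 int) set" where
  "wedge A a b = gen_class (carrier A \<times> carrier A) (bilin_rels A A \<union> {frag_of (a, a) | a. a \<in> carrier A}) (a, b)"

lemma frag_three_keys: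
  assumes "x \<in> Q" "y \<in> Q" "z \<in> Q"
  shows "Poly_Mapping.keys (frag_of x - frag_of y - frag_of z :: 'x \<Rightarrow>\<^sub>0 int) \<subseteq> Q"
  using assms keys_diff[of "frag_of x - frag_of y" "frag_of z"] keys_diff[of "frag_of x" "frag_of y"]
  by (auto split: if_splits)

lemma bilin_rels_carrier:
  assumes "group A" "group B"
  shows "bilin_rels A B \<subseteq> carrier (free_Abelian_group (carrier A \<times> carrier B))"
proof -
  interpret A: group A by fact
  interpret B: group B by fact
  show ?thesis
    unfolding bilin_rels_def
    by (intro Un_least subsetI) (elim CollectE exE conjE, simp only: carrier_free_Abelian_group_iff,
      rule frag_three_keys, simp_all)+
qed

lemma ext_rels_carrier:
  assumes "group A"
  shows "bilin_rels A A \<union> {frag_of (a, a) | a. a \<in> carrier A}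
    \<subseteq> carrier (free_Abelian_group (carrier A \<times> carrier A))"
  using bilin_rels_carrier[OF assms assms] by auto

lemma tensor_presented: "tensor A B = presented (carrier A \<times> carrier B) (bilin_rels A B)"
  by (simp add: tensor_def presented_def tensor_sub_def)

lemma ext_square_presented:
  "ext_square A = presented (carrier A \<times> carrier A) (bilin_rels A A \<union> {frag_of (a, a) | a. a \<in> carrier A})"
  by (simp add: ext_square_def presented_def ext_square_sub_def)

text \<open>Evaluating a relator produces a commutator of two values of \<open>\<beta>\<close>.
  These values commute because they are images under \<open>h\<close> of elements of a free abelian
  group.\<close>

lemma bilin_rels_vanish:
  assumes "bilinear A B G \<beta>" "group A" "group B" "group G"
    and h: "h \<in> hom (free_Abelian_group (carrier A \<times> carrier B)) G"
    and hf: "\<And>x. x \<in> carrier A \<times> carrier B \<Longrightarrow> h (frag_of x) = \<beta> (fst x) (snd x)"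
    and r: "r \<in> bilin_rels A B"
  shows "h r = \<one>\<^bsub>G\<^esub>"
proof -
  interpret A: group A by fact
  interpret B: group B by fact
  interpret G: group G by fact
  interpret h: group_hom "free_Abelian_group (carrier A \<times> carrier B)" G h
    by (simp add: group_hom_def group_hom_axioms_def h G.is_group)
  have *: "h (frag_of x - frag_of y - frag_of z) = h (frag_of x) \<otimes>\<^bsub>G\<^esub> inv\<^bsub>G\<^esub> h (frag_of y) \<otimes>\<^bsub>G\<^esub> inv\<^bsub>G\<^esub> h (frag_of z)"
    if "x \<in> carrier A \<times> carrier B" "y \<in> carrier A \<times> carrier B" "z \<in> carrier A \<times> carrier B" for x y z
  proof -
    let ?F = "free_Abelian_group (carrier A \<times> carrier B)"
    have "frag_of x - frag_of y - frag_of z = frag_of x \<otimes>\<^bsub>?F\<^esub> inv\<^bsub>?F\<^esub> frag_of y \<otimes>\<^bsub>?F\<^esub> inv\<^bsub>?F\<^esub> frag_of z"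
      using that by simp
    moreover have "frag_of x \<in> carrier ?F" "frag_of y \<in> carrier ?F" "frag_of z \<in> carrier ?F"
      using that by auto
    ultimately show ?thesis by (simp only: h.hom_mult h.hom_inv h.G.inv_closed h.G.m_closed)
  qed
  have b1: "\<beta> a b \<in> carrier G" if "a \<in> carrier A" "b \<in> carrier B" for a b
    using bilinear_closed[OF assms(1)] that by auto
  have b2: "\<beta> (a \<otimes>\<^bsub>A\<^esub> a') b = \<beta> a b \<otimes>\<^bsub>G\<^esub> \<beta> a' b"
    if "a \<in> carrier A" "a' \<in> carrier A" "b \<in> carrier B" for a a' b
    using assms(1) that by (auto simp: bilinear_def hom_def)
  have b3: "\<beta> a (b \<otimes>\<^bsub>B\<^esub> b') = \<beta> a b \<otimes>\<^bsub>G\<^esub> \<beta> a b'"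
    if "a \<in> carrier A" "b \<in> carrier B" "b' \<in> carrier B" for a b b'
    using assms(1) that by (auto simp: bilinear_def hom_def)
  have comm: "\<beta> a b \<otimes>\<^bsub>G\<^esub> \<beta> a' b = \<beta> a' b \<otimes>\<^bsub>G\<^esub> \<beta> a b \<and> \<beta> a b \<otimes>\<^bsub>G\<^esub> \<beta> a b' = \<beta> a b' \<otimes>\<^bsub>G\<^esub> \<beta> a b"
    if "a \<in> carrier A" "a' \<in> carrier A" "b \<in> carrier B" "b' \<in> carrier B" for a a' b b'
  proof -
    have "h (frag_of x) \<otimes>\<^bsub>G\<^esub> h (frag_of y) = h (frag_of y) \<otimes>\<^bsub>G\<^esub> h (frag_of x)"
      if "x \<in> carrier A \<times> carrier B" "y \<in> carrier A \<times> carrier B" for x y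
      using h.hom_mult[of "frag_of x" "frag_of y"] h.hom_mult[of "frag_of y" "frag_of x"] that
      by (simp add: add.commute)
    from this[of "(a,b)" "(a',b)"] this[of "(a,b)" "(a,b')"] show ?thesis using that by (simp add: hf)
  qed
  have cancel: "x \<otimes>\<^bsub>G\<^esub> y \<otimes>\<^bsub>G\<^esub> inv\<^bsub>G\<^esub> x \<otimes>\<^bsub>G\<^esub> inv\<^bsub>G\<^esub> y = \<one>\<^bsub>G\<^esub>"
    if "x \<in> carrier G" "y \<in> carrier G" "x \<otimes>\<^bsub>G\<^esub> y = y \<otimes>\<^bsub>G\<^esub> x" for x y
    using that by (simp add: G.m_assoc)
  from r show ?thesis
    unfolding bilin_rels_def
  proof (elim UnE CollectE exE conjE)
    fix a a' b
    assume "r = frag_of (a \<otimes>\<^bsub>A\<^esub> a', b) - frag_of (a, b) - frag_of (a', b)"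
      and "a \<in> carrier A" "a' \<in> carrier A" "b \<in> carrier B"
    then show ?thesis
      using cancel[of "\<beta> a b" "\<beta> a' b"] comm[of a a' b b] by (simp add: * hf b2 b1)
  next
    fix a b b'
    assume "r = frag_of (a, b \<otimes>\<^bsub>B\<^esub> b') - frag_of (a, b) - frag_of (a, b')"
      and "a \<in> carrier A" "b \<in> carrier B" "b' \<in> carrier B"
    then show ?thesis
      using cancel[of "\<beta> a b" "\<beta> a b'"] comm[of a a b b'] by (simp add: * hf b3 b1)
  qed
qed

lemma presented_additive:
  assumes R: "R \<subseteq> carrier (free_Abelian_group Q)"
    and r: "frag_of x - frag_of y - frag_of z \<in> R" and "x \<in> Q" "y \<in> Q" "z \<in> Q"
  shows "gen_class Q R x = gen_class Q R y \<otimes>\<^bsub>presented Q R\<^esub> gen_class Q R z"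
proof -
  let ?F = "free_Abelian_group Q" and ?P = "presented Q R"
  interpret P: comm_group ?P by (rule comm_group_presented[OF R])
  have *: "generate ?F R #>\<^bsub>?F\<^esub> (c + d)
      = (generate ?F R #>\<^bsub>?F\<^esub> c) \<otimes>\<^bsub>?P\<^esub> (generate ?F R #>\<^bsub>?F\<^esub> d)"
    if "c \<in> carrier ?F" "d \<in> carrier ?F" for c d
    using gen_class_hom[OF R] that by (auto simp: hom_def)
  have yz: "frag_of y + frag_of z \<in> carrier ?F" using assms keys_add[of "frag_of y" "frag_of z"] by auto
  have "gen_class Q R x = generate ?F R #>\<^bsub>?F\<^esub> ((frag_of x - frag_of y - frag_of z) + (frag_of y + frag_of z))"
    by (simp add: gen_class_def)
  also have "\<dots> = \<one>\<^bsub>?P\<^esub> \<otimes>\<^bsub>?P\<^esub> (gen_class Q R y \<otimes>\<^bsub>?P\<^esub> gen_class Q R z)"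
    using subsetD[OF R r] assms yz
    by (subst *) (auto simp: rel_eq_one[OF R r] * gen_class_def simp del: carrier_free_Abelian_group_iff)
  finally show ?thesis
    using gen_class_closed[OF R] assms by simp
qed

context
  fixes A :: "('a, 'c) monoid_scheme" and B :: "('b, 'd) monoid_scheme"
  assumes A: "group A" and B: "group B"
begin

lemma comm_group_tensor: "comm_group (tensor A B)"
  by (simp add: tensor_presented comm_group_presented bilin_rels_carrier A B)

lemma bilinear_ptensor: "bilinear A B (tensor A B) (ptensor A B)"
proof -
  interpret A: group A by (rule A)
  interpret B: group B by (rule B)
  note rc = bilin_rels_carrier[OF A B]
  show ?thesis
    unfolding bilinear_def
  proof (intro conjI ballI homI)
    fix a b b' assume "a \<in> carrier A" "b \<in> carrier B" "b' \<in> carrier B"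
    then show "ptensor A B a (b \<otimes>\<^bsub>B\<^esub> b') = ptensor A B a b \<otimes>\<^bsub>tensor A B\<^esub> ptensor A B a b'"
      unfolding ptensor_def tensor_presented
      by (intro presented_additive[OF rc]) (auto simp: bilin_rels_def)
  next
    fix a a' b assume "a \<in> carrier A" "a' \<in> carrier A" "b \<in> carrier B"
    then show "ptensor A B (a \<otimes>\<^bsub>A\<^esub> a') b = ptensor A B a b \<otimes>\<^bsub>tensor A B\<^esub> ptensor A B a' b"
      unfolding ptensor_def tensor_presented
      by (intro presented_additive[OF rc]) (auto simp: bilin_rels_def)
  qed (auto simp: ptensor_def tensor_presented gen_class_closed[OF rc])
qed

lemma tensor_lift:
  assumes "comm_group G" "bilinear A B G \<beta>"
  obtains h where "h \<in> hom (tensor A B) G"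
    "\<And>a b. \<lbrakk>a \<in> carrier A; b \<in> carrier B\<rbrakk> \<Longrightarrow> h (ptensor A B a b) = \<beta> a b"
proof (rule presented_lift[OF bilin_rels_carrier[OF A B] assms(1), of "\<lambda>x. \<beta> (fst x) (snd x)"])
  show "(\<lambda>x. \<beta> (fst x) (snd x)) \<in> carrier A \<times> carrier B \<rightarrow> carrier G"
    using bilinear_closed[OF assms(2)] by auto
next
  fix h r assume "h \<in> hom (free_Abelian_group (carrier A \<times> carrier B)) G"
    "\<And>x. x \<in> carrier A \<times> carrier B \<Longrightarrow> h (frag_of x) = \<beta> (fst x) (snd x)" "r \<in> bilin_rels A B"
  then show "h r = \<one>\<^bsub>G\<^esub>"
    using bilin_rels_vanish[OF assms(2) A B] assms(1) by (auto simp: comm_group_def)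
next
  fix g assume "g \<in> hom (presented (carrier A \<times> carrier B) (bilin_rels A B)) G"
    "\<And>x. x \<in> carrier A \<times> carrier B \<Longrightarrow> g (gen_class (carrier A \<times> carrier B) (bilin_rels A B) x) = \<beta> (fst x) (snd x)"
  then show thesis using that[of g] by (auto simp: tensor_presented ptensor_def)
qed

lemma tensor_eqI:
  assumes "group G" "h \<in> hom (tensor A B) G" "h' \<in> hom (tensor A B) G"
    and "\<And>a b. \<lbrakk>a \<in> carrier A; b \<in> carrier B\<rbrakk> \<Longrightarrow> h (ptensor A B a b) = h' (ptensor A B a b)"
    and "t \<in> carrier (tensor A B)"
  shows "h t = h' t"
  using hom_presented_eqI[OF bilin_rels_carrier[OF A B] assms(1)] assms
  by (auto simp: tensor_presented ptensor_def)

end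

lemma frag_extend_bilin:
  assumes f: "f \<in> hom A' A" and g: "g \<in> hom B' B" and r: "r \<in> bilin_rels A' B'"
  shows "frag_extend (\<lambda>x. frag_of ((\<lambda>(a, b). (f a, g b)) x)) r \<in> bilin_rels A B"
  using r unfolding bilin_rels_def
proof (elim UnE CollectE exE conjE, goal_cases)
  case (1 a a' b)
  then show ?case
    using f g by (intro UnI1 CollectI exI[of _ "f a"] exI[of _ "f a'"] exI[of _ "g b"])
      (auto simp: frag_extend_diff hom_def)
next
  case (2 a b b')
  then show ?case
    using f g by (intro UnI2 CollectI exI[of _ "f a"] exI[of _ "g b"] exI[of _ "g b'"])
      (auto simp: frag_extend_diff hom_def)
qed

lemma tensor_map:
  assumes A: "group A" "group A'" and B: "group B" "group B'"
    and f: "f \<in> hom A' A" and g: "g \<in> hom B' B"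
  shows tensor_map_hom: "tensor_map A B f g \<in> hom (tensor A' B') (tensor A B)"
    and tensor_map_ptensor: "\<lbrakk>a \<in> carrier A'; b \<in> carrier B'\<rbrakk>
          \<Longrightarrow> tensor_map A B f g (ptensor A' B' a b) = ptensor A B (f a) (g b)"
proof -
  let ?u = "\<lambda>(a, b). (f a, g b)"
  have u: "?u \<in> carrier A' \<times> carrier B' \<rightarrow> carrier A \<times> carrier B"
    using f g by (auto simp: hom_def)
  have e: "tensor_map A B f g = induced (free_Abelian_group (carrier A \<times> carrier B))
      (generate (free_Abelian_group (carrier A \<times> carrier B)) (bilin_rels A B))
      (frag_extend (\<lambda>x. frag_of (?u x)))"
    by (simp add: tensor_map_def tensor_sub_def case_prod_unfold)
  have sub: "frag_extend (\<lambda>x. frag_of (?u x)) ` bilin_rels A' B'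
      \<subseteq> generate (free_Abelian_group (carrier A \<times> carrier B)) (bilin_rels A B)"
    using frag_extend_bilin[OF f g] by (auto intro: generate.incl)
  note i = induced_presented_hom[OF bilin_rels_carrier[OF A(2) B(2)] bilin_rels_carrier[OF A(1) B(1)] u sub]
    induced_presented_class[OF bilin_rels_carrier[OF A(2) B(2)] bilin_rels_carrier[OF A(1) B(1)] u sub]
  show "tensor_map A B f g \<in> hom (tensor A' B') (tensor A B)"
    unfolding e tensor_presented by (rule i)
  show "\<lbrakk>a \<in> carrier A'; b \<in> carrier B'\<rbrakk>
          \<Longrightarrow> tensor_map A B f g (ptensor A' B' a b) = ptensor A B (f a) (g b)"
    unfolding e ptensor_def by (subst i) auto
qed

context
  fixes A :: "('a, 'c) monoid_scheme"
  assumes A: "group A"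
begin

lemma comm_group_ext_square: "comm_group (ext_square A)"
  by (simp only: ext_square_presented comm_group_presented[OF ext_rels_carrier[OF A]])

lemma bilinear_wedge: "bilinear A A (ext_square A) (wedge A)"
proof -
  interpret A: group A by (rule A)
  note rc = ext_rels_carrier[OF A]
  show ?thesis
    unfolding bilinear_def
  proof (intro conjI ballI homI)
    fix a b b' assume "a \<in> carrier A" "b \<in> carrier A" "b' \<in> carrier A"
    then show "wedge A a (b \<otimes>\<^bsub>A\<^esub> b') = wedge A a b \<otimes>\<^bsub>ext_square A\<^esub> wedge A a b'"
      unfolding wedge_def ext_square_presented
      by (intro presented_additive[OF rc]) (auto simp: bilin_rels_def)
  next
    fix a a' b assume "a \<in> carrier A" "a' \<in> carrier A" "b \<in> carrier A"
    then show "wedge A (a \<otimes>\<^bsub>A\<^esub> a') b = wedge A a b \<otimes>\<^bsub>ext_square A\<^esub> wedge A a' b"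
      unfolding wedge_def ext_square_presented
      by (intro presented_additive[OF rc]) (auto simp: bilin_rels_def)
  next
    fix a b assume "a \<in> carrier A" "b \<in> carrier A"
    then show "wedge A a b \<in> carrier (ext_square A)" "wedge A a b \<in> carrier (ext_square A)"
      by (simp_all only: wedge_def ext_square_presented)
        (auto intro!: gen_class_closed[OF rc])
  qed
qed

lemma wedge_closed: "a \<in> carrier A \<Longrightarrow> b \<in> carrier A \<Longrightarrow> wedge A a b \<in> carrier (ext_square A)"
  using bilinear_wedge by (auto simp: bilinear_def hom_def)

lemma wedge_self: "a \<in> carrier A \<Longrightarrow> wedge A a a = \<one>\<^bsub>ext_square A\<^esub>"
  unfolding wedge_def ext_square_presented gen_class_def
  by (rule rel_eq_one[OF ext_rels_carrier[OF A]]) auto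

lemma ext_square_lift:
  assumes "comm_group G" "bilinear A A G \<beta>" and alt: "\<And>a. a \<in> carrier A \<Longrightarrow> \<beta> a a = \<one>\<^bsub>G\<^esub>"
  obtains h where "h \<in> hom (ext_square A) G"
    "\<And>a b. \<lbrakk>a \<in> carrier A; b \<in> carrier A\<rbrakk> \<Longrightarrow> h (wedge A a b) = \<beta> a b"
proof (rule presented_lift[OF ext_rels_carrier[OF A] assms(1), of "\<lambda>x. \<beta> (fst x) (snd x)"])
  show "(\<lambda>x. \<beta> (fst x) (snd x)) \<in> carrier A \<times> carrier A \<rightarrow> carrier G"
    using bilinear_closed[OF assms(2)] by auto
next
  fix h r assume h: "h \<in> hom (free_Abelian_group (carrier A \<times> carrier A)) G"
    "\<And>x. x \<in> carrier A \<times> carrier A \<Longrightarrow> h (frag_of x) = \<beta> (fst x) (snd x)"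
    and "r \<in> bilin_rels A A \<union> {frag_of (a, a) | a. a \<in> carrier A}"
  then show "h r = \<one>\<^bsub>G\<^esub>"
    using bilin_rels_vanish[OF assms(2) A A] assms(1) alt by (auto simp: comm_group_def)
next
  fix g assume "g \<in> hom (presented (carrier A \<times> carrier A) (bilin_rels A A \<union> {frag_of (a, a) | a. a \<in> carrier A})) G"
    "\<And>x. x \<in> carrier A \<times> carrier A \<Longrightarrow> g (gen_class (carrier A \<times> carrier A) (bilin_rels A A \<union> {frag_of (a, a) | a. a \<in> carrier A}) x) = \<beta> (fst x) (snd x)"
  then show thesis using that[of g] by (auto simp: ext_square_presented wedge_def)
qed

lemma ext_square_generated:
  "generate (ext_square A) {wedge A a b | a b. a \<in> carrier A \<and> b \<in> carrier A} = carrier (ext_square A)"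
proof -
  have "{wedge A a b | a b. a \<in> carrier A \<and> b \<in> carrier A}
      = gen_class (carrier A \<times> carrier A) (bilin_rels A A \<union> {frag_of (a, a) | a. a \<in> carrier A}) ` (carrier A \<times> carrier A)"
    by (auto simp: wedge_def)
  then show ?thesis
    by (simp only: ext_square_presented presented_generated[OF ext_rels_carrier[OF A]])
qed

lemma ext_square_eqI:
  assumes "group G" "h \<in> hom (ext_square A) G" "h' \<in> hom (ext_square A) G"
    and "\<And>a b. \<lbrakk>a \<in> carrier A; b \<in> carrier A\<rbrakk> \<Longrightarrow> h (wedge A a b) = h' (wedge A a b)"
    and "t \<in> carrier (ext_square A)"
  shows "h t = h' t"
  by (rule hom_presented_eqI[OF ext_rels_carrier[OF A] assms(1)])
    (use assms in \<open>auto simp: ext_square_presented wedge_def\<close>)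

end

lemma ext_square_map:
  assumes A: "group A" "group A'" and f: "f \<in> hom A' A"
  shows ext_square_map_hom: "ext_square_map A f \<in> hom (ext_square A') (ext_square A)"
    and ext_square_map_wedge: "\<lbrakk>a \<in> carrier A'; b \<in> carrier A'\<rbrakk>
          \<Longrightarrow> ext_square_map A f (wedge A' a b) = wedge A (f a) (f b)"
proof -
  let ?u = "\<lambda>(a, b). (f a, f b)"
  have u: "?u \<in> carrier A' \<times> carrier A' \<rightarrow> carrier A \<times> carrier A"
    using f by (auto simp: hom_def)
  have e: "ext_square_map A f = induced (free_Abelian_group (carrier A \<times> carrier A))
      (generate (free_Abelian_group (carrier A \<times> carrier A)) (bilin_rels A A \<union> {frag_of (a, a) | a. a \<in> carrier A}))
      (frag_extend (\<lambda>x. frag_of (?u x)))"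
    by (simp add: ext_square_map_def ext_square_sub_def case_prod_unfold)
  have sub: "frag_extend (\<lambda>x. frag_of (?u x)) ` (bilin_rels A' A' \<union> {frag_of (a, a) | a. a \<in> carrier A'})
      \<subseteq> generate (free_Abelian_group (carrier A \<times> carrier A)) (bilin_rels A A \<union> {frag_of (a, a) | a. a \<in> carrier A})"
    using frag_extend_bilin[OF f f] f by (auto intro!: generate.incl simp: hom_def)
  note i = induced_presented_hom[OF ext_rels_carrier[OF A(2)] ext_rels_carrier[OF A(1)] u sub]
    induced_presented_class[OF ext_rels_carrier[OF A(2)] ext_rels_carrier[OF A(1)] u sub]
  show "ext_square_map A f \<in> hom (ext_square A') (ext_square A)"
    unfolding e ext_square_presented by (rule i)
  show "\<lbrakk>a \<in> carrier A'; b \<in> carrier A'\<rbrakk>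
          \<Longrightarrow> ext_square_map A f (wedge A' a b) = wedge A (f a) (f b)"
    unfolding e wedge_def by (subst i) auto
qed

lemma hom_finprod:
  assumes "comm_group G" "comm_group K" "h \<in> hom G K" "finite I" "f \<in> I \<rightarrow> carrier G"
  shows "h (finprod G f I) = finprod K (\<lambda>i. h (f i)) I"
proof -
  interpret G: comm_group G by fact
  interpret K: comm_group K by fact
  interpret h: group_hom G K h using assms(3) by (simp add: group_hom_def group_hom_axioms_def G.is_group K.is_group)
  show ?thesis using assms(4,5)
  proof (induction I)
    case (insert i I)
    then have "(\<lambda>i. h (f i)) \<in> I \<rightarrow> carrier K" "h (f i) \<in> carrier K"
      by (auto simp: Pi_iff)
    with insert show ?case by (simp add: Pi_iff)
  qed simp
qed

text \<open>Used one slot at a time to pass from wedges of basis elements to arbitrary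
  wedges.\<close>

lemma hom_image_generate_subset:
  assumes "group G" "group K" "h \<in> hom G K" "S \<subseteq> carrier G" "generate G S = carrier G"
    and "subgroup H K" "h ` S \<subseteq> H" and "x \<in> carrier G"
  shows "h x \<in> H"
proof -
  interpret h: group_hom G K h using assms by (simp add: group_hom_def group_hom_axioms_def)
  have "h ` carrier G = generate K (h ` S)" using h.generate_img[OF assms(4)] assms(5) by simp
  also have "\<dots> \<subseteq> H" using assms h.H.generate_subgroup_incl by simp
  finally show ?thesis using assms by auto
qed

section \<open>Bases of finitely generated free abelian groups\<close>

text \<open>A basis is packaged with its coordinate functions, and spanning is replaced by the
  condition that vanishing coordinates force triviality. In this form the notion passes easily to
  duals and tensor products; expansion and generation are recovered in \<open>zbasis_expand\<close>
  and \<open>zbasis_generated\<close>.\<close>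

definition zbasis :: "('a, 'c) monoid_scheme \<Rightarrow> 'i set \<Rightarrow> ('i \<Rightarrow> 'a) \<Rightarrow> ('i \<Rightarrow> 'a \<Rightarrow> int) \<Rightarrow> bool" where
  "zbasis A I e c \<longleftrightarrow> comm_group A \<and> finite I \<and> e \<in> I \<rightarrow> carrier A \<and>
     (\<forall>i\<in>I. c i \<in> hom A integer_group) \<and> (\<forall>i\<in>I. \<forall>j\<in>I. c i (e j) = (if i = j then 1 else 0)) \<and>
     (\<forall>a\<in>carrier A. (\<forall>i\<in>I. c i a = 0) \<longrightarrow> a = \<one>\<^bsub>A\<^esub>)"

lemma hom_integer_pow:
  assumes "group A" "u \<in> hom A integer_group" "a \<in> carrier A"
  shows "u (a [^]\<^bsub>A\<^esub> (k::int)) = k * u a"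
  using hom_int_pow[OF assms(2,3,1) group_integer_group] by simp

context
  fixes A :: "('a, 'c) monoid_scheme" and I :: "'i set" and e c
  assumes A: "comm_group A" and I: "finite I" and e: "e \<in> I \<rightarrow> carrier A"
    and c: "\<And>i. i \<in> I \<Longrightarrow> c i \<in> hom A integer_group"
    and ce: "\<And>i j. \<lbrakk>i \<in> I; j \<in> I\<rbrakk> \<Longrightarrow> c i (e j) = (if i = j then 1 else 0)"
begin

interpretation A: comm_group A by (rule A)

lemma coord_combination:
  assumes "j \<in> I"
  shows "c j (finprod A (\<lambda>i. e i [^]\<^bsub>A\<^esub> (y i :: int)) I) = y j"
proof -
  interpret Z: comm_group integer_group by (rule abelian_integer_group)
  have e': "e i \<in> carrier A" if "i \<in> I" for i using e that by auto
  have "c j (finprod A (\<lambda>i. e i [^]\<^bsub>A\<^esub> y i) I) = finprod integer_group (\<lambda>i. c j (e i [^]\<^bsub>A\<^esub> y i)) I"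
    by (rule hom_finprod[OF A abelian_integer_group c I]) (use assms e' in auto)
  also have "\<dots> = finprod integer_group (\<lambda>i. if j = i then y i else \<one>\<^bsub>integer_group\<^esub>) I"
    by (rule Z.finprod_cong) (use assms in \<open>auto simp: simp_implies_def hom_integer_pow[OF A.is_group c] e' ce\<close>)
  also have "\<dots> = y j" by (rule Z.finprod_singleton) (use assms I in auto)
  finally show ?thesis .
qed

text \<open>Rebuilding an element from its coordinates is an endomorphism that fixes every
  \<open>e j\<close>. As these generate, it is the identity, so an element with vanishing
  coordinates is trivial.\<close>

lemma zbasis_generatedI:
  assumes gen: "generate A (e ` I) = carrier A"
  shows "zbasis A I e c"
proof -
  have e': "e i \<in> carrier A" if "i \<in> I" for i using e that by auto
  let ?s = "\<lambda>a. finprod A (\<lambda>i. e i [^]\<^bsub>A\<^esub> c i a) I"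
  have s: "?s \<in> hom A A"
  proof (rule homI)
    fix a b assume "a \<in> carrier A" "b \<in> carrier A"
    then have "?s (a \<otimes>\<^bsub>A\<^esub> b) = finprod A (\<lambda>i. e i [^]\<^bsub>A\<^esub> c i a \<otimes>\<^bsub>A\<^esub> e i [^]\<^bsub>A\<^esub> c i b) I"
      by (intro A.finprod_cong) (auto simp: simp_implies_def e' A.int_pow_mult hom_mult[OF c])
    then show "?s (a \<otimes>\<^bsub>A\<^esub> b) = ?s a \<otimes>\<^bsub>A\<^esub> ?s b" using e' by (simp add: A.finprod_multf Pi_iff)
  qed (use e' in auto)
  have "?s (e j) = e j" if "j \<in> I" for j
  proof -
    have "?s (e j) = finprod A (\<lambda>i. if j = i then e i else \<one>\<^bsub>A\<^esub>) I"
      by (intro A.finprod_cong) (use that in \<open>auto simp: simp_implies_def e' ce\<close>)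
    also have "\<dots> = e j" by (rule A.finprod_singleton) (use that I e in auto)
    finally show ?thesis .
  qed
  then have *: "?s a = a" if "a \<in> carrier A" for a
    using hom_eq_on_generate[OF A.is_group A.is_group s, of "\<lambda>x. x" "e ` I" a] that gen e'
    by (auto simp: hom_def)
  have "a = \<one>\<^bsub>A\<^esub>" if "a \<in> carrier A" "\<forall>i\<in>I. c i a = 0" for a
  proof -
    have "?s a = \<one>\<^bsub>A\<^esub>" using that by (intro A.finprod_one_eqI) auto
    then show ?thesis using * that by simp
  qed
  then show ?thesis using A I e c ce by (simp add: zbasis_def)
qed

end

context
  fixes A :: "('a, 'c) monoid_scheme" and I :: "'i set" and e c
  assumes zb: "zbasis A I e c"
begin

lemma zbasisD:
  shows zbasis_group: "comm_group A" and zbasis_finite: "finite I"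
    and zbasis_elem: "i \<in> I \<Longrightarrow> e i \<in> carrier A"
    and zbasis_coord: "i \<in> I \<Longrightarrow> c i \<in> hom A integer_group"
    and zbasis_delta: "\<lbrakk>i \<in> I; j \<in> I\<rbrakk> \<Longrightarrow> c i (e j) = (if i = j then 1 else 0)"
    and zbasis_zero: "\<lbrakk>a \<in> carrier A; \<And>i. i \<in> I \<Longrightarrow> c i a = 0\<rbrakk> \<Longrightarrow> a = \<one>\<^bsub>A\<^esub>"
  using zb by (auto simp: zbasis_def)

lemma zbasis_coord_combination:
  "j \<in> I \<Longrightarrow> c j (finprod A (\<lambda>i. e i [^]\<^bsub>A\<^esub> (y i :: int)) I) = y j"
  by (rule coord_combination) (use zb in \<open>auto simp: zbasis_def\<close>)

lemma zbasis_eqI: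
  assumes "a \<in> carrier A" "b \<in> carrier A" "\<And>i. i \<in> I \<Longrightarrow> c i a = c i b"
  shows "a = b"
proof -
  interpret A: comm_group A by (rule zbasis_group)
  have "a \<otimes>\<^bsub>A\<^esub> inv\<^bsub>A\<^esub> b = \<one>\<^bsub>A\<^esub>"
  proof (rule zbasis_zero)
    fix i assume i: "i \<in> I"
    interpret h: group_hom A integer_group "c i"
      using zbasis_coord[OF i] by (simp add: group_hom_def group_hom_axioms_def A.is_group)
    show "c i (a \<otimes>\<^bsub>A\<^esub> inv\<^bsub>A\<^esub> b) = 0" using assms i h.hom_inv[of b] by simp
  qed (use assms in simp)
  then show ?thesis using assms by (metis A.inv_equality A.inv_inv A.inv_closed)
qed

lemma zbasis_expand:
  assumes "a \<in> carrier A"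
  shows "a = finprod A (\<lambda>i. e i [^]\<^bsub>A\<^esub> c i a) I"
proof (rule zbasis_eqI)
  interpret A: comm_group A by (rule zbasis_group)
  show "finprod A (\<lambda>i. e i [^]\<^bsub>A\<^esub> c i a) I \<in> carrier A"
    by (rule A.finprod_closed) (auto simp: zbasis_elem)
qed (use assms zbasis_coord_combination in auto)

lemma zbasis_generated: "generate A (e ` I) = carrier A"
proof -
  interpret A: comm_group A by (rule zbasis_group)
  have s: "subgroup (generate A (e ` I)) A" by (rule A.generate_is_subgroup) (use zbasis_elem in auto)
  have "finprod A (\<lambda>i. e i [^]\<^bsub>A\<^esub> (y i::int)) J \<in> generate A (e ` I)" if "J \<subseteq> I" for J y
    using zbasis_finite[THEN rev_finite_subset, OF that] that
  proof (induction J)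
    case empty then show ?case by (simp add: generate.one)
  next
    case (insert j J)
    have "e j [^]\<^bsub>A\<^esub> y j \<in> generate A (e ` I)"
      using insert by (intro A.subgroup_int_pow_closed[OF s]) (auto intro: generate.incl)
    moreover have "finprod A (\<lambda>i. e i [^]\<^bsub>A\<^esub> y i) (insert j J)
        = e j [^]\<^bsub>A\<^esub> y j \<otimes>\<^bsub>A\<^esub> finprod A (\<lambda>i. e i [^]\<^bsub>A\<^esub> y i) J"
      using insert zbasis_elem by (intro A.finprod_insert) auto
    ultimately show ?case using insert by (simp add: generate.eng)
  qed
  then have "carrier A \<subseteq> generate A (e ` I)" using zbasis_expand by (metis order_refl subsetI)
  then show ?thesis using A.generate_incl[of "e ` I"] zbasis_elem by auto
qed

end

lemma comm_group_dual: "comm_group (dual_group A)" if "group A"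
proof -
  interpret A: group A by fact
  show ?thesis
  proof (rule comm_groupI)
    fix x assume x: "x \<in> carrier (dual_group A)"
    let ?y = "\<lambda>a\<in>carrier A. - x a"
    have "?y \<in> carrier (dual_group A)" using x by (auto simp: dual_group_def hom_def)
    moreover have "?y \<otimes>\<^bsub>dual_group A\<^esub> x = \<one>\<^bsub>dual_group A\<^esub>"
      by (auto simp: dual_group_def)
    ultimately show "\<exists>y\<in>carrier (dual_group A). y \<otimes>\<^bsub>dual_group A\<^esub> x = \<one>\<^bsub>dual_group A\<^esub>" by blast
  qed (auto simp: dual_group_def hom_def extensional_def intro!: restrict_ext)
qed

lemma dual_eval_hom: "a \<in> carrier A \<Longrightarrow> (\<lambda>\<phi>. \<phi> a) \<in> hom (dual_group A) integer_group"
  by (auto simp: dual_group_def hom_def)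

text \<open>The restriction is there because elements of \<open>dual_group\<close> are extensional.
  A functional that vanishes at every \<open>e i\<close> vanishes everywhere by generation.\<close>

lemma zbasis_dual:
  assumes "zbasis A I e c"
  shows "zbasis (dual_group A) I (\<lambda>i. restrict (c i) (carrier A)) (\<lambda>i \<phi>. \<phi> (e i))"
proof -
  note b = zbasisD[OF assms]
  interpret A: comm_group A by (rule b)
  have "\<phi> = \<one>\<^bsub>dual_group A\<^esub>" if \<phi>: "\<phi> \<in> carrier (dual_group A)" and z: "\<forall>i\<in>I. \<phi> (e i) = 0" for \<phi>
  proof -
    have h: "\<phi> \<in> hom A integer_group" "\<phi> \<in> extensional (carrier A)"
      using \<phi> by (auto simp: dual_group_def)
    have "\<phi> a = 0" if "a \<in> carrier A" for a
      using hom_eq_on_generate[OF A.is_group group_integer_group h(1), of "\<lambda>_. 0" "e ` I" a] that z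
        zbasis_generated[OF assms] b(3) by (auto simp: hom_def)
    then show ?thesis using h(2) by (auto simp: dual_group_def extensional_def)
  qed
  moreover have "restrict (c i) (carrier A) \<in> carrier (dual_group A)" if "i \<in> I" for i
    using b(4)[OF that] by (auto simp: dual_group_def hom_def)
  ultimately show ?thesis
    using b comm_group_dual[OF A.is_group]
    by (auto simp: zbasis_def intro!: dual_eval_hom)
qed

text \<open>Contraction of the first factor with \<open>u\<close>, that is A \<otimes> B
  \<rightarrow> Z \<otimes> B = B. For \<open>u\<close> a coordinate of a basis of \<open>A\<close>
  this is a \<open>B\<close>-valued coordinate, and \<open>B\<close> may be any abelian group, in
  particular the additive group of \<open>L\<close>.\<close>

definition tensor_eval ::
  "('a, 'c) monoid_scheme \<Rightarrow> ('b, 'd) monoid_scheme \<Rightarrow> ('a \<Rightarrow> int) \<Rightarrow> ('a \<times> 'b \<Rightarrow>\<^sub>0 int) set \<Rightarrow> 'b" where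
  "tensor_eval A B u = (SOME h. h \<in> hom (tensor A B) B \<and>
     (\<forall>a\<in>carrier A. \<forall>b\<in>carrier B. h (ptensor A B a b) = b [^]\<^bsub>B\<^esub> u a))"

context
  fixes A :: "('a, 'c) monoid_scheme" and B :: "('b, 'd) monoid_scheme"
  assumes A: "group A" and B: "comm_group B"
begin

interpretation B: comm_group B by (rule B)

lemma tensor_eval:
  assumes u: "u \<in> hom A integer_group"
  shows tensor_eval_hom: "tensor_eval A B u \<in> hom (tensor A B) B"
    and tensor_eval_ptensor:
      "\<lbrakk>a \<in> carrier A; b \<in> carrier B\<rbrakk> \<Longrightarrow> tensor_eval A B u (ptensor A B a b) = b [^]\<^bsub>B\<^esub> u a"
proof -
  have "bilinear A B B (\<lambda>a b. b [^]\<^bsub>B\<^esub> u a)"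
    unfolding bilinear_def
    by (auto intro!: homI simp: B.int_pow_distrib B.int_pow_mult hom_mult[OF u])
  then have "\<exists>h. h \<in> hom (tensor A B) B \<and> (\<forall>a\<in>carrier A. \<forall>b\<in>carrier B. h (ptensor A B a b) = b [^]\<^bsub>B\<^esub> u a)"
    by (rule tensor_lift[OF A B.is_group B]) auto
  then have *: "tensor_eval A B u \<in> hom (tensor A B) B \<and>
      (\<forall>a\<in>carrier A. \<forall>b\<in>carrier B. tensor_eval A B u (ptensor A B a b) = b [^]\<^bsub>B\<^esub> u a)"
    unfolding tensor_eval_def by (rule someI_ex)
  then show "tensor_eval A B u \<in> hom (tensor A B) B" by simp
  from * show "\<lbrakk>a \<in> carrier A; b \<in> carrier B\<rbrakk> \<Longrightarrow> tensor_eval A B u (ptensor A B a b) = b [^]\<^bsub>B\<^esub> u a"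
    by simp
qed

lemma ptensor_closed: "\<lbrakk>a \<in> carrier A; b \<in> carrier B\<rbrakk> \<Longrightarrow> ptensor A B a b \<in> carrier (tensor A B)"
  using bilinear_closed[OF bilinear_ptensor[OF A B.is_group]] .

context
  fixes I :: "'i set" and e c
  assumes zb: "zbasis A I e c"
begin

text \<open>Both sides are homomorphisms in \<open>t\<close>. On a pure tensor a \<otimes> x,
  bilinearity turns the sum of e_i \<otimes> c_i(a)x into (sum of c_i(a)e_i) \<otimes> x, whose
  first factor is the expansion of \<open>a\<close>.\<close>

lemma tensor_expand:
  assumes t: "t \<in> carrier (tensor A B)"
  shows "t = finprod (tensor A B) (\<lambda>i. ptensor A B (e i) (tensor_eval A B (c i) t)) I"
proof -
  interpret T: comm_group "tensor A B" by (rule comm_group_tensor[OF A B.is_group])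
  note b = zbasisD[OF zb]
  note pr = bilinear_right[OF bilinear_ptensor[OF A B.is_group]]
    and pl = bilinear_left[OF bilinear_ptensor[OF A B.is_group]]
  interpret A: comm_group A by (rule b)
  let ?s = "\<lambda>t. finprod (tensor A B) (\<lambda>i. ptensor A B (e i) (tensor_eval A B (c i) t)) I"
  have is_double: "tensor_eval A B (c i) t \<in> carrier B" if "i \<in> I" "t \<in> carrier (tensor A B)" for i t
    using that tensor_eval_hom b(4) by (auto simp: hom_def)
  have h: "?s \<in> hom (tensor A B) (tensor A B)"
  proof (rule homI)
    fix t t' assume t: "t \<in> carrier (tensor A B)" "t' \<in> carrier (tensor A B)"
    have "?s (t \<otimes>\<^bsub>tensor A B\<^esub> t') = finprod (tensor A B) (\<lambda>i. ptensor A B (e i) (tensor_eval A B (c i) t)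
        \<otimes>\<^bsub>tensor A B\<^esub> ptensor A B (e i) (tensor_eval A B (c i) t')) I"
      using t by (intro T.finprod_cong) (auto simp: simp_implies_def b is_double
          hom_mult[OF tensor_eval_hom[OF b(4)]] hom_mult[OF pr] ptensor_closed)
    then show "?s (t \<otimes>\<^bsub>tensor A B\<^esub> t') = ?s t \<otimes>\<^bsub>tensor A B\<^esub> ?s t'"
      using t by (simp add: T.finprod_multf Pi_iff is_double ptensor_closed b)
  qed (auto intro!: T.finprod_closed ptensor_closed is_double b)
  show ?thesis
  proof (rule tensor_eqI[OF A B.is_group T.is_group _ h _ t])
    show "(\<lambda>x. x) \<in> hom (tensor A B) (tensor A B)" by (simp add: hom_def)
    fix a x assume a: "a \<in> carrier A" and x: "x \<in> carrier B"
    have "?s (ptensor A B a x) = finprod (tensor A B) (\<lambda>i. ptensor A B (e i [^]\<^bsub>A\<^esub> c i a) x) I"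
      using a x b hom_int_pow[OF pr, of _ x] hom_int_pow[OF pl[OF x]]
      by (intro T.finprod_cong)
        (auto simp: simp_implies_def tensor_eval_ptensor ptensor_closed T.is_group A.is_group B.is_group)
    also have "\<dots> = ptensor A B (finprod A (\<lambda>i. e i [^]\<^bsub>A\<^esub> c i a) I) x"
      by (rule hom_finprod[OF b(1) T.comm_group_axioms pl[OF x] b(2), symmetric]) (auto simp: b)
    also have "\<dots> = ptensor A B a x" using zbasis_expand[OF zb a] by simp
    finally show "ptensor A B a x = ?s (ptensor A B a x)" ..
  qed
qed

lemma tensor_coords_eqI:
  assumes "t \<in> carrier (tensor A B)" "t' \<in> carrier (tensor A B)"
    and "\<And>i. i \<in> I \<Longrightarrow> tensor_eval A B (c i) t = tensor_eval A B (c i) t'"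
  shows "t = t'"
proof -
  interpret T: comm_group "tensor A B" by (rule comm_group_tensor[OF A B.is_group])
  have "finprod (tensor A B) (\<lambda>i. ptensor A B (e i) (tensor_eval A B (c i) t)) I
      = finprod (tensor A B) (\<lambda>i. ptensor A B (e i) (tensor_eval A B (c i) t')) I"
    using assms(2) zbasisD[OF zb] hom_in_carrier[OF tensor_eval_hom]
    by (intro T.finprod_cong) (auto simp: assms(3) simp_implies_def intro!: ptensor_closed)
  then show ?thesis using tensor_expand assms by simp
qed

lemma tensor_coords_exist:
  assumes y: "y \<in> I \<rightarrow> carrier B"
  obtains t where "t \<in> carrier (tensor A B)" "\<And>i. i \<in> I \<Longrightarrow> tensor_eval A B (c i) t = y i"
proof
  interpret T: comm_group "tensor A B" by (rule comm_group_tensor[OF A B.is_group])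
  note b = zbasisD[OF zb]
  let ?t = "finprod (tensor A B) (\<lambda>i. ptensor A B (e i) (y i)) I"
  have p: "(\<lambda>i. ptensor A B (e i) (y i)) \<in> I \<rightarrow> carrier (tensor A B)"
    using y b by (auto intro!: ptensor_closed)
  then show "?t \<in> carrier (tensor A B)" by simp
  fix j assume j: "j \<in> I"
  have "tensor_eval A B (c j) ?t = finprod B (\<lambda>i. tensor_eval A B (c j) (ptensor A B (e i) (y i))) I"
    by (rule hom_finprod[OF T.comm_group_axioms B tensor_eval_hom b(2) p]) (use b j in auto)
  also have "\<dots> = finprod B (\<lambda>i. if j = i then y i else \<one>\<^bsub>B\<^esub>) I"
    using j y b by (intro B.finprod_cong) (auto simp: simp_implies_def tensor_eval_ptensor Pi_iff)
  also have "\<dots> = y j" by (rule B.finprod_singleton) (use j y b in auto)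
  finally show "tensor_eval A B (c j) ?t = y j" .
qed

end

end

definition tensor_coord ::
  "('a, 'c) monoid_scheme \<Rightarrow> ('b, 'd) monoid_scheme \<Rightarrow> ('a \<Rightarrow> int) \<Rightarrow> ('b \<Rightarrow> int) \<Rightarrow> ('a \<times> 'b \<Rightarrow>\<^sub>0 int) set \<Rightarrow> int" where
  "tensor_coord A B u w t = w (tensor_eval A B u t)"

lemma tensor_coord:
  assumes A: "group A" and B: "comm_group B" and u: "u \<in> hom A integer_group" and w: "w \<in> hom B integer_group"
  shows tensor_coord_hom: "tensor_coord A B u w \<in> hom (tensor A B) integer_group"
    and tensor_coord_ptensor:
      "\<lbrakk>a \<in> carrier A; b \<in> carrier B\<rbrakk> \<Longrightarrow> tensor_coord A B u w (ptensor A B a b) = u a * w b"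
proof -
  have "tensor_coord A B u w = w \<circ> tensor_eval A B u" by (auto simp: tensor_coord_def)
  then show "tensor_coord A B u w \<in> hom (tensor A B) integer_group"
    using hom_compose[OF tensor_eval_hom[OF A B u] w] by simp
  show "\<lbrakk>a \<in> carrier A; b \<in> carrier B\<rbrakk> \<Longrightarrow> tensor_coord A B u w (ptensor A B a b) = u a * w b"
    using B w by (simp add: tensor_coord_def tensor_eval_ptensor[OF A B u] hom_integer_pow comm_group_def)
qed

text \<open>If all coordinates of \<open>t\<close> vanish, then each contraction in the first factor
  has vanishing coordinates in \<open>B\<close>, hence is trivial, and these contractions determine
  \<open>t\<close>.\<close>

lemma zbasis_tensor:
  assumes za: "zbasis A I e c" and zb: "zbasis B J f d"
  shows "zbasis (tensor A B) (I \<times> J) (\<lambda>(i, j). ptensor A B (e i) (f j)) (\<lambda>(i, j). tensor_coord A B (c i) (d j))"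
proof -
  note a = zbasisD[OF za] and b = zbasisD[OF zb]
  interpret A: comm_group A by (rule a)
  interpret B: comm_group B by (rule b)
  interpret T: comm_group "tensor A B" by (rule comm_group_tensor[OF A.is_group B.is_group])
  note tc = tensor_coord_hom[OF A.is_group b(1)] tensor_coord_ptensor[OF A.is_group b(1)]
  have "t = \<one>\<^bsub>tensor A B\<^esub>" if t: "t \<in> carrier (tensor A B)"
    and z: "\<And>i j. i \<in> I \<Longrightarrow> j \<in> J \<Longrightarrow> tensor_coord A B (c i) (d j) t = 0" for t
  proof (rule tensor_coords_eqI[OF A.is_group b(1) za t])
    fix i assume i: "i \<in> I"
    have "tensor_eval A B (c i) t = \<one>\<^bsub>B\<^esub>"
    proof (rule b(6))
      show "tensor_eval A B (c i) t \<in> carrier B"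
        using tensor_eval_hom[OF A.is_group b(1) a(4)[OF i]] t by (auto simp: hom_def)
    qed (use z i in \<open>auto simp: tensor_coord_def\<close>)
    then show "tensor_eval A B (c i) t = tensor_eval A B (c i) \<one>\<^bsub>tensor A B\<^esub>"
      using hom_one[OF tensor_eval_hom[OF A.is_group b(1) a(4)[OF i]]] T.is_group B.is_group by simp
  qed simp
  then show ?thesis
    unfolding zbasis_def
    by (auto simp: T.comm_group_axioms a b tc ptensor_closed[OF A.is_group b(1)] split: if_splits)
qed

text \<open>The pairing with the form u \<and> w, a 2 by 2 minor on decomposable elements; the
  choice operator only names the map given by the universal property.\<close>

definition ext_coord ::
  "('a, 'c) monoid_scheme \<Rightarrow> ('a \<Rightarrow> int) \<Rightarrow> ('a \<Rightarrow> int) \<Rightarrow> ('a \<times> 'a \<Rightarrow>\<^sub>0 int) set \<Rightarrow> int" where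
  "ext_coord A u w = (SOME h. h \<in> hom (ext_square A) integer_group \<and>
     (\<forall>a\<in>carrier A. \<forall>b\<in>carrier A. h (wedge A a b) = u a * w b - w a * u b))"

lemma ext_coord:
  assumes A: "group A" and u: "u \<in> hom A integer_group" and w: "w \<in> hom A integer_group"
  shows ext_coord_hom: "ext_coord A u w \<in> hom (ext_square A) integer_group"
    and ext_coord_wedge:
      "\<lbrakk>a \<in> carrier A; b \<in> carrier A\<rbrakk> \<Longrightarrow> ext_coord A u w (wedge A a b) = u a * w b - w a * u b"
proof -
  have "bilinear A A integer_group (\<lambda>a b. u a * w b - w a * u b)"
    unfolding bilinear_def
    by (auto intro!: homI simp: hom_mult[OF u] hom_mult[OF w] algebra_simps)
  then have "\<exists>h. h \<in> hom (ext_square A) integer_group \<and>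
     (\<forall>a\<in>carrier A. \<forall>b\<in>carrier A. h (wedge A a b) = u a * w b - w a * u b)"
    by (rule ext_square_lift[OF A abelian_integer_group]) auto
  then have *: "ext_coord A u w \<in> hom (ext_square A) integer_group \<and>
     (\<forall>a\<in>carrier A. \<forall>b\<in>carrier A. ext_coord A u w (wedge A a b) = u a * w b - w a * u b)"
    unfolding ext_coord_def by (rule someI_ex)
  then show "ext_coord A u w \<in> hom (ext_square A) integer_group" by simp
  from * show "\<lbrakk>a \<in> carrier A; b \<in> carrier A\<rbrakk> \<Longrightarrow> ext_coord A u w (wedge A a b) = u a * w b - w a * u b"
    by simp
qed

text \<open>Only increasing pairs serve as indices, so generation has to reorder wedges of basis
  elements. Between increasing pairs the minors reduce to the Kronecker delta.\<close>

lemma zbasis_ext_square: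
  fixes I :: "'i::linorder set"
  assumes za: "zbasis A I e c"
  shows "zbasis (ext_square A) {(i, j) \<in> I \<times> I. i < j} (\<lambda>(i, j). wedge A (e i) (e j)) (\<lambda>(i, j). ext_coord A (c i) (c j))"
proof -
  note a = zbasisD[OF za]
  interpret A: comm_group A by (rule a)
  interpret E: comm_group "ext_square A" by (rule comm_group_ext_square[OF A.is_group])
  note wb = bilinear_wedge[OF A.is_group]
  let ?J = "{(i, j) \<in> I \<times> I. i < j}"
  let ?S = "(\<lambda>(i, j). wedge A (e i) (e j)) ` ?J"
  have S: "?S \<subseteq> carrier (ext_square A)" using a wedge_closed[OF A.is_group] by auto
  have sg: "subgroup (generate (ext_square A) ?S) (ext_square A)" by (rule E.generate_is_subgroup[OF S])
  have 1: "wedge A (e i) (e j) \<in> generate (ext_square A) ?S" if "i \<in> I" "j \<in> I" for i j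
  proof -
    consider "i < j" | "i = j" | "j < i" by fastforce
    then show ?thesis
    proof cases
      case 1
      then show ?thesis using that by (force intro!: generate.incl)
    next
      case 2
      then show ?thesis using that a wedge_self[OF A.is_group] by (simp add: generate.one)
    next
      case 3
      \<comment> \<open>Polarisation: expanding the wedge of the sum of \<open>e i\<close> and
        \<open>e j\<close> with itself shows that the two mixed wedges are inverse to each
        other.\<close>
      have ee: "e i \<in> carrier A" "e j \<in> carrier A" using a that by auto
      have w: "wedge A x y \<in> carrier (ext_square A)" if "x \<in> {e i, e j}" "y \<in> {e i, e j}" for x y
        using that ee wedge_closed[OF A.is_group] by auto
      have "\<one>\<^bsub>ext_square A\<^esub> = wedge A (e i \<otimes>\<^bsub>A\<^esub> e j) (e i \<otimes>\<^bsub>A\<^esub> e j)"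
        using ee wedge_self[OF A.is_group] by simp
      also have "\<dots> = wedge A (e i) (e j) \<otimes>\<^bsub>ext_square A\<^esub> wedge A (e j) (e i)"
        using ee w[of "e i" "e j"] w[of "e j" "e i"] w[of "e i" "e i"] w[of "e j" "e j"]
        by (simp add: hom_mult[OF bilinear_left[OF wb]] hom_mult[OF bilinear_right[OF wb]]
            wedge_self[OF A.is_group ee(1)] wedge_self[OF A.is_group ee(2)] E.m_comm)
      finally have "wedge A (e i) (e j) = inv\<^bsub>ext_square A\<^esub> (wedge A (e j) (e i))"
        using w by (intro E.inv_equality[symmetric]) auto
      moreover have "wedge A (e j) (e i) \<in> generate (ext_square A) ?S"
        using 3 that by (force intro!: generate.incl)
      ultimately show ?thesis using E.generate_m_inv_closed[OF S] by simp
    qed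
  qed
  have 2: "wedge A x (e j) \<in> generate (ext_square A) ?S" if "j \<in> I" "x \<in> carrier A" for j x
    by (rule hom_image_generate_subset[OF A.is_group E.is_group bilinear_left[OF wb] _ zbasis_generated[OF za] sg])
       (use that 1 a in auto)
  have 3: "wedge A x y \<in> generate (ext_square A) ?S" if "x \<in> carrier A" "y \<in> carrier A" for x y
    by (rule hom_image_generate_subset[OF A.is_group E.is_group bilinear_right[OF wb] _ zbasis_generated[OF za] sg])
       (use that 2 a in auto)
  have "generate (ext_square A) ?S = carrier (ext_square A)"
  proof
    show "generate (ext_square A) ?S \<subseteq> carrier (ext_square A)" by (rule E.generate_incl[OF S])
    show "carrier (ext_square A) \<subseteq> generate (ext_square A) ?S"
      unfolding ext_square_generated[OF A.is_group, symmetric]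
      by (rule E.generate_subgroup_incl[OF _ sg]) (use 3 in auto)
  qed
  then show ?thesis
  proof (rule zbasis_generatedI[OF E.comm_group_axioms, rotated -1])
    show "finite ?J" by (rule finite_subset[of _ "I \<times> I"]) (use a(2) in auto)
    show "(\<lambda>(i, j). wedge A (e i) (e j)) \<in> ?J \<rightarrow> carrier (ext_square A)"
      using a(3) wedge_closed[OF A.is_group] by auto
    fix p assume p: "p \<in> ?J"
    then obtain i j where ij: "p = (i, j)" "i \<in> I" "j \<in> I" "i < j" by auto
    then show "(\<lambda>(i, j). ext_coord A (c i) (c j)) p \<in> hom (ext_square A) integer_group"
      by (simp add: ext_coord_hom[OF A.is_group] a(4))
    fix q assume "q \<in> ?J"
    then obtain k l where "q = (k, l)" "k \<in> I" "l \<in> I" "k < l" by auto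
    with ij show "(\<lambda>(i, j). ext_coord A (c i) (c j)) p ((\<lambda>(i, j). wedge A (e i) (e j)) q) = (if p = q then 1 else 0)"
      by (auto simp: ext_coord_wedge[OF A.is_group a(4) a(4)] a(3,5))
  qed
qed

section \<open>The free group on a set\<close>

abbreviation winv :: "('a \<times> bool) list \<Rightarrow> ('a \<times> bool) list" where
  "winv w \<equiv> rev (map (\<lambda>(a, b). (a, \<not> b)) w)"

lemma reduced_Nil [simp]: "reduced []"
  by (simp add: reduced_def)

lemma reduced_single [simp]: "reduced [x]"
  by (simp add: reduced_def)

lemma reduced_Cons: "reduced (x # w) \<longleftrightarrow> reduced w \<and> (w \<noteq> [] \<longrightarrow> \<not> (fst x = fst (hd w) \<and> snd x \<noteq> snd (hd w)))"
  by (cases w) (auto simp: reduced_def)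

lemma reduced_append:
  "reduced (u @ v) \<longleftrightarrow> reduced u \<and> reduced v
     \<and> (u \<noteq> [] \<longrightarrow> v \<noteq> [] \<longrightarrow> \<not> (fst (last u) = fst (hd v) \<and> snd (last u) \<noteq> snd (hd v)))"
  by (auto simp: reduced_def successively_append_iff)

lemma reduced_take: "reduced w \<Longrightarrow> reduced (take k w)"
  using reduced_append[of "take k w" "drop k w"] by simp

lemma reduced_drop: "reduced w \<Longrightarrow> reduced (drop k w)"
  using reduced_append[of "take k w" "drop k w"] by simp

lemma reduced_winv: "reduced (winv w) \<longleftrightarrow> reduced w"
proof -
  have *: "(\<lambda>y x. \<not> (fst (case x of (a, b) \<Rightarrow> (a, \<not> b)) = fst (case y of (a, b) \<Rightarrow> (a, \<not> b))
      \<and> snd (case x of (a, b) \<Rightarrow> (a, \<not> b)) \<noteq> snd (case y of (a, b) \<Rightarrow> (a, \<not> b))))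
    = (\<lambda>x y. \<not> (fst x = fst y \<and> snd x \<noteq> snd y))"
    by (auto simp: fun_eq_iff split: prod.splits)
  show ?thesis
    unfolding reduced_def successively_rev successively_map * ..
qed

lemma winv_winv [simp]: "winv (winv w) = w"
  by (induction w) auto

lemma red_cons_reduced: "reduced w \<Longrightarrow> reduced (red_cons x w)"
  by (cases w) (auto simp: reduced_Cons)

text \<open>Each letter acts on the reduced words as a bijection whose inverse is the action of the
  inverse letter. Associativity is derived from this action (van der Waerden's argument), so
  confluence of cancellation is never discussed.\<close>

lemma red_cons_inv: "reduced w \<Longrightarrow> red_cons (a, b) (red_cons (a, \<not> b) w) = w"
  by (cases w rule: remdups_adj.cases) (auto simp: reduced_def)

lemma foldr_red_cons_reduced: "reduced v \<Longrightarrow> reduced (foldr red_cons u v)"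
  by (induction u) (auto simp: red_cons_reduced)

text \<open>The only case with content is cancellation of \<open>x\<close> against the head of
  \<open>u\<close>, where the two letters act as mutually inverse maps on \<open>w\<close>.\<close>

lemma foldr_red_cons: "reduced w \<Longrightarrow> foldr red_cons (red_cons x u) w = red_cons x (foldr red_cons u w)"
proof (cases "u = [] \<or> \<not> (fst x = fst (hd u) \<and> snd x \<noteq> snd (hd u))")
  case True
  then show ?thesis by (cases u) auto
next
  case False
  then obtain a b u' where "x = (a, b)" "u = (a, \<not> b) # u'" by (cases u; cases x) auto
  moreover assume "reduced w"
  ultimately show ?thesis using red_cons_inv[of "foldr red_cons u' w" a b] by (simp add: foldr_red_cons_reduced)
qed

lemma foldr_red_cons_assoc:
  "reduced w \<Longrightarrow> foldr red_cons (foldr red_cons u v) w = foldr red_cons u (foldr red_cons v w)"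
  by (induction u) (auto simp: foldr_red_cons)

lemma foldr_red_cons_append: "reduced (u @ v) \<Longrightarrow> foldr red_cons u v = u @ v"
proof (induction u)
  case (Cons x u)
  then show ?case by (cases "u @ v") (auto simp: reduced_Cons)
qed simp

lemma foldr_winv: "reduced v \<Longrightarrow> foldr red_cons (winv u) (foldr red_cons u v) = v"
proof (induction u arbitrary: v)
  case (Cons x u)
  obtain a b where x: "x = (a, b)" by force
  have "red_cons (a, \<not> b) (red_cons (a, b) (foldr red_cons u v)) = foldr red_cons u v"
    using red_cons_inv[of "foldr red_cons u v" a "\<not> b"] Cons.prems by (simp add: foldr_red_cons_reduced)
  then show ?case using Cons x by simp
qed simp

lemma set_red_cons: "fst ` set (red_cons x w) \<subseteq> insert (fst x) (fst ` set w)"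
  by (cases w) auto

lemma set_foldr_red_cons: "fst ` set (foldr red_cons u v) \<subseteq> fst ` set u \<union> fst ` set v"
proof (induction u)
  case (Cons x u)
  then show ?case using order_trans[OF set_red_cons insert_mono[OF Cons.IH], of x] by simp
qed simp

lemma carrier_free_group: "w \<in> carrier (free_group S) \<longleftrightarrow> fst ` set w \<subseteq> S \<and> reduced w"
  by (simp add: free_group_def)

lemma mult_free_group: "u \<otimes>\<^bsub>free_group S\<^esub> v = foldr red_cons u v"
  by (simp add: free_group_def)

lemma one_free_group [simp]: "\<one>\<^bsub>free_group S\<^esub> = []"
  by (simp add: free_group_def)

lemma winv_carrier: "w \<in> carrier (free_group S) \<Longrightarrow> winv w \<in> carrier (free_group S)"
  by (force simp: carrier_free_group reduced_winv)

lemma winv_mult: "w \<in> carrier (free_group S) \<Longrightarrow> winv w \<otimes>\<^bsub>free_group S\<^esub> w = []"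
  using foldr_winv[of "[]" w] foldr_red_cons_append[of w "[]"] by (simp add: carrier_free_group mult_free_group)

lemma group_free_group: "group (free_group S)"
proof (rule groupI)
  show "x \<otimes>\<^bsub>free_group S\<^esub> y \<in> carrier (free_group S)"
    if "x \<in> carrier (free_group S)" "y \<in> carrier (free_group S)" for x y
    using that order_trans[OF set_foldr_red_cons[of x y], of S]
    by (simp add: carrier_free_group mult_free_group foldr_red_cons_reduced)
next
  show "\<exists>y\<in>carrier (free_group S). y \<otimes>\<^bsub>free_group S\<^esub> x = \<one>\<^bsub>free_group S\<^esub>"
    if "x \<in> carrier (free_group S)" for x
    using winv_carrier[OF that] winv_mult[OF that] by auto
qed (auto simp: carrier_free_group mult_free_group foldr_red_cons_assoc)

lemma inv_free_group: "w \<in> carrier (free_group S) \<Longrightarrow> inv\<^bsub>free_group S\<^esub> w = winv w"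
  by (rule group.inv_equality[OF group_free_group]) (simp_all only: winv_mult winv_carrier one_free_group)

lemma letter_carrier [simp]: "[(a, b)] \<in> carrier (free_group S) \<longleftrightarrow> a \<in> S"
  by (simp add: carrier_free_group)

lemma inv_letter: "a \<in> S \<Longrightarrow> inv\<^bsub>free_group S\<^esub> [(a, b)] = [(a, \<not> b)]"
  by (simp add: inv_free_group)

lemma letter_mult_inv: "[(a, b)] \<otimes>\<^bsub>free_group S\<^esub> [(a, \<not> b)] = []"
  by (simp add: mult_free_group)

lemma Cons_free_group:
  assumes "(a, b) # w \<in> carrier (free_group S)"
  shows "a \<in> S" "w \<in> carrier (free_group S)" "[(a, b)] \<otimes>\<^bsub>free_group S\<^esub> w = (a, b) # w"
proof -
  show "a \<in> S" "w \<in> carrier (free_group S)" using assms by (auto simp: carrier_free_group reduced_Cons)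
  show "[(a, b)] \<otimes>\<^bsub>free_group S\<^esub> w = (a, b) # w"
    using assms foldr_red_cons_append[of "[(a, b)]" w] by (simp add: carrier_free_group mult_free_group)
qed

lemma free_group_generated:
  "generate (free_group S) ((\<lambda>a. [(a, True)]) ` S) = carrier (free_group S)"
proof -
  interpret F: group "free_group S" by (rule group_free_group)
  let ?E = "generate (free_group S) ((\<lambda>a. [(a, True)]) ` S)"
  have l: "[(a, b)] \<in> ?E" if "a \<in> S" for a b
  proof (cases b)
    case True then show ?thesis using that by (auto intro: generate.incl)
  next
    case False
    then show ?thesis using that generate.inv[of "[(a, True)]" _ "free_group S"] by (simp add: inv_letter)
  qed
  have "w \<in> ?E" if "w \<in> carrier (free_group S)" for w
    using that
  proof (induction w)
    case Nil then show ?case using generate.one[of "free_group S"] by simp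
  next
    case (Cons x w)
    obtain a b where x: "x = (a, b)" by force
    note c = Cons_free_group[OF Cons.prems[unfolded x]]
    show ?case using generate.eng[OF l[OF c(1), of b] Cons.IH[OF c(2)]] c(3) x by simp
  qed
  moreover have "(\<lambda>a. [(a, True)]) ` S \<subseteq> carrier (free_group S)" by auto
  ultimately show ?thesis using F.generate_incl by blast
qed

lemma free_group_hom_eqI:
  assumes "group G" "h \<in> hom (free_group S) G" "h' \<in> hom (free_group S) G"
    and "\<And>a. a \<in> S \<Longrightarrow> h [(a, True)] = h' [(a, True)]" and "w \<in> carrier (free_group S)"
  shows "h w = h' w"
proof (rule hom_eq_on_generate[OF group_free_group assms(1-3)])
  show "(\<lambda>a. [(a, True)]) ` S \<subseteq> carrier (free_group S)" by auto
qed (use assms(4,5) in \<open>auto simp: free_group_generated\<close>)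

fun letter_image :: "('b, 'c) monoid_scheme \<Rightarrow> ('a \<Rightarrow> 'b) \<Rightarrow> 'a \<times> bool \<Rightarrow> 'b" where
  "letter_image G g (a, b) = (if b then g a else inv\<^bsub>G\<^esub> g a)"

definition free_ext :: "('b, 'c) monoid_scheme \<Rightarrow> ('a \<Rightarrow> 'b) \<Rightarrow> ('a \<times> bool) list \<Rightarrow> 'b" where
  "free_ext G g w = foldr (\<lambda>x. monoid.mult G (letter_image G g x)) w \<one>\<^bsub>G\<^esub>"

lemma free_ext:
  assumes G: "group G" and g: "g \<in> S \<rightarrow> carrier G"
  shows free_ext_hom: "free_ext G g \<in> hom (free_group S) G"
    and free_ext_letter: "a \<in> S \<Longrightarrow> free_ext G g [(a, b)] = (if b then g a else inv\<^bsub>G\<^esub> g a)"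
proof -
  interpret G: group G by (rule G)
  have li: "letter_image G g x \<in> carrier G" if "fst x \<in> S" for x
    using that g by (cases x) auto
  have cl: "free_ext G g w \<in> carrier G" if "fst ` set w \<subseteq> S" for w
    using that by (induction w) (auto simp: free_ext_def li)
  \<comment> \<open>Evaluation in \<open>G\<close> does not see cancellation: when \<open>x\<close>
    meets its inverse at the head of the word, their images multiply to the identity.\<close>
  have rc: "free_ext G g (red_cons x w) = letter_image G g x \<otimes>\<^bsub>G\<^esub> free_ext G g w"
    if "fst x \<in> S" "fst ` set w \<subseteq> S" for x w
  proof (cases w)
    case Nil
    then show ?thesis by (simp add: free_ext_def)
  next
    case (Cons y u)
    show ?thesis
    proof (cases "fst x = fst y \<and> snd x \<noteq> snd y")
      case True
      then obtain a b where ab: "x = (a, b)" "y = (a, \<not> b)" by (cases x; cases y) auto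
      have "g a \<in> carrier G" using that ab g by auto
      then have "letter_image G g x \<otimes>\<^bsub>G\<^esub> letter_image G g y = \<one>\<^bsub>G\<^esub>" using ab by auto
      moreover have "free_ext G g u \<in> carrier G" "letter_image G g x \<in> carrier G" "letter_image G g y \<in> carrier G"
        using that Cons cl li by auto
      ultimately have "letter_image G g x \<otimes>\<^bsub>G\<^esub> (letter_image G g y \<otimes>\<^bsub>G\<^esub> free_ext G g u) = free_ext G g u"
        by (metis G.m_assoc G.l_one)
      then show ?thesis using True Cons by (simp add: free_ext_def)
    qed (auto simp: Cons free_ext_def)
  qed
  have "free_ext G g (foldr red_cons u v) = free_ext G g u \<otimes>\<^bsub>G\<^esub> free_ext G g v"
    if "fst ` set u \<subseteq> S" "fst ` set v \<subseteq> S" for u v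
    using that
  proof (induction u)
    case Nil then show ?case using cl by (simp add: free_ext_def[of _ _ "[]"])
  next
    case (Cons x u)
    have "fst ` set (foldr red_cons u v) \<subseteq> S"
      using order_trans[OF set_foldr_red_cons[of u v], of S] Cons.prems by simp
    then have "free_ext G g (foldr red_cons (x # u) v) = letter_image G g x \<otimes>\<^bsub>G\<^esub> (free_ext G g u \<otimes>\<^bsub>G\<^esub> free_ext G g v)"
      using Cons rc by simp
    also have "\<dots> = (letter_image G g x \<otimes>\<^bsub>G\<^esub> free_ext G g u) \<otimes>\<^bsub>G\<^esub> free_ext G g v"
      using Cons.prems cl li by (simp add: G.m_assoc)
    finally show ?case by (simp add: free_ext_def[of _ _ "x # u"] free_ext_def[of _ _ u])
  qed
  then show "free_ext G g \<in> hom (free_group S) G"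
    using cl by (auto intro!: homI simp: carrier_free_group mult_free_group)
  show "a \<in> S \<Longrightarrow> free_ext G g [(a, b)] = (if b then g a else inv\<^bsub>G\<^esub> g a)"
    using funcset_mem[OF g, of a] by (auto simp: free_ext_def)
qed

section \<open>Automorphisms\<close>

lemma right_Aut_mult: "x \<in> carrier G \<Longrightarrow> (\<sigma> \<otimes>\<^bsub>right_Aut G\<^esub> \<tau>) x = \<tau> (\<sigma> x)"
  by (simp add: right_Aut_def compose_def)

lemma right_Aut_one: "x \<in> carrier G \<Longrightarrow> \<one>\<^bsub>right_Aut G\<^esub> x = x"
  by (simp add: right_Aut_def)

lemma carrier_right_Aut:
  "\<sigma> \<in> carrier (right_Aut G) \<longleftrightarrow> \<sigma> \<in> hom G G \<and> \<sigma> \<in> extensional (carrier G) \<and> bij_betw \<sigma> (carrier G) (carrier G)"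
  by (auto simp: right_Aut_def auto_def Bij_def)

lemma right_AutD:
  assumes "\<sigma> \<in> carrier (right_Aut G)"
  shows "\<sigma> \<in> hom G G" "x \<in> carrier G \<Longrightarrow> \<sigma> x \<in> carrier G"
  using assms by (auto simp: carrier_right_Aut hom_def)

lemma right_Aut_ext:
  assumes "\<sigma> \<in> carrier (right_Aut G)" "\<tau> \<in> carrier (right_Aut G)" "\<And>x. x \<in> carrier G \<Longrightarrow> \<sigma> x = \<tau> x"
  shows "\<sigma> = \<tau>"
  using assms by (intro extensionalityI[of \<sigma> "carrier G" \<tau>]) (auto simp: carrier_right_Aut)

lemma group_right_Aut:
  assumes "group G" shows "group (right_Aut G)"
proof -
  interpret G: group G by fact
  have id: "(\<lambda>x\<in>carrier G. x) \<in> auto G" by (rule G.id_in_auto)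
  have cl: "compose (carrier G) \<tau> \<sigma> \<in> auto G" if "\<sigma> \<in> auto G" "\<tau> \<in> auto G" for \<sigma> \<tau>
    using that by (auto simp: auto_def compose_Bij G.hom_compose)
  have one: "compose (carrier G) \<sigma> (\<lambda>x\<in>carrier G. x) = \<sigma>" if "\<sigma> \<in> auto G" for \<sigma>
    using that compose_Id[OF Bij_imp_funcset Bij_imp_extensional] by (auto simp: auto_def)
  show ?thesis
  proof (rule groupI)
    fix \<sigma> assume "\<sigma> \<in> carrier (right_Aut G)"
    then have s: "\<sigma> \<in> hom G G" "\<sigma> \<in> Bij (carrier G)" by (auto simp: right_Aut_def auto_def)
    have t: "restrict (inv_into (carrier G) \<sigma>) (carrier G) \<in> auto G"
      using s G.restrict_inv_into_hom restrict_inv_into_Bij by (auto simp: auto_def)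
    have "compose (carrier G) \<sigma> (restrict (inv_into (carrier G) \<sigma>) (carrier G)) = (\<lambda>x\<in>carrier G. x)"
      using s(2) by (auto simp: compose_def Bij_def fun_eq_iff restrict_def bij_betw_inv_into_right)
    with t show "\<exists>y\<in>carrier (right_Aut G). y \<otimes>\<^bsub>right_Aut G\<^esub> \<sigma> = \<one>\<^bsub>right_Aut G\<^esub>"
      by (auto simp: right_Aut_def)
  qed (use id cl one in \<open>auto simp: right_Aut_def auto_def Bij_imp_extensional Bij_imp_funcset compose_assoc\<close>)
qed

context
  fixes G :: "('a, 'b) monoid_scheme"
  assumes G: "group G"
begin

interpretation G: group G by (rule G)
interpretation A: group "right_Aut G" by (rule group_right_Aut[OF G])

lemma right_Aut_inv:
  assumes "\<sigma> \<in> carrier (right_Aut G)" "x \<in> carrier G"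
  shows "(inv\<^bsub>right_Aut G\<^esub> \<sigma>) (\<sigma> x) = x" "\<sigma> ((inv\<^bsub>right_Aut G\<^esub> \<sigma>) x) = x"
  using assms right_Aut_mult[OF assms(2), of \<sigma> "inv\<^bsub>right_Aut G\<^esub> \<sigma>"]
    right_Aut_mult[OF assms(2), of "inv\<^bsub>right_Aut G\<^esub> \<sigma>" \<sigma>] right_Aut_one[OF assms(2)] by auto

lemma right_AutI:
  assumes f: "f \<in> hom G G" and g: "g \<in> hom G G"
    and "\<And>x. x \<in> carrier G \<Longrightarrow> g (f x) = x" "\<And>x. x \<in> carrier G \<Longrightarrow> f (g x) = x"
  shows "restrict f (carrier G) \<in> carrier (right_Aut G)"
proof -
  have "bij_betw f (carrier G) (carrier G)"
    by (rule bij_betwI[of _ _ _ g]) (use assms in \<open>auto simp: hom_def\<close>)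
  then show ?thesis using f by (auto simp: carrier_right_Aut hom_def)
qed

definition conj_aut :: "'a \<Rightarrow> 'a \<Rightarrow> 'a" where
  "conj_aut g = (\<lambda>x\<in>carrier G. inv\<^bsub>G\<^esub> g \<otimes>\<^bsub>G\<^esub> x \<otimes>\<^bsub>G\<^esub> g)"

lemma cancel_inv:
  assumes "g \<in> carrier G" "x \<in> carrier G"
  shows "g \<otimes>\<^bsub>G\<^esub> (inv\<^bsub>G\<^esub> g \<otimes>\<^bsub>G\<^esub> x) = x" "inv\<^bsub>G\<^esub> g \<otimes>\<^bsub>G\<^esub> (g \<otimes>\<^bsub>G\<^esub> x) = x"
  using assms by (simp_all add: G.m_assoc[symmetric])

lemma conj_hom: "g \<in> carrier G \<Longrightarrow> (\<lambda>x. inv\<^bsub>G\<^esub> g \<otimes>\<^bsub>G\<^esub> x \<otimes>\<^bsub>G\<^esub> g) \<in> hom G G"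
proof (rule homI)
  fix x y assume "g \<in> carrier G" "x \<in> carrier G" "y \<in> carrier G"
  then show "inv\<^bsub>G\<^esub> g \<otimes>\<^bsub>G\<^esub> (x \<otimes>\<^bsub>G\<^esub> y) \<otimes>\<^bsub>G\<^esub> g = inv\<^bsub>G\<^esub> g \<otimes>\<^bsub>G\<^esub> x \<otimes>\<^bsub>G\<^esub> g \<otimes>\<^bsub>G\<^esub> (inv\<^bsub>G\<^esub> g \<otimes>\<^bsub>G\<^esub> y \<otimes>\<^bsub>G\<^esub> g)"
    by (simp add: G.m_assoc cancel_inv)
qed auto

lemma conj_aut_carrier: "g \<in> carrier G \<Longrightarrow> conj_aut g \<in> carrier (right_Aut G)"
  unfolding conj_aut_def
proof (rule right_AutI[OF conj_hom])
  assume g: "g \<in> carrier G"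
  show "(\<lambda>x. inv\<^bsub>G\<^esub> (inv\<^bsub>G\<^esub> g) \<otimes>\<^bsub>G\<^esub> x \<otimes>\<^bsub>G\<^esub> inv\<^bsub>G\<^esub> g) \<in> hom G G" using g by (intro conj_hom) simp
  fix x assume x: "x \<in> carrier G"
  show "inv\<^bsub>G\<^esub> (inv\<^bsub>G\<^esub> g) \<otimes>\<^bsub>G\<^esub> (inv\<^bsub>G\<^esub> g \<otimes>\<^bsub>G\<^esub> x \<otimes>\<^bsub>G\<^esub> g) \<otimes>\<^bsub>G\<^esub> inv\<^bsub>G\<^esub> g = x"
    using g x by (simp add: G.m_assoc cancel_inv)
  show "inv\<^bsub>G\<^esub> g \<otimes>\<^bsub>G\<^esub> (inv\<^bsub>G\<^esub> (inv\<^bsub>G\<^esub> g) \<otimes>\<^bsub>G\<^esub> x \<otimes>\<^bsub>G\<^esub> inv\<^bsub>G\<^esub> g) \<otimes>\<^bsub>G\<^esub> g = x"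
    using g x by (simp add: G.m_assoc cancel_inv)
qed

lemma Inn_conj_aut: "Inn G = conj_aut ` carrier G"
  by (auto simp: Inn_def conj_aut_def)

text \<open>Conjugation is taken as x \<mapsto> g^-1 x g and left factors act first; the two
  conventions fit, so the map is multiplicative and not order reversing.\<close>

lemma conj_aut_mult:
  assumes "g \<in> carrier G" "h \<in> carrier G"
  shows "conj_aut g \<otimes>\<^bsub>right_Aut G\<^esub> conj_aut h = conj_aut (g \<otimes>\<^bsub>G\<^esub> h)"
proof (rule right_Aut_ext[of _ G])
  fix x assume x: "x \<in> carrier G"
  show "(conj_aut g \<otimes>\<^bsub>right_Aut G\<^esub> conj_aut h) x = conj_aut (g \<otimes>\<^bsub>G\<^esub> h) x"
    using assms x by (simp add: right_Aut_mult conj_aut_def G.inv_mult_group G.m_assoc)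
qed (use assms conj_aut_carrier in auto)

lemma conj_aut_one: "conj_aut \<one>\<^bsub>G\<^esub> = \<one>\<^bsub>right_Aut G\<^esub>"
proof (rule right_Aut_ext[OF conj_aut_carrier[OF G.one_closed] A.one_closed])
qed (simp add: right_Aut_one conj_aut_def)

lemma conj_aut_conj:
  assumes "\<sigma> \<in> carrier (right_Aut G)" "g \<in> carrier G"
  shows "\<sigma> \<otimes>\<^bsub>right_Aut G\<^esub> conj_aut g \<otimes>\<^bsub>right_Aut G\<^esub> inv\<^bsub>right_Aut G\<^esub> \<sigma>
    = conj_aut ((inv\<^bsub>right_Aut G\<^esub> \<sigma>) g)"
proof (rule right_Aut_ext[of _ G])
  have t: "inv\<^bsub>right_Aut G\<^esub> \<sigma> \<in> carrier (right_Aut G)" using assms by simp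
  interpret t: group_hom G G "inv\<^bsub>right_Aut G\<^esub> \<sigma>"
    using right_AutD(1)[OF t] by (simp add: group_hom_def group_hom_axioms_def G)
  fix x assume x: "x \<in> carrier G"
  show "(\<sigma> \<otimes>\<^bsub>right_Aut G\<^esub> conj_aut g \<otimes>\<^bsub>right_Aut G\<^esub> inv\<^bsub>right_Aut G\<^esub> \<sigma>) x
    = conj_aut ((inv\<^bsub>right_Aut G\<^esub> \<sigma>) g) x"
    using assms x right_AutD(2)[OF assms(1)] right_AutD(2)[OF t]
    by (simp add: right_Aut_mult conj_aut_def right_Aut_inv)
next
  show "conj_aut ((inv\<^bsub>right_Aut G\<^esub> \<sigma>) g) \<in> carrier (right_Aut G)"
    by (intro conj_aut_carrier right_AutD(2)[of "inv\<^bsub>right_Aut G\<^esub> \<sigma>"] A.inv_closed assms)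
qed (simp add: assms conj_aut_carrier)

lemma Inn_normal: "Inn G \<lhd> right_Aut G"
proof -
  have sub: "subgroup (Inn G) (right_Aut G)"
    unfolding Inn_conj_aut
  proof (rule A.subgroupI)
    fix a assume "a \<in> conj_aut ` carrier G"
    then obtain g where g: "g \<in> carrier G" "a = conj_aut g" by auto
    have "inv\<^bsub>right_Aut G\<^esub> a = conj_aut (inv\<^bsub>G\<^esub> g)"
      using g by (intro A.inv_equality) (auto simp: conj_aut_mult conj_aut_carrier conj_aut_one)
    then show "inv\<^bsub>right_Aut G\<^esub> a \<in> conj_aut ` carrier G" using g by auto
  qed (auto simp: conj_aut_mult conj_aut_carrier)
  then show ?thesis
    by (auto simp: A.normal_inv_iff Inn_conj_aut conj_aut_conj intro!: imageI right_AutD(2)[of "inv\<^bsub>right_Aut G\<^esub> _"])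
qed

end

lemma right_Aut_free_eqI:
  assumes "\<sigma> \<in> carrier (right_Aut (free_group S))" "\<tau> \<in> carrier (right_Aut (free_group S))"
    and "\<And>a. a \<in> S \<Longrightarrow> \<sigma> [(a, True)] = \<tau> [(a, True)]"
  shows "\<sigma> = \<tau>"
  by (rule right_Aut_ext[OF assms(1,2)])
    (rule free_group_hom_eqI[OF group_free_group right_AutD(1)[OF assms(1)] right_AutD(1)[OF assms(2)] assms(3)])

definition free_aut :: "'a set \<Rightarrow> ('a \<Rightarrow> ('a \<times> bool) list) \<Rightarrow> ('a \<times> bool) list \<Rightarrow> ('a \<times> bool) list" where
  "free_aut S g = restrict (free_ext (free_group S) g) (carrier (free_group S))"

lemma free_aut_letter:
  assumes "g \<in> S \<rightarrow> carrier (free_group S)" "a \<in> S"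
  shows "free_aut S g [(a, b)] = (if b then g a else inv\<^bsub>free_group S\<^esub> g a)"
  using assms free_ext_letter[OF group_free_group assms] by (simp add: free_aut_def)

text \<open>Bijectivity is certified by an inverse given on generators: both composites are
  endomorphisms that fix every generator.\<close>

lemma free_aut_carrier:
  assumes g: "g \<in> S \<rightarrow> carrier (free_group S)" and h: "h \<in> S \<rightarrow> carrier (free_group S)"
    and gh: "\<And>a. a \<in> S \<Longrightarrow> free_ext (free_group S) h (g a) = [(a, True)]"
    and hg: "\<And>a. a \<in> S \<Longrightarrow> free_ext (free_group S) g (h a) = [(a, True)]"
  shows "free_aut S g \<in> carrier (right_Aut (free_group S))"
proof -
  note F = group_free_group[of S]
  let ?g = "free_ext (free_group S) g" and ?h = "free_ext (free_group S) h"
  have gh': "?g \<in> hom (free_group S) (free_group S)" "?h \<in> hom (free_group S) (free_group S)"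
    using free_ext_hom[OF F] g h by auto
  have id: "(\<lambda>x. x) \<in> hom (free_group S) (free_group S)" by (simp add: hom_def)
  have "?h (?g x) = x" if "x \<in> carrier (free_group S)" for x
    using free_group_hom_eqI[OF F hom_compose[OF gh'] id _ that]
      free_ext_letter[OF F g, of _ True] gh by simp
  moreover have "?g (?h x) = x" if "x \<in> carrier (free_group S)" for x
    using free_group_hom_eqI[OF F hom_compose[OF gh'(2,1)] id _ that]
      free_ext_letter[OF F h, of _ True] hg by simp
  ultimately show ?thesis unfolding free_aut_def using right_AutI[OF F gh'] by simp
qed

section \<open>Cancellation in products of reduced words\<close>

text \<open>The length of the longest common prefix. Applied to the inverse of \<open>u\<close> and
  to \<open>v\<close>, it counts the letters of each factor that cancel in the product.\<close>

fun cpl :: "'a list \<Rightarrow> 'a list \<Rightarrow> nat" where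
  "cpl (x # u) (y # v) = (if x = y then Suc (cpl u v) else 0)"
| "cpl u v = 0"

lemma le_cpl_iff: "k \<le> cpl u v \<longleftrightarrow> k \<le> length u \<and> k \<le> length v \<and> take k u = take k v"
proof (induction u v arbitrary: k rule: cpl.induct)
  case (1 x u y v)
  then show ?case by (cases k) auto
qed auto

lemma cpl_take: "take (cpl u v) u = take (cpl u v) v"
  and cpl_le: "cpl u v \<le> length u" "cpl u v \<le> length v"
  using le_cpl_iff[of "cpl u v" u v] by auto

lemma cpl_commute: "cpl u v = cpl v u"
  by (induction u v rule: cpl.induct) auto

text \<open>Once the common prefix with \<open>v\<close> stops before position \<open>k\<close>,
  letters from there on are irrelevant. This lets the first factor of a long product stand for the
  whole product.\<close>

lemma cpl_eqI:
  assumes "take k u = take k u'" "k \<le> length u" "k \<le> length u'" "cpl u v < k"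
  shows "cpl u' v = cpl u v"
proof -
  have "j \<le> cpl u' v \<longleftrightarrow> j \<le> cpl u v" if "j \<le> k" for j
  proof -
    have "take j u = take j u'" using assms(1) that by (metis min.absorb1 take_take)
    then show ?thesis using that assms by (auto simp: le_cpl_iff)
  qed
  from this[of "Suc (cpl u v)"] this[of "cpl u v"] assms show ?thesis by force
qed

definition cancel :: "('a \<times> bool) list \<Rightarrow> ('a \<times> bool) list \<Rightarrow> nat" where
  "cancel u v = cpl (winv u) v"

lemma cancel_le: "cancel u v \<le> length u" "cancel u v \<le> length v"
  using cpl_le[of "winv u" v] by (auto simp: cancel_def)

lemma cancel_winv: "cancel (winv v) (winv u) = cancel u v"
  by (simp add: cancel_def cpl_commute)

text \<open>Write u = p t^-1 and v = t q with \<open>t\<close> of length \<open>cancel u v\<close>.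
  A further cancellation between \<open>p\<close> and \<open>q\<close> would lengthen the common
  prefix of \<open>winv u\<close> and \<open>v\<close>, so \<open>p @ q\<close> is already
  reduced.\<close>

lemma foldr_red_cons_cancel:
  assumes u: "reduced u" and v: "reduced v"
  shows "foldr red_cons u v = take (length u - cancel u v) u @ drop (cancel u v) v"
proof -
  define k where "k = cancel u v"
  define p t q where "p = take (length u - k) u" and "t = take k v" and "q = drop k v"
  have k: "k \<le> length u" "k \<le> length v" using cancel_le k_def by auto
  have ut: "drop (length u - k) u = winv t"
  proof -
    have "take k (winv u) = t" using cpl_take[of "winv u" v] by (simp add: t_def k_def cancel_def)
    then have "winv (take k (winv u)) = winv t" by simp
    then show ?thesis by (simp add: take_rev take_map rev_map drop_map comp_def case_prod_unfold)
  qed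
  have uv: "u = p @ winv t" "v = t @ q" using ut by (auto simp: p_def t_def q_def) (metis append_take_drop_id)
  have tq: "reduced t" "reduced q" "reduced p" using u v by (auto simp: p_def t_def q_def reduced_take reduced_drop)
  have pq: "reduced (p @ q)"
  proof (rule ccontr)
    assume "\<not> reduced (p @ q)"
    then have ne: "p \<noteq> []" "q \<noteq> []" and "fst (last p) = fst (hd q)" "snd (last p) \<noteq> snd (hd q)"
      using tq by (auto simp: reduced_append)
    then have l: "hd q = (case last p of (a, b) \<Rightarrow> (a, \<not> b))" by (cases "last p"; cases "hd q") auto
    obtain p' x where p': "p = p' @ [x]" using ne(1) by (cases p rule: rev_cases) auto
    obtain y q' where q': "q = y # q'" using ne(2) by (cases q) auto
    have lt: "length t = k" using k by (simp add: t_def)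
    have "winv u = t @ y # winv p'" "v = t @ y # q'"
      using uv p' q' l by auto
    then have "Suc k \<le> cpl (winv u) v" using lt by (simp add: le_cpl_iff)
    then show False by (simp add: k_def cancel_def)
  qed
  have "foldr red_cons u v = foldr red_cons p (foldr red_cons (winv t) (foldr red_cons t q))"
    using uv v foldr_red_cons_append[of t q] by simp
  also have "\<dots> = foldr red_cons p q" using foldr_winv[OF tq(2)] by simp
  also have "\<dots> = p @ q" by (rule foldr_red_cons_append[OF pq])
  finally show ?thesis by (simp add: p_def q_def k_def)
qed

lemma length_foldr_red_cons:
  assumes "reduced u" "reduced v"
  shows "length (foldr red_cons u v) + 2 * cancel u v = length u + length v"
  using foldr_red_cons_cancel[OF assms] cancel_le[of u v] by simp

text \<open>If half of \<open>u\<close> cancelled against \<open>u\<close>, letters in mirror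
  positions would be mutually inverse. For odd length the middle letter would be its own inverse;
  for even length the two middle letters would be a cancelling pair.\<close>

lemma cancel_self:
  assumes u: "reduced u" "u \<noteq> []"
  shows "2 * cancel u u < length u"
proof (rule ccontr)
  assume "\<not> 2 * cancel u u < length u"
  then have *: "length u \<le> 2 * cancel u u" by simp
  define j where "j = length u div 2"
  have tk: "take (cancel u u) (winv u) = take (cancel u u) u" using cpl_take by (simp add: cancel_def)
  have nth: "fst (u ! i) = fst (u ! (length u - Suc i)) \<and> snd (u ! i) \<noteq> snd (u ! (length u - Suc i))"
    if "i < cancel u u" for i
  proof -
    have il: "i < length u" using that cancel_le[of u u] by simp
    have "u ! i = winv u ! i" using that tk by (metis nth_take)
    also have "\<dots> = (case u ! (length u - Suc i) of (a, b) \<Rightarrow> (a, \<not> b))" using il by (simp add: rev_nth)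
    finally show ?thesis by (auto split: prod.splits)
  qed
  show False
  proof (cases "even (length u)")
    case True
    then have l: "length u = 2 * j" by (simp add: j_def)
    moreover have "length u > 0" using u by simp
    ultimately have "j > 0" by simp
    note l = l this
    have "successively (\<lambda>x y. \<not> (fst x = fst y \<and> snd x \<noteq> snd y)) u" using u by (simp add: reduced_def)
    then have "\<not> (fst (u ! (j - 1)) = fst (u ! j) \<and> snd (u ! (j - 1)) \<noteq> snd (u ! j))"
      using l successively_nth[of "\<lambda>x y. \<not> (fst x = fst y \<and> snd x \<noteq> snd y)" u "j - 1"] by simp
    then show False using nth[of "j - 1"] l * by (simp add: Suc_diff_Suc mult_2)
  next
    case False
    then have "length u = 2 * j + 1" by (simp add: j_def)
    then show False using nth[of j] * by simp
  qed
qed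

text \<open>Minimality of the total length alone does not make a tuple Nielsen reduced. Ties are broken by
  comparing the left halves of a word and of its inverse lexicographically, where \<open>word_rank\<close> reads
  words of equal length as numerals in base \<open>B\<close>.\<close>

fun word_rank :: "nat \<Rightarrow> (nat \<times> bool) list \<Rightarrow> nat" where
  "word_rank B [] = 0"
| "word_rank B ((a, b) # w) = (2 * a + of_bool b) * B ^ length w + word_rank B w"

definition tie_break :: "nat \<Rightarrow> (nat \<times> bool) list \<Rightarrow> nat" where
  "tie_break B w = word_rank B (take ((length w + 1) div 2) w) + word_rank B (take ((length w + 1) div 2) (winv w))"

lemma tie_break_winv: "tie_break B (winv w) = tie_break B w"
  by (simp add: tie_break_def)

lemma word_rank_append: "word_rank B (u @ v) = word_rank B u * B ^ length v + word_rank B v"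
  by (induction u) (auto simp: power_add algebra_simps)

lemma word_rank_less: "fst ` set w \<subseteq> {..<n} \<Longrightarrow> word_rank (2 * n) w < (2 * n) ^ length w"
proof (induction w)
  case (Cons x w)
  obtain a b where x: "x = (a, b)" by force
  have "2 * a + of_bool b + 1 \<le> 2 * n" using Cons.prems x by (cases b) auto
  then have "(2 * a + of_bool b + 1) * (2 * n) ^ length w \<le> 2 * n * (2 * n) ^ length w" by (rule mult_le_mono1)
  moreover have "word_rank (2 * n) w < (2 * n) ^ length w" using Cons by simp
  ultimately show ?case using x by (simp add: algebra_simps)
qed simp

lemma word_rank_inj:
  assumes "fst ` set u \<subseteq> {..<n}" "fst ` set v \<subseteq> {..<n}" "length u = length v"
    and "word_rank (2 * n) u = word_rank (2 * n) v"
  shows "u = v"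
  using assms(3,1,2,4)
proof (induction u v rule: list_induct2)
  case (Cons x u y v)
  obtain a b where x: "x = (a, b)" by force
  obtain c d where y: "y = (c, d)" by force
  have u: "word_rank (2 * n) u < (2 * n) ^ length u" using Cons.prems word_rank_less by simp
  have v: "word_rank (2 * n) v < (2 * n) ^ length u" using Cons.prems Cons.hyps word_rank_less[of v n] by simp
  define P where "P = (2 * n) ^ length u"
  have dv: "(x * P + r) div P = x" if "r < P" for x r :: nat using that by simp
  have e: "(2 * a + of_bool b) * P + word_rank (2 * n) u = (2 * c + of_bool d) * P + word_rank (2 * n) v"
    using Cons.prems Cons.hyps x y by (simp add: P_def)
  have "((2 * a + of_bool b) * P + word_rank (2 * n) u) div P = 2 * a + of_bool b"
    "((2 * c + of_bool d) * P + word_rank (2 * n) v) div P = 2 * c + of_bool d"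
    using u v unfolding P_def[symmetric] by (simp_all only: dv)
  then have "2 * a + of_bool b = 2 * c + (of_bool d :: nat)" using e by metis
  then have "a = c \<and> b = d" by (cases b; cases d) (simp_all, presburger+)
  then show ?case using Cons e x y by simp
qed simp

text \<open>Exactly half of \<open>v\<close> cancels, so multiplication by \<open>v\<close> replaces
  a prefix of \<open>w\<close> by an equally long one of smaller rank. That prefix lies within the
  left half of \<open>w\<close>, and the final letters, which the inverse of \<open>w\<close> shows
  in its own left half, are untouched.\<close>

lemma tie_break_less:
  assumes vw: "reduced v" "reduced w" and n: "fst ` set v \<subseteq> {..<n}" "fst ` set w \<subseteq> {..<n}"
    and half: "2 * cancel v w = length v" "length v \<le> length w"
    and less: "word_rank (2 * n) (take (cancel v w) v) < word_rank (2 * n) (take (cancel v w) w)"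
  shows "tie_break (2 * n) (foldr red_cons v w) < tie_break (2 * n) w"
    and "length (foldr red_cons v w) = length w"
proof -
  define k p q b where "k = cancel v w" and "p = take k v" and "q = take k w" and "b = drop k w"
  have vk: "length v = 2 * k" using half by (simp add: k_def)
  have vw': "foldr red_cons v w = p @ b"
    using foldr_red_cons_cancel[OF vw] vk by (simp add: k_def[symmetric] p_def b_def)
  have w: "w = q @ b" by (simp add: q_def b_def)
  have l: "length p = k" "length q = k" using vk half by (auto simp: p_def q_def)
  show len: "length (foldr red_cons v w) = length w" using vw' w l by simp
  define h :: nat where "h = (length w + 1) div 2"
  have "2 * k \<le> length w" using vk half by simp
  then have h: "k \<le> h" "h + k \<le> length w + 1" "h \<le> length b \<or> k = 0" using w l by (auto simp: h_def)
  have t1: "take h (p @ b) = p @ take (h - k) b" "take h w = q @ take (h - k) b"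
    using h l w by auto
  have t2: "take h (winv (p @ b)) = take h (winv w)"
  proof (cases "k = 0")
    case True
    then show ?thesis using l w by simp
  next
    case False
    then have "h \<le> length b" using h by simp
    then show ?thesis using w by simp
  qed
  have pos: "0 < (2 * n) ^ length (take (h - k) b)"
  proof (cases "n = 0")
    case True
    then have "w = []" using n by (cases w) auto
    then show ?thesis by (simp add: b_def)
  qed simp
  have "word_rank (2 * n) p * (2 * n) ^ length (take (h - k) b) < word_rank (2 * n) q * (2 * n) ^ length (take (h - k) b)"
    using less pos by (intro mult_strict_right_mono) (simp_all add: p_def q_def k_def)
  then have "word_rank (2 * n) (take h (p @ b)) < word_rank (2 * n) (take h w)"
    unfolding t1 word_rank_append by simp
  then show "tie_break (2 * n) (foldr red_cons v w) < tie_break (2 * n) w"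
    unfolding tie_break_def vw' len[unfolded vw'] h_def[symmetric] t2 by (rule add_strict_right_mono)
qed

section \<open>Nielsen generators\<close>

definition signed_perm :: "nat \<Rightarrow> (nat \<Rightarrow> nat) \<Rightarrow> (nat \<Rightarrow> bool) \<Rightarrow> (nat \<times> bool) list \<Rightarrow> (nat \<times> bool) list" where
  "signed_perm n \<pi> b = free_aut {..<n} (\<lambda>i. [(\<pi> i, b i)])"

definition transvection :: "nat \<Rightarrow> (nat \<times> bool) list \<Rightarrow> (nat \<times> bool) list" where
  "transvection n = free_aut {..<n} (\<lambda>i. if i = 0 then [(0, True), (1, True)] else [(i, True)])"

definition nielsen_gens :: "nat \<Rightarrow> ((nat \<times> bool) list \<Rightarrow> (nat \<times> bool) list) set" where
  "nielsen_gens n = insert (transvection n) {signed_perm n \<pi> b | \<pi> b. bij_betw \<pi> {..<n} {..<n}}"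

lemma signed_perm_letter:
  assumes "bij_betw \<pi> {..<n} {..<n}" "i < n"
  shows "signed_perm n \<pi> b [(i, s)] = [(\<pi> i, b i = s)]"
proof -
  have g: "(\<lambda>i. [(\<pi> i, b i)]) \<in> {..<n} \<rightarrow> carrier (free_group {..<n})"
    using bij_betwE[OF assms(1)] by auto
  show ?thesis
    using free_aut_letter[OF g, of i s] assms bij_betwE[OF assms(1)] by (auto simp: signed_perm_def inv_letter)
qed

lemma signed_perm_carrier:
  assumes pi: "bij_betw \<pi> {..<n} {..<n}"
  shows "signed_perm n \<pi> b \<in> carrier (right_Aut (free_group {..<n}))"
proof -
  note F = group_free_group[of "{..<n}"]
  let ?\<rho> = "inv_into {..<n} \<pi>"
  have r: "?\<rho> i < n" "\<pi> (?\<rho> i) = i" if "i < n" for i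
    using that pi bij_betw_inv_into_right[OF pi] bij_betwE[OF bij_betw_inv_into[OF pi]] by auto
  have l: "?\<rho> (\<pi> i) = i" "\<pi> i < n" if "i < n" for i
    using that pi bij_betw_inv_into_left[OF pi] bij_betwE[OF pi] by auto
  have g: "(\<lambda>i. [(\<pi> i, b i)]) \<in> {..<n} \<rightarrow> carrier (free_group {..<n})"
    and h: "(\<lambda>i. [(?\<rho> i, b (?\<rho> i))]) \<in> {..<n} \<rightarrow> carrier (free_group {..<n})"
    using l r by auto
  show ?thesis
    unfolding signed_perm_def
    by (rule free_aut_carrier[OF g h])
      (use l r in \<open>auto simp: free_ext_letter[OF F g] free_ext_letter[OF F h] inv_letter\<close>)
qed

lemma two_letters:
  "i \<noteq> j \<Longrightarrow> [(i, s), (j, t)] = [(i, s)] \<otimes>\<^bsub>free_group S\<^esub> [(j, t)]"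
  by (simp add: mult_free_group)

locale free_rank =
  fixes n :: nat
  assumes n2: "2 \<le> n"
begin

abbreviation (input) "F \<equiv> free_group {..<n}"
abbreviation (input) "AF \<equiv> right_Aut (free_group {..<n})"

sublocale F: group F by (rule group_free_group)
sublocale A: group AF by (rule group_right_Aut[OF group_free_group])

lemma aut_mult: "\<lbrakk>\<sigma> \<in> carrier AF; x \<in> carrier F; y \<in> carrier F\<rbrakk> \<Longrightarrow> \<sigma> (x \<otimes>\<^bsub>F\<^esub> y) = \<sigma> x \<otimes>\<^bsub>F\<^esub> \<sigma> y"
  using right_AutD(1) hom_mult by fastforce

lemma aut_inv: "\<lbrakk>\<sigma> \<in> carrier AF; x \<in> carrier F\<rbrakk> \<Longrightarrow> \<sigma> (inv\<^bsub>F\<^esub> x) = inv\<^bsub>F\<^esub> \<sigma> x"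
  using group_hom.hom_inv[of F F \<sigma> x] right_AutD(1)[of \<sigma> F]
  by (simp add: group_hom_def group_hom_axioms_def F.is_group)

lemma aut_one: "\<sigma> \<in> carrier AF \<Longrightarrow> \<sigma> [] = []"
  using hom_one[OF right_AutD(1), of \<sigma> F] F.is_group by simp

lemma aut_letter_inv: "\<lbrakk>\<sigma> \<in> carrier AF; i < n\<rbrakk> \<Longrightarrow> \<sigma> [(i, \<not> s)] = inv\<^bsub>F\<^esub> \<sigma> [(i, s)]"
  using aut_inv[of \<sigma> "[(i, s)]"] by (simp add: inv_letter)

lemma transvection_gens:
  "(\<lambda>i. if i = 0 then [(0, True), (1, True)] else [(i, True)]) \<in> {..<n} \<rightarrow> carrier F"
  using n2 by (auto simp: carrier_free_group reduced_def)

lemma transvection_0: "transvection n [(0, True)] = [(0, True)] \<otimes>\<^bsub>F\<^esub> [(1, True)]"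
  using free_aut_letter[OF transvection_gens, of 0 True] n2 by (simp add: transvection_def two_letters[symmetric])

lemma transvection_other: "\<lbrakk>i < n; i \<noteq> 0\<rbrakk> \<Longrightarrow> transvection n [(i, s)] = [(i, s)]"
  using free_aut_letter[OF transvection_gens, of i s] n2 by (auto simp: transvection_def inv_letter)

lemma transvection_carrier: "transvection n \<in> carrier AF"
proof -
  let ?g = "\<lambda>i. if i = 0 then [(0, True), (1, True)] else [(i, True)]"
  let ?h = "\<lambda>i. if i = 0 then [(0, True), (1, False)] else [(i, True)]"
  have h: "?h \<in> {..<n} \<rightarrow> carrier F" using n2 by (auto simp: carrier_free_group reduced_def)
  note e = free_ext_hom[OF F.is_group h] free_ext_hom[OF F.is_group transvection_gens]
    free_ext_letter[OF F.is_group h] free_ext_letter[OF F.is_group transvection_gens]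
  have "free_ext F ?h (?g a) = [(a, True)]" if "a \<in> {..<n}" for a
    using that n2 letter_mult_inv[where a="Suc 0" and b=False and S="{..<n}"]
    by (auto simp: two_letters[of 0 "Suc 0" _ _ "{..<n}"] hom_mult[OF e(1)] e(3) F.m_assoc inv_letter F.r_one[unfolded one_free_group])
  moreover have "free_ext F ?g (?h a) = [(a, True)]" if "a \<in> {..<n}" for a
    using that n2 letter_mult_inv[where a="Suc 0" and b=True and S="{..<n}"]
    by (auto simp: two_letters[of 0 "Suc 0" _ _ "{..<n}"] hom_mult[OF e(2)] e(4) F.m_assoc inv_letter F.r_one[unfolded one_free_group])
  ultimately show ?thesis unfolding transvection_def by (intro free_aut_carrier[OF transvection_gens h]) auto
qed

lemma nielsen_gens_carrier: "nielsen_gens n \<subseteq> carrier AF"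
  using signed_perm_carrier transvection_carrier by (auto simp: nielsen_gens_def)

abbreviation (input) "NG \<equiv> generate AF (nielsen_gens n)"

lemma NG_subgroup: "subgroup NG AF"
  by (rule A.generate_is_subgroup[OF nielsen_gens_carrier])

text \<open>The transvection is conjugated by a signed permutation that carries the letters
  \<open>(0, True)\<close> and \<open>(1, True)\<close> to \<open>(i, s)\<close> and
  \<open>(j, t)\<close>.\<close>

lemma elementary_move:
  assumes ij: "i < n" "j < n" "i \<noteq> j"
  obtains \<tau> where "\<tau> \<in> NG" "\<tau> [(i, s)] = [(i, s)] \<otimes>\<^bsub>F\<^esub> [(j, t)]"
    "\<And>k u. \<lbrakk>k < n; k \<noteq> i\<rbrakk> \<Longrightarrow> \<tau> [(k, u)] = [(k, u)]"
proof -
  \<comment> \<open>The inner transposition sends 0 to \<open>i\<close>; the outer one moves the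
    image of 1 to \<open>j\<close> and leaves \<open>i\<close> alone.\<close>
  define \<pi> where "\<pi> = Transposition.transpose (Transposition.transpose 0 i 1) j \<circ> Transposition.transpose 0 i"
  have "\<pi> permutes {..<n}"
    unfolding \<pi>_def using ij n2
    by (intro permutes_compose permutes_swap_id) (auto simp: transpose_def)
  then have pi: "bij_betw \<pi> {..<n} {..<n}" by (simp add: permutes_imp_bij)
  have p0: "\<pi> 0 = i" "\<pi> 1 = j" using ij by (auto simp: \<pi>_def transpose_def)
  define b where "b = (\<lambda>k::nat. if k = 0 then s else t)"
  let ?S = "signed_perm n \<pi> b" and ?U = "transvection n"
  have S: "?S \<in> carrier AF" "?S \<in> NG" using signed_perm_carrier[OF pi] pi
    by (auto intro!: generate.incl simp: nielsen_gens_def)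
  have U: "?U \<in> carrier AF" "?U \<in> NG" using transvection_carrier
    by (auto intro!: generate.incl simp: nielsen_gens_def)
  let ?T = "inv\<^bsub>AF\<^esub> ?S \<otimes>\<^bsub>AF\<^esub> ?U \<otimes>\<^bsub>AF\<^esub> ?S"
  have T: "?T \<in> NG" using S U NG_subgroup by (simp add: subgroup.m_closed subgroup.m_inv_closed)
  have Tm: "?T x = ?S (?U ((inv\<^bsub>AF\<^esub> ?S) x))" if "x \<in> carrier F" for x
    using that S U right_AutD(2)[of "inv\<^bsub>AF\<^esub> ?S" F x] by (simp add: right_Aut_mult)
  have iS: "(inv\<^bsub>AF\<^esub> ?S) [(\<pi> k, b k = u)] = [(k, u)]" if "k < n" for k u
    using right_Aut_inv(1)[OF F.is_group S(1), of "[(k, u)]"] signed_perm_letter[OF pi that, of b u] that by simp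
  have n01: "0 < n" "1 < n" using n2 by auto
  show thesis
  proof (rule that[OF T])
    have "(inv\<^bsub>AF\<^esub> ?S) [(i, s)] = [(0, True)]" using iS[of 0 True] n01 p0 by (simp add: b_def)
    then have "?T [(i, s)] = ?S ([(0, True)] \<otimes>\<^bsub>F\<^esub> [(1, True)])"
      using ij by (subst Tm) (simp_all add: transvection_0)
    also have "\<dots> = ?S [(0, True)] \<otimes>\<^bsub>F\<^esub> ?S [(1, True)]" using n01 by (intro aut_mult[OF S(1)]) auto
    also have "\<dots> = [(i, s)] \<otimes>\<^bsub>F\<^esub> [(j, t)]"
      using signed_perm_letter[OF pi n01(1)] signed_perm_letter[OF pi n01(2)] p0 by (simp add: b_def)
    finally show "?T [(i, s)] = [(i, s)] \<otimes>\<^bsub>F\<^esub> [(j, t)]" .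
  next
    fix k u assume k: "k < n" "k \<noteq> i"
    obtain l where l: "l < n" "\<pi> l = k" using k bij_betw_imp_surj_on[OF pi] by (metis imageE lessThan_iff)
    have l0: "l \<noteq> 0" using l(2) p0(1) k(2) by metis
    have "(inv\<^bsub>AF\<^esub> ?S) [(k, u)] = [(l, b l = u)]" using iS[of l "b l = u"] l by (cases "b l"; cases u) auto
    then show "?T [(k, u)] = [(k, u)]"
      using l l0 k by (subst Tm) (auto simp: transvection_other signed_perm_letter[OF pi])
  qed
qed

lemma aut_letter_closed: "\<lbrakk>\<phi> \<in> carrier AF; fst p < n\<rbrakk> \<Longrightarrow> \<phi> [p] \<in> carrier F"
  by (cases p) (simp add: right_AutD(2))

lemma aut_letter_winv: "\<lbrakk>\<phi> \<in> carrier AF; i < n\<rbrakk> \<Longrightarrow> \<phi> [(i, \<not> s)] = winv (\<phi> [(i, s)])"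
  by (simp add: aut_letter_inv inv_free_group right_AutD(2))

text \<open>Among the tuples \<open>(\<phi> x\<^sub>i)\<^sub>i\<close> in one Nielsen class, minimise the total length first and the
  total \<open>tie_break\<close> second.\<close>

definition nielsen_order where
  "nielsen_order = measures [\<lambda>\<phi>. \<Sum>k<n. length (\<phi> [(k, True)]), \<lambda>\<phi>. \<Sum>k<n. tie_break (2 * n) (\<phi> [(k, True)])]"

definition nielsen_minimal where
  "nielsen_minimal \<phi> \<longleftrightarrow> \<phi> \<in> carrier AF \<and> (\<forall>\<tau>\<in>NG. (\<tau> \<otimes>\<^bsub>AF\<^esub> \<phi>, \<phi>) \<notin> nielsen_order)"

text \<open>In \<open>\<tau> \<otimes> \<phi>\<close> the factor \<open>\<tau>\<close> acts first,
  so an elementary move changes only the i-th member of the tuple, and right multiplication by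
  \<open>v\<close> is among the moves.\<close>

lemma nielsen_minimal_move:
  fixes i j :: nat and s t :: bool
  assumes m: "nielsen_minimal \<phi>" and ij: "i < n" "j < n" "i \<noteq> j"
  defines "u \<equiv> \<phi> [(i, s)]" and "v \<equiv> \<phi> [(j, t)]"
  shows "length u \<le> length (u \<otimes>\<^bsub>F\<^esub> v)"
    and "length u = length (u \<otimes>\<^bsub>F\<^esub> v) \<Longrightarrow> tie_break (2 * n) u \<le> tie_break (2 * n) (u \<otimes>\<^bsub>F\<^esub> v)"
proof -
  have \<phi>: "\<phi> \<in> carrier AF" using m by (simp add: nielsen_minimal_def)
  obtain \<tau> where \<tau>: "\<tau> \<in> NG" "\<tau> [(i, s)] = [(i, s)] \<otimes>\<^bsub>F\<^esub> [(j, t)]"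
    "\<And>k u. \<lbrakk>k < n; k \<noteq> i\<rbrakk> \<Longrightarrow> \<tau> [(k, u)] = [(k, u)]"
    using elementary_move[OF ij, of s t] by metis
  have \<tau>A: "\<tau> \<in> carrier AF" using \<tau>(1) NG_subgroup subgroup.mem_carrier by fastforce
  have uv: "u \<in> carrier F" "v \<in> carrier F" using \<phi> ij by (auto simp: u_def v_def right_AutD(2))
  have i1: "(\<tau> \<otimes>\<^bsub>AF\<^esub> \<phi>) [(i, s)] = u \<otimes>\<^bsub>F\<^esub> v"
    using ij \<phi> by (simp add: right_Aut_mult \<tau>(2) aut_mult u_def v_def)
  have k1: "(\<tau> \<otimes>\<^bsub>AF\<^esub> \<phi>) [(k, True)] = \<phi> [(k, True)]" if "k < n" "k \<noteq> i" for k
    using that by (simp add: right_Aut_mult \<tau>(3))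
  \<comment> \<open>Length and \<open>tie_break\<close> are invariant under inversion, so the
    changed member may be measured at the letter \<open>(i, s)\<close> instead of at the positive
    generator.\<close>
  have *: "(\<Sum>k<n. q ((\<tau> \<otimes>\<^bsub>AF\<^esub> \<phi>) [(k, True)])) + q u = (\<Sum>k<n. q (\<phi> [(k, True)])) + q (u \<otimes>\<^bsub>F\<^esub> v)"
    if q: "\<And>w. q (winv w) = q w" for q :: "(nat \<times> bool) list \<Rightarrow> nat"
  proof -
    have sgn: "q (\<psi> [(i, True)]) = q (\<psi> [(i, s)])" if "\<psi> \<in> carrier AF" for \<psi>
      using aut_letter_winv[OF that ij(1), of s] q by (cases s) auto
    have "(\<Sum>k\<in>{..<n} - {i}. q ((\<tau> \<otimes>\<^bsub>AF\<^esub> \<phi>) [(k, True)])) = (\<Sum>k\<in>{..<n} - {i}. q (\<phi> [(k, True)]))"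
      by (rule sum.cong) (auto simp: k1)
    moreover have "q ((\<tau> \<otimes>\<^bsub>AF\<^esub> \<phi>) [(i, True)]) = q (u \<otimes>\<^bsub>F\<^esub> v)" "q (\<phi> [(i, True)]) = q u"
      using sgn[of "\<tau> \<otimes>\<^bsub>AF\<^esub> \<phi>"] sgn[OF \<phi>] \<tau>A \<phi> i1 by (simp_all add: u_def)
    ultimately show ?thesis
      using ij sum.remove[of "{..<n}" i "\<lambda>k. q ((\<tau> \<otimes>\<^bsub>AF\<^esub> \<phi>) [(k, True)])"]
        sum.remove[of "{..<n}" i "\<lambda>k. q (\<phi> [(k, True)])"] by simp
  qed
  have "(\<tau> \<otimes>\<^bsub>AF\<^esub> \<phi>, \<phi>) \<notin> nielsen_order" using m \<tau>(1) by (simp add: nielsen_minimal_def)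
  then show "length u \<le> length (u \<otimes>\<^bsub>F\<^esub> v)"
    and "length u = length (u \<otimes>\<^bsub>F\<^esub> v) \<Longrightarrow> tie_break (2 * n) u \<le> tie_break (2 * n) (u \<otimes>\<^bsub>F\<^esub> v)"
    using *[of length] *[of "tie_break (2 * n)"] by (auto simp: nielsen_order_def tie_break_winv)
qed

section \<open>Nielsen-minimal tuples\<close>

context
  fixes \<phi>
  assumes m: "nielsen_minimal \<phi>"
begin

abbreviation (input) "wd p \<equiv> \<phi> [p]"
abbreviation (input) "noninv p q \<equiv> \<not> (fst p = fst q \<and> snd p \<noteq> snd q)"

lemma minimal_aut: "\<phi> \<in> carrier AF"
  using m by (simp add: nielsen_minimal_def)

lemma wd_reduced: "fst p < n \<Longrightarrow> reduced (wd p) \<and> fst ` set (wd p) \<subseteq> {..<n}"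
  using aut_letter_closed[OF minimal_aut, of p] by (simp add: carrier_free_group)

lemma wd_winv: "fst p < n \<Longrightarrow> winv (wd p) = wd (fst p, \<not> snd p)"
  using aut_letter_winv[OF minimal_aut, of "fst p" "snd p"] by simp

lemma wd_nonempty: "fst p < n \<Longrightarrow> wd p \<noteq> []"
proof
  assume p: "fst p < n" "wd p = []"
  have "inj_on \<phi> (carrier F)" using minimal_aut by (simp add: carrier_right_Aut bij_betw_def)
  moreover have "[p] \<in> carrier F" "[] \<in> carrier F" using p F.one_closed by (cases p, simp_all)
  ultimately have "[p] = []" using p aut_one[OF minimal_aut] by (metis inj_onD)
  then show False by simp
qed

text \<open>By minimality neither \<open>wd p\<close> times \<open>wd q\<close> nor the inverse
  product is shorter than its first factor, which bounds the cancellation by half of either length.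
  The case \<open>p = q\<close> is not a move and is settled by \<open>cancel_self\<close>.\<close>

lemma cancel_half:
  assumes "fst p < n" "fst q < n" "noninv p q"
  shows "2 * cancel (wd p) (wd q) \<le> length (wd p)" "2 * cancel (wd p) (wd q) \<le> length (wd q)"
proof -
  have "2 * cancel (wd p) (wd q) \<le> length (wd p) \<and> 2 * cancel (wd p) (wd q) \<le> length (wd q)"
  proof (cases "fst p = fst q")
    case True
    then have "p = q" using assms by (simp add: prod_eq_iff)
    then show ?thesis using cancel_self[of "wd p"] wd_reduced[OF assms(1)] wd_nonempty[OF assms(1)] by simp
  next
    case False
    have "length (wd p) \<le> length (wd p \<otimes>\<^bsub>F\<^esub> wd q)"
      using nielsen_minimal_move(1)[OF m assms(1,2) False, of "snd p" "snd q"] by simp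
    moreover have "length (winv (wd q)) \<le> length (winv (wd q) \<otimes>\<^bsub>F\<^esub> winv (wd p))"
      using nielsen_minimal_move(1)[OF m assms(2,1) False[symmetric], of "\<not> snd q" "\<not> snd p"] assms
      by (simp add: wd_winv)
    ultimately show ?thesis
      using length_foldr_red_cons[of "wd p" "wd q"] length_foldr_red_cons[of "winv (wd q)" "winv (wd p)"]
        wd_reduced assms reduced_winv[of "wd p"] reduced_winv[of "wd q"] cancel_winv[of "wd q" "wd p"]
      by (simp add: mult_free_group)
  qed
  then show "2 * cancel (wd p) (wd q) \<le> length (wd p)" "2 * cancel (wd p) (wd q) \<le> length (wd q)" by auto
qed

text \<open>Otherwise \<open>tie_break_less\<close> would improve the member \<open>wd r\<close>.
  Moves multiply on the right, so the product is formed with inverses, \<open>winv (wd r)\<close>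
  times \<open>winv (wd q)\<close>, which leaves \<open>tie_break\<close> unaffected.\<close>

lemma minimal_rank:
  assumes q: "fst q < n" and r: "fst r < n" and qr: "fst q \<noteq> fst r"
    and half: "2 * cancel (wd q) (wd r) = length (wd q)"
  shows "\<not> word_rank (2 * n) (take (cancel (wd q) (wd r)) (wd q)) < word_rank (2 * n) (take (cancel (wd q) (wd r)) (wd r))"
proof
  let ?v = "wd q" and ?w = "wd r"
  assume less: "word_rank (2 * n) (take (cancel ?v ?w) ?v) < word_rank (2 * n) (take (cancel ?v ?w) ?w)"
  have le: "length ?v \<le> length ?w" using cancel_half(2)[OF q r] qr half by simp
  have red: "reduced ?v" "reduced ?w" "fst ` set ?v \<subseteq> {..<n}" "fst ` set ?w \<subseteq> {..<n}"
    using wd_reduced q r by auto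
  note tb = tie_break_less[OF red half le less]
  have c: "?v \<in> carrier F" "?w \<in> carrier F" using aut_letter_closed[OF minimal_aut] q r by auto
  have e: "winv ?w \<otimes>\<^bsub>F\<^esub> winv ?v = winv (?v \<otimes>\<^bsub>F\<^esub> ?w)"
    using c F.inv_mult_group[OF c] inv_free_group[OF c(1)] inv_free_group[OF c(2)] inv_free_group[OF F.m_closed[OF c]]
    by simp
  have "length (winv ?w) = length (winv ?w \<otimes>\<^bsub>F\<^esub> winv ?v)" using tb(2) by (simp only: e) (simp add: mult_free_group)
  then have "tie_break (2 * n) (winv ?w) \<le> tie_break (2 * n) (winv ?w \<otimes>\<^bsub>F\<^esub> winv ?v)"
    using nielsen_minimal_move(2)[OF m r q qr[symmetric], of "\<not> snd r" "\<not> snd q"] q r by (simp add: wd_winv)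
  then show False using tb(1) by (simp only: e tie_break_winv) (simp add: mult_free_group)
qed

text \<open>If nothing of \<open>wd q\<close> survived between its neighbours, each neighbour would
  consume exactly one half. By \<open>minimal_rank\<close> neither the left half of
  \<open>wd q\<close> nor that of its inverse has smaller rank than the other, so they coincide, and
  \<open>wd q\<close> would cancel half of itself.\<close>

lemma cancel_sum:
  assumes p: "fst p < n" and q: "fst q < n" and r: "fst r < n" and pq: "noninv p q" and qr: "noninv q r"
  shows "cancel (wd p) (wd q) + cancel (wd q) (wd r) < length (wd q)"
proof (rule ccontr)
  let ?v = "wd q"
  assume "\<not> ?thesis"
  then have k: "2 * cancel (wd p) ?v = length ?v" "2 * cancel ?v (wd r) = length ?v"
    using cancel_half(2)[OF p q pq] cancel_half(1)[OF q r qr] by auto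
  define k where "k = cancel ?v (wd r)"
  have kk: "cancel (wd p) ?v = k" "cancel ?v (wd r) = k" "2 * k = length ?v" using k by (auto simp: k_def)
  have P: "take k (winv (wd p)) = take k ?v" using cpl_take[of "winv (wd p)" ?v] kk by (simp add: cancel_def)
  have Q: "take k (winv ?v) = take k (wd r)" using cpl_take[of "winv ?v" "wd r"] kk by (simp add: cancel_def)
  have red: "reduced ?v" "fst ` set ?v \<subseteq> {..<n}" "fst ` set (winv ?v) \<subseteq> {..<n}"
    using wd_reduced[OF q] wd_reduced[of "(fst q, \<not> snd q)"] q by (auto simp: wd_winv[OF q])
  have cs: "2 * cancel ?v ?v < length ?v" using cancel_self[OF red(1) wd_nonempty[OF q]] .
  have ne: "take k ?v \<noteq> take k (winv ?v)"
  proof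
    assume "take k ?v = take k (winv ?v)"
    then have "k \<le> cancel ?v ?v" using kk by (simp add: cancel_def le_cpl_iff)
    then show False using cs kk by simp
  qed
  \<comment> \<open>Equality would let \<open>wd q\<close> cancel half of itself. As the neighbours
    are not inverse to \<open>q\<close> either, the generator indices differ, which
    \<open>minimal_rank\<close> requires.\<close>
  have "p \<noteq> q" "r \<noteq> q" using cs kk by auto
  then have idx: "fst q \<noteq> fst r" "fst q \<noteq> fst p" using pq qr by (auto simp: prod_eq_iff)
  have "\<not> word_rank (2 * n) (take k ?v) < word_rank (2 * n) (take k (winv ?v))"
    using minimal_rank[OF q r idx(1)] kk Q by simp
  moreover have "\<not> word_rank (2 * n) (take k (winv ?v)) < word_rank (2 * n) (take k ?v)"
    using minimal_rank[of "(fst q, \<not> snd q)" "(fst p, \<not> snd p)"] q p idx kk P cancel_winv[of ?v "wd p"]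
    by (simp add: wd_winv[symmetric])
  moreover have "fst ` set (take k ?v) \<subseteq> {..<n}" "fst ` set (take k (winv ?v)) \<subseteq> {..<n}"
    using red(2,3) set_take_subset[of k ?v] set_take_subset[of k "winv ?v"] by blast+
  moreover have "length (take k ?v) = length (take k (winv ?v))" by simp
  ultimately have "take k ?v = take k (winv ?v)" by (intro word_rank_inj[of _ n]) auto
  then show False using ne by simp
qed

text \<open>By \<open>cancel_sum\<close> a cancellation from the left never reaches past the first
  factor of the image of \<open>y\<close>, and every factor keeps a letter. The summand for a
  preceding letter \<open>p\<close> is the strengthening that the induction needs.\<close>

lemma minimal_length:
  assumes "y \<in> carrier F" "y \<noteq> []" "fst p < n" "noninv p (hd y)"
  shows "cancel (wd p) (\<phi> y) = cancel (wd p) (wd (hd y)) \<and>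
    length y + cancel (wd p) (wd (hd y)) \<le> length (\<phi> y)"
  using assms
proof (induction y arbitrary: p)
  case (Cons s y)
  note c = Cons_free_group[of "fst s" "snd s" y "{..<n}", simplified, OF Cons.prems(1)]
  show ?case
  proof (cases "y = []")
    case True
    have "2 * cancel (wd p) (wd s) \<le> length (wd s)" using cancel_half(2)[of p s] Cons.prems c by simp
    moreover have "length (wd s) > 0" using wd_nonempty[of s] c by simp
    ultimately have "Suc (cancel (wd p) (wd s)) \<le> length (wd s)" by linarith
    then show ?thesis using True by simp
  next
    case False
    let ?c = "cancel (wd s) (wd (hd y))"
    have hy: "fst (hd y) < n" using c(2) False by (cases y) (auto simp: carrier_free_group)
    have ni: "noninv s (hd y)" using Cons.prems(1) False by (auto simp: carrier_free_group reduced_Cons)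
    have IH: "cancel (wd s) (\<phi> y) = ?c" "length y + ?c \<le> length (\<phi> y)"
      using Cons.IH[OF c(2) False _ ni] c(1) by auto
    have yr: "reduced (\<phi> y)" "reduced (wd s)"
      using right_AutD(2)[OF minimal_aut c(2)] wd_reduced[of s] c(1) by (auto simp: carrier_free_group)
    have "[s] \<in> carrier F" using c(1) by (cases s) simp
    then have e: "\<phi> (s # y) = foldr red_cons (wd s) (\<phi> y)"
      using aut_mult[OF minimal_aut _ c(2), of "[s]"] c(3) by (simp add: mult_free_group)
    have sum: "cancel (wd p) (wd s) + ?c < length (wd s)"
      using cancel_sum[of p s "hd y"] Cons.prems c(1) hy ni by simp
    have len: "length (\<phi> (s # y)) + 2 * ?c = length (wd s) + length (\<phi> y)"
      using length_foldr_red_cons[OF yr(2,1)] IH(1) e by simp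
    define k where "k = length (wd s) - ?c"
    have "\<phi> (s # y) = take k (wd s) @ drop ?c (\<phi> y)"
      using foldr_red_cons_cancel[OF yr(2,1)] IH(1) e by (simp add: k_def)
    then have "take k (wd s) = take k (\<phi> (s # y))" "k \<le> length (\<phi> (s # y))"
      by (auto simp: k_def)
    then have "cpl (\<phi> (s # y)) (winv (wd p)) = cpl (wd s) (winv (wd p))"
      using sum by (intro cpl_eqI[of k]) (auto simp: k_def cancel_def cpl_commute)
    then have "cancel (wd p) (\<phi> (s # y)) = cancel (wd p) (wd s)" by (simp add: cancel_def cpl_commute)
    moreover have "length (s # y) + cancel (wd p) (wd s) \<le> length (\<phi> (s # y))"
      using len sum IH(2) by simp
    ultimately show ?thesis by simp
  qed
qed simp

text \<open>The preimage of a generator is nonempty and has an image of length 1, so by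
  \<open>minimal_length\<close> it is a single letter.\<close>

lemma minimal_letter:
  assumes "a < n"
  obtains p where "fst p < n" "(inv\<^bsub>AF\<^esub> \<phi>) [(a, True)] = [p]"
proof -
  let ?y = "(inv\<^bsub>AF\<^esub> \<phi>) [(a, True)]"
  have y: "?y \<in> carrier F" using assms right_AutD(2)[OF A.inv_closed[OF minimal_aut]] by simp
  have \<phi>y: "\<phi> ?y = [(a, True)]" using right_Aut_inv(2)[OF F.is_group minimal_aut] assms by simp
  have ne: "?y \<noteq> []" using \<phi>y aut_one[OF minimal_aut] by auto
  have "fst (hd ?y) < n" using y ne by (cases ?y) (auto simp: carrier_free_group)
  \<comment> \<open>For the preceding letter \<open>p\<close> the head of the word itself is taken,
    since it is never its own inverse; its summand is then discarded.\<close>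
  then have "length ?y \<le> 1" using minimal_length[OF y ne, of "hd ?y"] \<phi>y by simp
  then obtain p where "?y = [p]" using ne by (cases ?y) auto
  moreover from this have "fst p < n" using y by (cases p) simp
  ultimately show thesis by (rule that[rotated])
qed

text \<open>The inverse sends generators to letters, and injectivity forbids two of these letters to
  have the same index; so it is a signed permutation.\<close>

lemma minimal_in_NG: "\<phi> \<in> NG"
proof -
  let ?i = "inv\<^bsub>AF\<^esub> \<phi>"
  have i: "?i \<in> carrier AF" using minimal_aut by simp
  have "\<forall>a. \<exists>p. a < n \<longrightarrow> fst p < n \<and> ?i [(a, True)] = [p]" using minimal_letter by metis
  then obtain P where P: "\<And>a. a < n \<Longrightarrow> fst (P a) < n \<and> ?i [(a, True)] = [P a]" by metis
  have inj: "inj_on ?i (carrier F)" using i by (simp add: carrier_right_Aut bij_betw_def)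
  have "inj_on (\<lambda>a. fst (P a)) {..<n}"
  proof (rule inj_onI, rule ccontr)
    fix a a' assume a: "a \<in> {..<n}" "a' \<in> {..<n}" "fst (P a) = fst (P a')" "a \<noteq> a'"
    define t where "t = (snd (P a) = snd (P a'))"
    have "?i [(a', t)] = [P a]"
      using P[of a] P[of a'] a aut_letter_winv[OF i, of a' True] by (cases t) (auto simp: t_def prod_eq_iff split: prod.splits)
    then have "[(a, True)] = [(a', t)]" using P[of a] a inj_onD[OF inj, of "[(a, True)]" "[(a', t)]"] by simp
    then show False using a by simp
  qed
  moreover have "(\<lambda>a. fst (P a)) ` {..<n} \<subseteq> {..<n}" using P by auto
  ultimately have pi: "bij_betw (\<lambda>a. fst (P a)) {..<n} {..<n}"
    by (simp add: bij_betw_def endo_inj_surj)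
  have "?i = signed_perm n (\<lambda>a. fst (P a)) (\<lambda>a. snd (P a))"
    by (rule right_Aut_free_eqI[OF i signed_perm_carrier[OF pi]]) (use P signed_perm_letter[OF pi] in auto)
  then have "?i \<in> NG" using pi by (auto intro!: generate.incl simp: nielsen_gens_def)
  then have "inv\<^bsub>AF\<^esub> ?i \<in> NG" using NG_subgroup subgroup.m_inv_closed by fastforce
  then show ?thesis using minimal_aut by simp
qed

end

text \<open>A tuple that is not minimal is lowered by an element of the generated subgroup acting
  first; the order is well-founded, so the descent stops at a minimal tuple.\<close>

theorem nielsen_generation: "generate (right_Aut (free_group {..<n})) (nielsen_gens n) = carrier (right_Aut (free_group {..<n}))"
proof -
  have "\<phi> \<in> carrier AF \<longrightarrow> \<phi> \<in> NG" for \<phi>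
  proof (rule wf_induct[of nielsen_order "\<lambda>\<phi>. \<phi> \<in> carrier AF \<longrightarrow> \<phi> \<in> NG" \<phi>])
    show "wf nielsen_order" by (simp add: nielsen_order_def)
  next
    fix \<phi> assume IH: "\<forall>\<psi>. (\<psi>, \<phi>) \<in> nielsen_order \<longrightarrow> \<psi> \<in> carrier AF \<longrightarrow> \<psi> \<in> NG"
    show "\<phi> \<in> carrier AF \<longrightarrow> \<phi> \<in> NG"
    proof
      assume \<phi>: "\<phi> \<in> carrier AF"
      show "\<phi> \<in> NG"
      proof (cases "nielsen_minimal \<phi>")
        case True
        then show ?thesis by (rule minimal_in_NG)
      next
        case False
        then obtain \<tau> where \<tau>: "\<tau> \<in> NG" "(\<tau> \<otimes>\<^bsub>AF\<^esub> \<phi>, \<phi>) \<in> nielsen_order"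
          using \<phi> by (auto simp: nielsen_minimal_def)
        have \<tau>A: "\<tau> \<in> carrier AF" using \<tau>(1) NG_subgroup subgroup.mem_carrier by fastforce
        then have "\<tau> \<otimes>\<^bsub>AF\<^esub> \<phi> \<in> NG" using IH \<tau> \<phi> by simp
        then have "inv\<^bsub>AF\<^esub> \<tau> \<otimes>\<^bsub>AF\<^esub> (\<tau> \<otimes>\<^bsub>AF\<^esub> \<phi>) \<in> NG"
          using \<tau>(1) NG_subgroup by (meson subgroup.m_closed subgroup.m_inv_closed)
        then show ?thesis using \<tau>A \<phi> by (simp add: A.m_assoc[symmetric])
      qed
    qed
  qed
  then show ?thesis using NG_subgroup subgroup.subset by blast
qed

end

section \<open>Exponent sums\<close>

text \<open>The homomorphism from the free group to the Heisenberg group that sends the \<open>i\<close>-th generator to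
  the \<open>i\<close>-th unit vector collects the exponent sums and the map \<open>\<lambda>\<close> to the exterior square with
  \<open>\<lambda>(xy) = \<lambda>(x) + \<lambda>(y) + [x] \<and> [y]\<close>.\<close>

definition heisenberg :: "((nat \<Rightarrow> int) \<times> (nat \<Rightarrow> nat \<Rightarrow> int)) monoid" where
  "heisenberg = \<lparr>carrier = UNIV,
     monoid.mult = (\<lambda>(a, P) (b, Q). (\<lambda>i. a i + b i, \<lambda>j k. P j k + Q j k + a j * b k - a k * b j)),
     one = (\<lambda>_. 0, \<lambda>_ _. 0)\<rparr>"

lemma group_heisenberg: "group heisenberg"
proof (rule groupI)
  fix x assume "x \<in> carrier heisenberg"
  obtain a P where "x = (a, P)" by force
  then show "\<exists>y\<in>carrier heisenberg. y \<otimes>\<^bsub>heisenberg\<^esub> x = \<one>\<^bsub>heisenberg\<^esub>"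
    by (intro bexI[of _ "(\<lambda>i. - a i, \<lambda>j k. - P j k)"]) (auto simp: heisenberg_def fun_eq_iff)
qed (auto simp: heisenberg_def fun_eq_iff algebra_simps)

definition heis :: "(nat \<times> bool) list \<Rightarrow> (nat \<Rightarrow> int) \<times> (nat \<Rightarrow> nat \<Rightarrow> int)" where
  "heis = free_ext heisenberg (\<lambda>i. (\<lambda>j. of_bool (i = j), \<lambda>_ _. 0))"

definition expn :: "nat \<Rightarrow> (nat \<times> bool) list \<Rightarrow> int" where
  "expn j w = fst (heis w) j"

definition lam :: "nat \<Rightarrow> nat \<Rightarrow> (nat \<times> bool) list \<Rightarrow> int" where
  "lam j k w = snd (heis w) j k"

lemma free_group_induct [consumes 1, case_names Nil mult]:
  assumes "w \<in> carrier (free_group S)" "P []"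
    and "\<And>a b w. \<lbrakk>a \<in> S; w \<in> carrier (free_group S); P w\<rbrakk> \<Longrightarrow> P ([(a, b)] \<otimes>\<^bsub>free_group S\<^esub> w)"
  shows "P w"
  using assms(1)
proof (induction w)
  case (Cons x w)
  obtain a b where x: "x = (a, b)" by force
  note c = Cons_free_group[OF Cons.prems[unfolded x]]
  show ?case using assms(3)[OF c(1,2) Cons.IH[OF c(2)], of b] c(3) x by simp
qed (rule assms)

context free_rank
begin

lemma heis_hom: "heis \<in> hom F heisenberg"
  unfolding heis_def by (rule free_ext_hom[OF group_heisenberg]) (simp add: heisenberg_def)

lemma expn_mult: "\<lbrakk>x \<in> carrier F; y \<in> carrier F\<rbrakk> \<Longrightarrow> expn j (x \<otimes>\<^bsub>F\<^esub> y) = expn j x + expn j y"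
  using hom_mult[OF heis_hom] by (auto simp: expn_def heisenberg_def split: prod.splits)

lemma lam_mult: "\<lbrakk>x \<in> carrier F; y \<in> carrier F\<rbrakk> \<Longrightarrow>
    lam j k (x \<otimes>\<^bsub>F\<^esub> y) = lam j k x + lam j k y + expn j x * expn k y - expn k x * expn j y"
  using hom_mult[OF heis_hom] by (auto simp: expn_def lam_def heisenberg_def split: prod.splits)

lemma expn_Nil [simp]: "expn j [] = 0" and lam_Nil [simp]: "lam j k [] = 0"
  by (simp_all add: expn_def lam_def heis_def free_ext_def heisenberg_def)

lemma expn_inv:
  assumes "x \<in> carrier F" shows "expn j (inv\<^bsub>F\<^esub> x) = - expn j x"
  using expn_mult[of x "inv\<^bsub>F\<^esub> x" j] assms F.r_inv by simp

lemma lam_inv: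
  assumes "x \<in> carrier F" shows "lam j k (inv\<^bsub>F\<^esub> x) = - lam j k x"
  using lam_mult[of x "inv\<^bsub>F\<^esub> x" j k] assms F.r_inv by (simp add: expn_inv)

lemma expn_letter: "i < n \<Longrightarrow> expn j [(i, b)] = (if i = j then if b then 1 else -1 else 0)"
  and lam_letter: "i < n \<Longrightarrow> lam j k [(i, b)] = 0"
proof -
  assume i: "i < n"
  have t: "heis [(i, True)] = (\<lambda>j. of_bool (i = j), \<lambda>_ _. 0)"
    unfolding heis_def by (subst free_ext_letter[OF group_heisenberg, of _ "{..<n}"]) (use i in \<open>auto simp: heisenberg_def\<close>)
  have f: "[(i, False)] = inv\<^bsub>F\<^esub> [(i, True)]" using i by (simp add: inv_letter)
  have "expn j [(i, True)] = of_bool (i = j)" "lam j k [(i, True)] = 0" using t by (simp_all add: expn_def lam_def)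
  moreover from this have "expn j [(i, False)] = - of_bool (i = j)" "lam j k [(i, False)] = 0"
    unfolding f using i by (simp_all add: expn_inv lam_inv)
  ultimately show "expn j [(i, b)] = (if i = j then if b then 1 else -1 else 0)" "lam j k [(i, b)] = 0"
    by (cases b; simp)+
qed

lemma lam_swap: "w \<in> carrier F \<Longrightarrow> lam k j w = - lam j k w"
  by (induction rule: free_group_induct) (auto simp: lam_mult lam_letter)

text \<open>Both sides are homomorphisms to the integers with the same values at generators. The
  point is to apply it to functions whose additivity is the real content, as in
  \<open>eact_lam\<close>.\<close>

lemma additive_expand:
  fixes u :: "(nat \<times> bool) list \<Rightarrow> int"
  assumes u: "\<And>x y. \<lbrakk>x \<in> carrier F; y \<in> carrier F\<rbrakk> \<Longrightarrow> u (x \<otimes>\<^bsub>F\<^esub> y) = u x + u y" and w: "w \<in> carrier F"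
  shows "u w = (\<Sum>i<n. expn i w * u [(i, True)])"
proof (rule free_group_hom_eqI[OF group_integer_group _ _ _ w])
  show "u \<in> hom F integer_group" using u by (auto simp: hom_def)
  show "(\<lambda>w. \<Sum>i<n. expn i w * u [(i, True)]) \<in> hom F integer_group"
    by (auto simp: hom_def expn_mult algebra_simps sum.distrib)
  fix a assume "a \<in> {..<n}"
  then show "u [(a, True)] = (\<Sum>i<n. expn i [(a, True)] * u [(i, True)])"
    by (simp add: expn_letter if_distrib[of "\<lambda>x. x * _"] sum.delta cong: if_cong)
qed

definition mat :: "((nat \<times> bool) list \<Rightarrow> (nat \<times> bool) list) \<Rightarrow> nat \<Rightarrow> nat \<Rightarrow> int" where
  "mat \<sigma> i j = expn j (\<sigma> [(i, True)])"

text \<open>The left action on H applies the inverse automorphism, so \<open>imat\<close> governs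
  the two H-slots of a tensor, while \<open>mat\<close> governs the dual slot.\<close>

definition imat :: "((nat \<times> bool) list \<Rightarrow> (nat \<times> bool) list) \<Rightarrow> nat \<Rightarrow> nat \<Rightarrow> int" where
  "imat \<sigma> = mat (inv\<^bsub>AF\<^esub> \<sigma>)"

lemma expn_aut: "\<lbrakk>\<sigma> \<in> carrier AF; w \<in> carrier F\<rbrakk> \<Longrightarrow> expn j (\<sigma> w) = (\<Sum>i<n. expn i w * mat \<sigma> i j)"
  unfolding mat_def by (rule additive_expand)
    (auto simp: hom_mult[OF right_AutD(1)] expn_mult right_AutD(2))

lemma mat_mult:
  assumes "\<sigma> \<in> carrier AF" "\<tau> \<in> carrier AF" "i < n"
  shows "mat (\<sigma> \<otimes>\<^bsub>AF\<^esub> \<tau>) i k = (\<Sum>j<n. mat \<sigma> i j * mat \<tau> j k)"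
proof -
  have "mat (\<sigma> \<otimes>\<^bsub>AF\<^esub> \<tau>) i k = expn k (\<tau> (\<sigma> [(i, True)]))"
    using assms by (simp add: mat_def right_Aut_mult)
  also have "\<dots> = (\<Sum>j<n. expn j (\<sigma> [(i, True)]) * mat \<tau> j k)"
    using assms by (intro expn_aut) (auto simp: right_AutD(2))
  finally show ?thesis by (simp add: mat_def)
qed

lemma mat_one: "i < n \<Longrightarrow> mat \<one>\<^bsub>AF\<^esub> i j = (if i = j then 1 else 0)"
  by (simp add: mat_def right_Aut_one expn_letter)

lemma mat_imat:
  assumes "\<sigma> \<in> carrier AF" "i < n"
  shows "(\<Sum>j<n. mat \<sigma> i j * imat \<sigma> j k) = (if i = k then 1 else 0)"
    and "(\<Sum>j<n. imat \<sigma> i j * mat \<sigma> j k) = (if i = k then 1 else 0)"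
  using mat_mult[OF assms(1) A.inv_closed[OF assms(1)] assms(2), of k]
    mat_mult[OF A.inv_closed[OF assms(1)] assms(1,2), of k] assms
  by (simp_all add: imat_def mat_one)

lemma imat_mult:
  assumes "\<sigma> \<in> carrier AF" "\<tau> \<in> carrier AF" "i < n"
  shows "imat (\<sigma> \<otimes>\<^bsub>AF\<^esub> \<tau>) i k = (\<Sum>j<n. imat \<tau> i j * imat \<sigma> j k)"
  using mat_mult[of "inv\<^bsub>AF\<^esub> \<tau>" "inv\<^bsub>AF\<^esub> \<sigma>" i k] assms by (simp add: imat_def A.inv_mult_group)

section \<open>Coordinates of the coefficient module\<close>

abbreviation (input) "HF \<equiv> abelianization F"
abbreviation (input) "DF \<equiv> dual_group (abelianization F)"
abbreviation (input) "EF \<equiv> ext_square (abelianization F)"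
abbreviation (input) "VF \<equiv> V_group F"
abbreviation (input) "dF \<equiv> derived F (carrier F)"

sublocale dF: normal dF F by (rule F.derived_self_is_normal)
sublocale H: comm_group HF unfolding abelianization_def by (rule F.derived_quot_is_comm_group)
sublocale D: comm_group DF by (rule comm_group_dual[OF H.is_group])
sublocale E: comm_group EF by (rule comm_group_ext_square[OF H.is_group])

definition hcls :: "(nat \<times> bool) list \<Rightarrow> (nat \<times> bool) list set" where
  "hcls x = dF #>\<^bsub>F\<^esub> x"

lemma hcls_hom: "hcls \<in> hom F HF"
  unfolding hcls_def abelianization_def by (rule dF.r_coset_hom_Mod)

lemma hcls_surj: "a \<in> carrier HF \<Longrightarrow> \<exists>x\<in>carrier F. a = hcls x"
  by (auto simp: hcls_def abelianization_def carrier_FactGroup)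

lemma hcls_closed: "x \<in> carrier F \<Longrightarrow> hcls x \<in> carrier HF"
  using hcls_hom by (auto simp: hom_def)

definition hcoord :: "nat \<Rightarrow> (nat \<times> bool) list set \<Rightarrow> int" where
  "hcoord i = (SOME c. c \<in> hom HF integer_group \<and> (\<forall>x\<in>carrier F. c (hcls x) = expn i x))"

text \<open>Exponent sums have values in an abelian group, so they kill the derived subgroup and
  descend to the abelianization.\<close>

lemma hcoord: "hcoord i \<in> hom HF integer_group" "x \<in> carrier F \<Longrightarrow> hcoord i (hcls x) = expn i x"
proof -
  have e: "expn i \<in> hom F integer_group" by (auto simp: hom_def expn_mult)
  interpret e: group_hom F integer_group "expn i"
    by (simp add: group_hom_def group_hom_axioms_def e F.is_group)
  have "derived integer_group (expn i ` carrier F) = expn i ` dF" by (rule e.derived_img) simp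
  moreover have "derived integer_group (expn i ` carrier F) \<subseteq> {0}"
    using comm_group.derived_eq_singleton[OF abelian_integer_group, of "expn i ` carrier F"] by simp
  ultimately have "dF \<subseteq> kernel F integer_group (expn i)"
    using dF.subset by (auto simp: kernel_def)
  then have "\<exists>c. c \<in> hom HF integer_group \<and> (\<forall>x\<in>carrier F. c (hcls x) = expn i x)"
    using e.FactGroup_universal_kernel[OF dF.normal_axioms] unfolding hcls_def abelianization_def by metis
  then have "hcoord i \<in> hom HF integer_group \<and> (\<forall>x\<in>carrier F. hcoord i (hcls x) = expn i x)"
    unfolding hcoord_def by (rule someI_ex)
  then show "hcoord i \<in> hom HF integer_group" "x \<in> carrier F \<Longrightarrow> hcoord i (hcls x) = expn i x" by auto
qed

definition hbas :: "nat \<Rightarrow> (nat \<times> bool) list set" where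
  "hbas i = hcls [(i, True)]"

lemma zbasis_H: "zbasis HF {..<n} hbas hcoord"
proof (rule zbasis_generatedI[OF H.comm_group_axioms])
  have "generate HF (hcls ` ((\<lambda>a. [(a, True)]) ` {..<n})) = hcls ` generate F ((\<lambda>a. [(a, True)]) ` {..<n})"
    by (rule group_hom.generate_img) (auto simp: group_hom_def group_hom_axioms_def hcls_hom F.is_group H.is_group)
  also have "\<dots> = carrier HF" using hcls_surj hcls_closed by (auto simp: free_group_generated)
  finally show "generate HF (hbas ` {..<n}) = carrier HF" by (simp add: image_image hbas_def)
qed (auto simp: hbas_def hcoord expn_letter intro!: hcls_closed)

lemma act_H_cls:
  assumes s: "\<sigma> \<in> carrier AF"
  shows "x \<in> carrier F \<Longrightarrow> act_H F \<sigma> (hcls x) = hcls ((inv\<^bsub>AF\<^esub> \<sigma>) x)" and "act_H F \<sigma> \<in> hom HF HF"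
proof -
  have t: "inv\<^bsub>AF\<^esub> \<sigma> \<in> hom F F" using right_AutD(1)[OF A.inv_closed[OF s]] .
  interpret t: group_hom F F "inv\<^bsub>AF\<^esub> \<sigma>" by (simp add: group_hom_def group_hom_axioms_def t F.is_group)
  have "(inv\<^bsub>AF\<^esub> \<sigma>) ` carrier F = carrier F"
    using A.inv_closed[OF s] by (simp add: carrier_right_Aut bij_betw_def)
  then have "(inv\<^bsub>AF\<^esub> \<sigma>) ` dF \<subseteq> dF" using t.derived_img[of "carrier F"] by simp
  note i = induced_hom[OF dF.normal_axioms dF.normal_axioms t this]
  show "x \<in> carrier F \<Longrightarrow> act_H F \<sigma> (hcls x) = hcls ((inv\<^bsub>AF\<^esub> \<sigma>) x)"
    unfolding act_H_def hcls_def by (rule i)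
  show "act_H F \<sigma> \<in> hom HF HF" unfolding act_H_def abelianization_def by (rule i)
qed

lemma act_H_closed: "\<lbrakk>\<sigma> \<in> carrier AF; a \<in> carrier HF\<rbrakk> \<Longrightarrow> act_H F \<sigma> a \<in> carrier HF"
  using act_H_cls(2) by (auto simp: hom_def)

lemma act_H_mult:
  assumes "\<sigma> \<in> carrier AF" "\<tau> \<in> carrier AF" "a \<in> carrier HF"
  shows "act_H F (\<sigma> \<otimes>\<^bsub>AF\<^esub> \<tau>) a = act_H F \<sigma> (act_H F \<tau> a)"
proof -
  obtain x where x: "x \<in> carrier F" "a = hcls x" using hcls_surj assms by blast
  then show ?thesis
    using assms by (simp add: act_H_cls A.inv_mult_group right_Aut_mult right_AutD(2)[OF A.inv_closed])
qed

lemma hcoord_act: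
  assumes s: "\<sigma> \<in> carrier AF" and a: "a \<in> carrier HF"
  shows "hcoord j (act_H F \<sigma> a) = (\<Sum>q<n. hcoord q a * imat \<sigma> q j)"
proof -
  obtain x where x: "x \<in> carrier F" "a = hcls x" using hcls_surj assms by blast
  then show ?thesis
    using s by (simp add: act_H_cls hcoord right_AutD(2)[OF A.inv_closed[OF s]] expn_aut imat_def)
qed

lemma dualD: "\<phi> \<in> carrier DF \<Longrightarrow> \<phi> \<in> hom HF integer_group"
  by (simp add: dual_group_def)

lemma act_dual_hom: assumes s: "\<sigma> \<in> carrier AF" shows "act_dual F \<sigma> \<in> hom DF DF"
proof (rule homI)
  note ih = act_H_cls(2)[OF A.inv_closed[OF s]]
  fix \<phi> assume p: "\<phi> \<in> carrier DF"
  then show "act_dual F \<sigma> \<phi> \<in> carrier DF"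
    using ih by (auto simp: dual_group_def act_dual_def hom_def)
  fix \<psi> assume "\<psi> \<in> carrier DF"
  with p show "act_dual F \<sigma> (\<phi> \<otimes>\<^bsub>DF\<^esub> \<psi>) = act_dual F \<sigma> \<phi> \<otimes>\<^bsub>DF\<^esub> act_dual F \<sigma> \<psi>"
    using act_H_closed[OF A.inv_closed[OF s]] by (auto simp: dual_group_def act_dual_def fun_eq_iff)
qed

lemma act_dual_mult:
  assumes "\<sigma> \<in> carrier AF" "\<tau> \<in> carrier AF" "\<phi> \<in> carrier DF"
  shows "act_dual F (\<sigma> \<otimes>\<^bsub>AF\<^esub> \<tau>) \<phi> = act_dual F \<sigma> (act_dual F \<tau> \<phi>)"
  using assms act_H_closed[OF A.inv_closed] by (auto simp: act_dual_def fun_eq_iff A.inv_mult_group act_H_mult)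

text \<open>The inverse in the dual action meets the inverse inside \<open>act_H\<close>, so the
  automorphism itself is applied to the generator and \<open>mat\<close> appears rather than
  \<open>imat\<close>.\<close>

lemma act_dual_coord:
  assumes s: "\<sigma> \<in> carrier AF" and p: "\<phi> \<in> carrier DF" and i: "i < n"
  shows "act_dual F \<sigma> \<phi> (hbas i) = (\<Sum>p<n. mat \<sigma> i p * \<phi> (hbas p))"
proof -
  have x: "\<sigma> [(i, True)] \<in> carrier F" using right_AutD(2)[OF s] i by simp
  have "act_dual F \<sigma> \<phi> (hbas i) = \<phi> (hcls (\<sigma> [(i, True)]))"
    using s i by (simp add: act_dual_def hbas_def hcls_closed act_H_cls)
  also have "\<dots> = (\<Sum>p<n. expn p (\<sigma> [(i, True)]) * \<phi> (hcls [(p, True)]))"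
    by (rule additive_expand[OF _ x]) (simp add: hom_mult[OF hcls_hom] hcls_closed hom_mult[OF dualD[OF p]])
  finally show ?thesis by (simp add: mat_def hbas_def)
qed

definition ecoord :: "nat \<Rightarrow> nat \<Rightarrow> ((nat \<times> bool) list set \<times> (nat \<times> bool) list set \<Rightarrow>\<^sub>0 int) set \<Rightarrow> int" where
  "ecoord j k = ext_coord HF (hcoord j) (hcoord k)"

lemma ecoord: "ecoord j k \<in> hom EF integer_group"
    "\<lbrakk>a \<in> carrier HF; b \<in> carrier HF\<rbrakk> \<Longrightarrow> ecoord j k (wedge HF a b) = hcoord j a * hcoord k b - hcoord k a * hcoord j b"
  unfolding ecoord_def by (simp_all add: ext_coord_hom[OF H.is_group] ext_coord_wedge[OF H.is_group] hcoord)

lemmas act_E_hom = ext_square_map_hom[OF H.is_group H.is_group act_H_cls(2)]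
lemmas act_E_wedge = ext_square_map_wedge[OF H.is_group H.is_group act_H_cls(2)]

lemma ecoord_act:
  assumes s: "\<sigma> \<in> carrier AF" and w: "w \<in> carrier EF"
  shows "ecoord j k (ext_square_map HF (act_H F \<sigma>) w) = (\<Sum>q<n. \<Sum>r<n. imat \<sigma> q j * imat \<sigma> r k * ecoord q r w)"
proof -
  let ?h = "\<lambda>w. ecoord j k (ext_square_map HF (act_H F \<sigma>) w)"
    and ?g = "\<lambda>w. \<Sum>q<n. \<Sum>r<n. imat \<sigma> q j * imat \<sigma> r k * ecoord q r w"
  have h: "?h \<in> hom EF integer_group"
    using hom_compose[OF act_E_hom[OF s] ecoord(1)] by (simp add: comp_def)
  have g: "?g \<in> hom EF integer_group"
    by (auto simp: hom_def hom_mult[OF ecoord(1)] algebra_simps sum.distrib)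
  show ?thesis
  proof (rule ext_square_eqI[OF H.is_group group_integer_group h g _ w])
    fix a b assume ab: "a \<in> carrier HF" "b \<in> carrier HF"
    have "?g (wedge HF a b) = (\<Sum>q<n. \<Sum>r<n. (hcoord q a * imat \<sigma> q j) * (hcoord r b * imat \<sigma> r k))
        - (\<Sum>q<n. \<Sum>r<n. (hcoord q b * imat \<sigma> q j) * (hcoord r a * imat \<sigma> r k))"
      unfolding sum_subtractf[symmetric] using ab by (intro sum.cong refl) (simp add: ecoord algebra_simps)
    also have "\<dots> = hcoord j (act_H F \<sigma> a) * hcoord k (act_H F \<sigma> b) - hcoord j (act_H F \<sigma> b) * hcoord k (act_H F \<sigma> a)"
      using ab s by (simp add: hcoord_act sum_product)
    also have "\<dots> = ?h (wedge HF a b)"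
      using ab s by (simp add: act_E_wedge ecoord act_H_closed)
    finally show "?h (wedge HF a b) = ?g (wedge HF a b)" ..
  qed
qed

definition vcoord :: "nat \<Rightarrow> nat \<Rightarrow> nat \<Rightarrow> (nat \<times> bool) list V_elem \<Rightarrow> int" where
  "vcoord i j k = tensor_coord DF EF (\<lambda>\<phi>. \<phi> (hbas i)) (ecoord j k)"

lemma V_group_eq: "VF = tensor DF EF"
  by (simp add: V_group_def)

sublocale V: comm_group VF unfolding V_group_eq by (rule comm_group_tensor[OF D.is_group E.is_group])

lemma hbas_closed: "i < n \<Longrightarrow> hbas i \<in> carrier HF"
  by (simp add: hbas_def hcls_closed)

lemma vcoord_hom: "i < n \<Longrightarrow> vcoord i j k \<in> hom VF integer_group"
  unfolding vcoord_def V_group_eq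
  by (rule tensor_coord_hom[OF D.is_group E.comm_group_axioms dual_eval_hom[OF hbas_closed] ecoord(1)])

lemma vcoord_ptensor:
  "\<lbrakk>i < n; \<phi> \<in> carrier DF; w \<in> carrier EF\<rbrakk> \<Longrightarrow> vcoord i j k (ptensor DF EF \<phi> w) = \<phi> (hbas i) * ecoord j k w"
  unfolding vcoord_def
  by (rule tensor_coord_ptensor[OF D.is_group E.comm_group_axioms dual_eval_hom[OF hbas_closed] ecoord(1)])

definition vbas :: "nat \<times> nat \<times> nat \<Rightarrow> (nat \<times> bool) list V_elem" where
  "vbas = (\<lambda>(i, j, k). ptensor DF EF (restrict (hcoord i) (carrier HF)) (wedge HF (hbas j) (hbas k)))"

definition vindex :: "(nat \<times> nat \<times> nat) set" where
  "vindex = {(i, j, k). i < n \<and> j < k \<and> k < n}"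

lemma zbasis_V: "zbasis VF vindex vbas (\<lambda>(i, j, k). vcoord i j k)"
proof -
  have e: "zbasis EF {(i, j) \<in> {..<n} \<times> {..<n}. i < j} (\<lambda>(i, j). wedge HF (hbas i) (hbas j)) (\<lambda>(i, j). ecoord i j)"
    using zbasis_ext_square[OF zbasis_H] by (simp add: ecoord_def)
  have i: "vindex = {..<n} \<times> {(i, j) \<in> {..<n} \<times> {..<n}. i < j}" by (auto simp: vindex_def)
  have b: "vbas = (\<lambda>(i, j). ptensor DF EF (restrict (hcoord i) (carrier HF)) ((\<lambda>(i, j). wedge HF (hbas i) (hbas j)) j))"
    by (auto simp: vbas_def fun_eq_iff)
  have c: "(\<lambda>(i, j, k). vcoord i j k) = (\<lambda>(i, j). tensor_coord DF EF (\<lambda>\<phi>. \<phi> (hbas i)) ((\<lambda>(i, j). ecoord i j) j))"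
    by (auto simp: vcoord_def fun_eq_iff)
  show ?thesis
    unfolding V_group_eq i b c by (rule zbasis_tensor[OF zbasis_dual[OF zbasis_H] e])
qed

lemma ecoord_swap: "w \<in> carrier EF \<Longrightarrow> ecoord k j w = - ecoord j k w"
proof (rule ext_square_eqI[OF H.is_group group_integer_group ecoord(1)])
  show "(\<lambda>w. - ecoord j k w) \<in> hom EF integer_group" using ecoord(1)[of j k] by (auto simp: hom_def)
qed (auto simp: ecoord)

lemma vcoord_swap: "i < n \<Longrightarrow> v \<in> carrier VF \<Longrightarrow> vcoord i k j v = - vcoord i j k v"
  unfolding V_group_eq
proof (rule tensor_eqI[OF D.is_group E.is_group group_integer_group])
  assume "i < n"
  then show "vcoord i k j \<in> hom (tensor DF EF) integer_group" "(\<lambda>v. - vcoord i j k v) \<in> hom (tensor DF EF) integer_group"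
    using vcoord_hom[of i k j] vcoord_hom[of i j k] by (auto simp: hom_def V_group_eq)
next
  fix a b assume "i < n" "a \<in> carrier DF" "b \<in> carrier EF"
  then show "vcoord i k j (ptensor DF EF a b) = - vcoord i j k (ptensor DF EF a b)"
    using ecoord_swap[of b k j] by (simp add: vcoord_ptensor)
qed

lemma act_V_eq: "act_V F \<sigma> = tensor_map DF EF (act_dual F \<sigma>) (ext_square_map HF (act_H F \<sigma>))"
  by (simp add: act_V_def)

lemma act_V_hom: "\<sigma> \<in> carrier AF \<Longrightarrow> act_V F \<sigma> \<in> hom VF VF"
  unfolding act_V_eq V_group_eq
  by (rule tensor_map_hom[OF D.is_group D.is_group E.is_group E.is_group act_dual_hom act_E_hom])

lemma act_V_closed: "\<lbrakk>\<sigma> \<in> carrier AF; v \<in> carrier VF\<rbrakk> \<Longrightarrow> act_V F \<sigma> v \<in> carrier VF"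
  using act_V_hom by (auto simp: hom_def)

lemma act_V_ptensor: "\<lbrakk>\<sigma> \<in> carrier AF; \<phi> \<in> carrier DF; w \<in> carrier EF\<rbrakk> \<Longrightarrow>
    act_V F \<sigma> (ptensor DF EF \<phi> w) = ptensor DF EF (act_dual F \<sigma> \<phi>) (ext_square_map HF (act_H F \<sigma>) w)"
  unfolding act_V_eq
  by (rule tensor_map_ptensor[OF D.is_group D.is_group E.is_group E.is_group act_dual_hom act_E_hom])

text \<open>Both sides are homomorphisms in \<open>v\<close>, so pure tensors suffice. Since the
  coordinates are antisymmetric in the last two indices, the sum may run over all pairs
  \<open>q\<close>, \<open>r\<close> with no case distinction on their order.\<close>

lemma vcoord_act:
  assumes s: "\<sigma> \<in> carrier AF" and i: "i < n" and v: "v \<in> carrier VF"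
  shows "vcoord i j k (act_V F \<sigma> v)
    = (\<Sum>p<n. \<Sum>q<n. \<Sum>r<n. mat \<sigma> i p * (imat \<sigma> q j * imat \<sigma> r k) * vcoord p q r v)"
proof -
  let ?g = "\<lambda>v. \<Sum>p<n. \<Sum>q<n. \<Sum>r<n. mat \<sigma> i p * (imat \<sigma> q j * imat \<sigma> r k) * vcoord p q r v"
  have h: "(\<lambda>v. vcoord i j k (act_V F \<sigma> v)) \<in> hom (tensor DF EF) integer_group"
    using hom_compose[OF act_V_hom[OF s] vcoord_hom[OF i]] by (simp add: comp_def V_group_eq)
  have g: "?g \<in> hom (tensor DF EF) integer_group"
    unfolding V_group_eq[symmetric]
    by (auto simp: hom_def hom_mult[OF vcoord_hom] distrib_left sum.distrib)
  show ?thesis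
  proof (rule tensor_eqI[OF D.is_group E.is_group group_integer_group h g])
    show "v \<in> carrier (tensor DF EF)" using v by (simp add: V_group_eq)
    fix \<phi> w assume p: "\<phi> \<in> carrier DF" and w: "w \<in> carrier EF"
    have "act_dual F \<sigma> \<phi> \<in> carrier DF" "ext_square_map HF (act_H F \<sigma>) w \<in> carrier EF"
      using act_dual_hom[OF s] act_E_hom[OF s] p w by (auto simp: hom_def)
    then have "vcoord i j k (act_V F \<sigma> (ptensor DF EF \<phi> w))
        = (\<Sum>p<n. mat \<sigma> i p * \<phi> (hbas p)) * (\<Sum>q<n. \<Sum>r<n. imat \<sigma> q j * imat \<sigma> r k * ecoord q r w)"
      using s i p w by (simp add: act_V_ptensor vcoord_ptensor act_dual_coord ecoord_act)
    also have "\<dots> = ?g (ptensor DF EF \<phi> w)"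
      unfolding sum_distrib_right unfolding sum_distrib_left
      using p w by (intro sum.cong refl) (simp add: vcoord_ptensor)
    finally show "vcoord i j k (act_V F \<sigma> (ptensor DF EF \<phi> w)) = ?g (ptensor DF EF \<phi> w)" .
  qed
qed

lemma act_V_mult:
  assumes s: "\<sigma> \<in> carrier AF" and t: "\<tau> \<in> carrier AF" and v: "v \<in> carrier VF"
  shows "act_V F (\<sigma> \<otimes>\<^bsub>AF\<^esub> \<tau>) v = act_V F \<sigma> (act_V F \<tau> v)"
proof -
  have c: "(\<lambda>v. act_V F \<sigma> (act_V F \<tau> v)) \<in> hom (tensor DF EF) VF"
    using hom_compose[OF act_V_hom[OF t] act_V_hom[OF s]] by (simp add: comp_def V_group_eq)
  have st: "\<sigma> \<otimes>\<^bsub>AF\<^esub> \<tau> \<in> carrier AF" using s t by simp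
  have a: "act_V F (\<sigma> \<otimes>\<^bsub>AF\<^esub> \<tau>) \<in> hom (tensor DF EF) VF" using act_V_hom[OF st] by (simp only: V_group_eq)
  show ?thesis
  proof (rule tensor_eqI[OF D.is_group E.is_group V.is_group a c])
    show "v \<in> carrier (tensor DF EF)" using v by (simp add: V_group_eq)
    fix \<phi> w assume p: "\<phi> \<in> carrier DF" and w: "w \<in> carrier EF"
    have e: "ext_square_map HF (act_H F (\<sigma> \<otimes>\<^bsub>AF\<^esub> \<tau>)) w = ext_square_map HF (act_H F \<sigma>) (ext_square_map HF (act_H F \<tau>) w)"
    proof (rule ext_square_eqI[OF H.is_group E.is_group act_E_hom[OF st] _ _ w])
      show "(\<lambda>w. ext_square_map HF (act_H F \<sigma>) (ext_square_map HF (act_H F \<tau>) w)) \<in> hom EF EF"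
        using hom_compose[OF act_E_hom[OF t] act_E_hom[OF s]] by (simp add: comp_def)
    qed (use s t st in \<open>simp add: act_E_wedge act_H_closed act_H_mult\<close>)
    have "act_dual F \<tau> \<phi> \<in> carrier DF" "ext_square_map HF (act_H F \<tau>) w \<in> carrier EF"
      using act_dual_hom[OF t] act_E_hom[OF t] p w by (auto simp: hom_def)
    then show "act_V F (\<sigma> \<otimes>\<^bsub>AF\<^esub> \<tau>) (ptensor DF EF \<phi> w) = act_V F \<sigma> (act_V F \<tau> (ptensor DF EF \<phi> w))"
      using s t st p w by (simp add: act_V_ptensor act_dual_mult e)
  qed
qed

end

text \<open>Signed permutation matrices and the transvection have only one or two nonzero entries in
  each row and column that matters; this lemma and \<open>sum_row2\<close> collapse the nested sums
  slot by slot.\<close>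

lemma sum_row1:
  assumes "(i::nat) < n" "\<And>p. p < n \<Longrightarrow> a p = (if p = i then x else 0 :: int)"
  shows "(\<Sum>p<n. a p * g p) = x * g i"
proof -
  have "(\<Sum>p<n. a p * g p) = (\<Sum>p<n. if p = i then x * g p else 0)"
    by (intro sum.cong) (auto simp: assms)
  then show ?thesis using assms(1) by (simp add: sum.delta)
qed

lemma sum_row2:
  assumes "(i::nat) < n" "j < n" "i \<noteq> j" "\<And>p. p < n \<Longrightarrow> a p = (if p = i then x else if p = j then y else 0 :: int)"
  shows "(\<Sum>p<n. a p * g p) = x * g i + y * g j"
proof -
  have "(\<Sum>p<n. a p * g p) = (\<Sum>p<n. (if p = i then x * g p else 0) + (if p = j then y * g p else 0))"
    by (intro sum.cong) (use assms in auto)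
  then show ?thesis using assms(1,2) by (simp add: sum.distrib sum.delta)
qed

lemma (in free_rank) vcoord_act_nested:
  assumes "\<sigma> \<in> carrier AF" "i < n" "v \<in> carrier VF"
  shows "vcoord i j k (act_V F \<sigma> v)
    = (\<Sum>p<n. mat \<sigma> i p * (\<Sum>q<n. imat \<sigma> q j * (\<Sum>r<n. imat \<sigma> r k * vcoord p q r v)))"
  unfolding vcoord_act[OF assms] sum_distrib_left by (simp add: mult.assoc)

locale out_coeff = free_rank n + L: cring L for n :: nat and L :: "('l, 'd) ring_scheme" +
  assumes n5: "5 \<le> n"
    and no_two_torsion: "\<And>a. \<lbrakk>a \<in> carrier L; a \<oplus>\<^bsub>L\<^esub> a = \<zero>\<^bsub>L\<^esub>\<rbrakk> \<Longrightarrow> a = \<zero>\<^bsub>L\<^esub>"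
begin

abbreviation (input) "LA \<equiv> add_monoid L"
abbreviation (input) "TL \<equiv> tensor VF (add_monoid L)"
abbreviation (input) "WL \<equiv> V_mod F L"
abbreviation zmul :: "int \<Rightarrow> 'l \<Rightarrow> 'l" where "zmul k a \<equiv> a [^]\<^bsub>add_monoid L\<^esub> k"

lemma LA_comm: "comm_group LA"
  by (rule L.a_comm_group)

lemma LA_group: "group LA"
  by (rule L.a_group)

lemmas zmul_closed = group.int_pow_closed[OF LA_group]
lemmas zmul_add = group.int_pow_mult[OF LA_group]
lemmas zmul_zmul = group.int_pow_pow[OF LA_group]
lemmas zmul_distrib = comm_group.int_pow_distrib[OF LA_comm]

lemma zmul_one: "a \<in> carrier L \<Longrightarrow> zmul 1 a = a"
  using group.int_pow_1[OF LA_group, of a] by simp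

lemma zmul_minus_one: "a \<in> carrier L \<Longrightarrow> zmul (- 1) a = \<ominus>\<^bsub>L\<^esub> a"
  using group.int_pow_neg[OF LA_group, of a 1] zmul_one[of a] by (simp add: a_inv_def)

sublocale TL: comm_group TL by (rule comm_group_tensor[OF V.is_group LA_group])

lemma WL_simps: "carrier WL = carrier TL" "x \<oplus>\<^bsub>WL\<^esub> y = x \<otimes>\<^bsub>TL\<^esub> y" "\<zero>\<^bsub>WL\<^esub> = \<one>\<^bsub>TL\<^esub>"
  by (simp_all add: V_mod_def Let_def)

lemma abelian_group_WL: "abelian_group WL"
proof (rule abelian_groupI)
  show "x \<oplus>\<^bsub>WL\<^esub> y = y \<oplus>\<^bsub>WL\<^esub> x" if "x \<in> carrier WL" "y \<in> carrier WL" for x y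
    using that by (simp add: WL_simps TL.m_comm)
  show "\<exists>y\<in>carrier WL. y \<oplus>\<^bsub>WL\<^esub> x = \<zero>\<^bsub>WL\<^esub>" if "x \<in> carrier WL" for x
    using that TL.l_inv TL.inv_closed by (auto simp: WL_simps)
qed (auto simp: WL_simps TL.m_assoc)

lemma a_inv_WL: "x \<in> carrier TL \<Longrightarrow> \<ominus>\<^bsub>WL\<^esub> x = inv\<^bsub>TL\<^esub> x"
proof -
  interpret M: abelian_group WL by (rule abelian_group_WL)
  assume "x \<in> carrier TL"
  then show ?thesis using M.minus_equality[of "inv\<^bsub>TL\<^esub> x" x] by (simp add: WL_simps)
qed

text \<open>V is free, so an element of V_L is determined by these values in \<open>L\<close>. The
  group \<open>TL\<close> is written multiplicatively, but its product is the addition of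
  V_L.\<close>

definition tcoord :: "nat \<Rightarrow> nat \<Rightarrow> nat \<Rightarrow> ((nat \<times> bool) list, 'l) VL_elem \<Rightarrow> 'l" where
  "tcoord i j k = tensor_eval VF LA (vcoord i j k)"

lemma tcoord_hom: "i < n \<Longrightarrow> tcoord i j k \<in> hom TL LA"
  unfolding tcoord_def by (rule tensor_eval_hom[OF V.is_group LA_comm vcoord_hom])

lemma tcoord_closed: "\<lbrakk>i < n; t \<in> carrier TL\<rbrakk> \<Longrightarrow> tcoord i j k t \<in> carrier L"
  using tcoord_hom[of i j k] by (auto simp: hom_def)

lemma tcoord_mult: "\<lbrakk>i < n; t \<in> carrier TL; u \<in> carrier TL\<rbrakk> \<Longrightarrow>
    tcoord i j k (t \<otimes>\<^bsub>TL\<^esub> u) = tcoord i j k t \<oplus>\<^bsub>L\<^esub> tcoord i j k u"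
  using hom_mult[OF tcoord_hom[of i j k]] by simp

lemma tcoord_one: "i < n \<Longrightarrow> tcoord i j k \<one>\<^bsub>TL\<^esub> = \<zero>\<^bsub>L\<^esub>"
  using hom_one[OF tcoord_hom[of i j k] TL.is_group LA_group] by simp

lemma tcoord_inv: "\<lbrakk>i < n; t \<in> carrier TL\<rbrakk> \<Longrightarrow> tcoord i j k (inv\<^bsub>TL\<^esub> t) = \<ominus>\<^bsub>L\<^esub> tcoord i j k t"
  using tcoord_mult[of i "inv\<^bsub>TL\<^esub> t" t j k] tcoord_one[of i j k] tcoord_closed[of i t j k]
    tcoord_closed[of i "inv\<^bsub>TL\<^esub> t" j k] L.minus_equality[of "tcoord i j k (inv\<^bsub>TL\<^esub> t)" "tcoord i j k t"] by simp

lemma ptensor_TL_closed: "\<lbrakk>v \<in> carrier VF; l \<in> carrier L\<rbrakk> \<Longrightarrow> ptensor VF LA v l \<in> carrier TL"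
  using ptensor_closed[OF V.is_group LA_comm] by simp

lemma tcoord_ptensor: "\<lbrakk>i < n; v \<in> carrier VF; l \<in> carrier L\<rbrakk> \<Longrightarrow>
    tcoord i j k (ptensor VF LA v l) = zmul (vcoord i j k v) l"
  unfolding tcoord_def using tensor_eval_ptensor[OF V.is_group LA_comm vcoord_hom] by simp

lemma TL_eqI:
  assumes "t \<in> carrier TL" "u \<in> carrier TL"
    and "\<And>i j k. \<lbrakk>i < n; j < k; k < n\<rbrakk> \<Longrightarrow> tcoord i j k t = tcoord i j k u"
  shows "t = u"
  by (rule tensor_coords_eqI[OF V.is_group LA_comm zbasis_V])
    (use assms in \<open>auto simp: vindex_def tcoord_def\<close>)

lemma TL_exists:
  assumes "\<And>i j k. \<lbrakk>i < n; j < k; k < n\<rbrakk> \<Longrightarrow> y i j k \<in> carrier L"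
  obtains t where "t \<in> carrier TL" "\<And>i j k. \<lbrakk>i < n; j < k; k < n\<rbrakk> \<Longrightarrow> tcoord i j k t = y i j k"
proof (rule tensor_coords_exist[OF V.is_group LA_comm zbasis_V, of "\<lambda>(i, j, k). y i j k"])
  show "(\<lambda>(i, j, k). y i j k) \<in> vindex \<rightarrow> carrier LA" using assms by (auto simp: vindex_def)
  fix t assume t: "t \<in> carrier TL"
    "\<And>i. i \<in> vindex \<Longrightarrow> tensor_eval VF LA ((\<lambda>(i, j, k). vcoord i j k) i) t = (\<lambda>(i, j, k). y i j k) i"
  show thesis by (rule that[OF t(1)]) (use t(2)[of "(_, _, _)"] in \<open>auto simp: vindex_def tcoord_def\<close>)
qed

lemma V_exists:
  obtains v where "v \<in> carrier VF" "\<And>i j k. \<lbrakk>i < n; j < k; k < n\<rbrakk> \<Longrightarrow> vcoord i j k v = y i j k"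
proof
  note b = zbasisD[OF zbasis_V]
  let ?v = "finprod VF (\<lambda>i. vbas i [^]\<^bsub>VF\<^esub> (\<lambda>(i, j, k). y i j k) i) vindex"
  show "?v \<in> carrier VF" using b(3) by (intro V.finprod_closed) auto
  show "vcoord i j k ?v = y i j k" if "i < n" "j < k" "k < n" for i j k
    using zbasis_coord_combination[OF zbasis_V, of "(i, j, k)" "\<lambda>(i, j, k). y i j k"] that by (simp add: vindex_def)
qed

lemma V_eqI:
  assumes "v \<in> carrier VF" "v' \<in> carrier VF"
    and "\<And>i j k. \<lbrakk>i < n; j < k; k < n\<rbrakk> \<Longrightarrow> vcoord i j k v = vcoord i j k v'"
  shows "v = v'"
  by (rule zbasis_eqI[OF zbasis_V]) (use assms in \<open>auto simp: vindex_def\<close>)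

text \<open>An identity between integral coordinates on V passes to V_L because both sides are
  homomorphisms in \<open>t\<close> and can be compared on pure tensors. Two terms are enough for
  the transvection, and \<open>h\<close> is left abstract so that the identity map yields
  \<open>tcoord_swap\<close>.\<close>

lemma tcoord_relation:
  assumes a: "a \<in> hom VF VF" and h: "h \<in> hom TL TL"
    and ha: "\<And>v l. \<lbrakk>v \<in> carrier VF; l \<in> carrier L\<rbrakk> \<Longrightarrow> h (ptensor VF LA v l) = ptensor VF LA (a v) l"
    and i: "i < n" "p < n" "p' < n"
    and rel: "\<And>v. v \<in> carrier VF \<Longrightarrow> vcoord i j k (a v) = x * vcoord p q r v + y * vcoord p' q' r' v"
    and t: "t \<in> carrier TL"
  shows "tcoord i j k (h t) = zmul x (tcoord p q r t) \<oplus>\<^bsub>L\<^esub> zmul y (tcoord p' q' r' t)"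
proof -
  have 1: "(\<lambda>t. tcoord i j k (h t)) \<in> hom TL LA"
    using hom_compose[OF h tcoord_hom[OF i(1)]] by (simp add: comp_def)
  have 2: "(\<lambda>t. zmul x (tcoord p q r t) \<oplus>\<^bsub>L\<^esub> zmul y (tcoord p' q' r' t)) \<in> hom TL LA"
  proof (rule homI)
    fix t u assume "t \<in> carrier TL" "u \<in> carrier TL"
    moreover from this have "tcoord p q r t \<in> carrier L" "tcoord p q r u \<in> carrier L"
      "tcoord p' q' r' t \<in> carrier L" "tcoord p' q' r' u \<in> carrier L" using tcoord_closed i by auto
    ultimately show "zmul x (tcoord p q r (t \<otimes>\<^bsub>TL\<^esub> u)) \<oplus>\<^bsub>L\<^esub> zmul y (tcoord p' q' r' (t \<otimes>\<^bsub>TL\<^esub> u)) =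
       (zmul x (tcoord p q r t) \<oplus>\<^bsub>L\<^esub> zmul y (tcoord p' q' r' t)) \<otimes>\<^bsub>LA\<^esub>
       (zmul x (tcoord p q r u) \<oplus>\<^bsub>L\<^esub> zmul y (tcoord p' q' r' u))"
      using i zmul_distrib[of "tcoord p q r t" "tcoord p q r u" x]
        zmul_distrib[of "tcoord p' q' r' t" "tcoord p' q' r' u" y]
        zmul_closed[of "tcoord p q r t" x] zmul_closed[of "tcoord p q r u" x]
        zmul_closed[of "tcoord p' q' r' t" y] zmul_closed[of "tcoord p' q' r' u" y]
      by (simp add: tcoord_mult L.a_ac)
  next
    fix t assume "t \<in> carrier TL"
    then show "zmul x (tcoord p q r t) \<oplus>\<^bsub>L\<^esub> zmul y (tcoord p' q' r' t) \<in> carrier LA"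
      using i tcoord_closed zmul_closed[of "tcoord p q r t" x] zmul_closed[of "tcoord p' q' r' t" y] by simp
  qed
  show ?thesis
  proof (rule tensor_eqI[OF V.is_group LA_group LA_group 1 2 _ t])
    fix v l assume v: "v \<in> carrier VF" and l: "l \<in> carrier LA"
    have av: "a v \<in> carrier VF" using a v by (auto simp: hom_def)
    show "tcoord i j k (h (ptensor VF LA v l)) = zmul x (tcoord p q r (ptensor VF LA v l)) \<oplus>\<^bsub>L\<^esub> zmul y (tcoord p' q' r' (ptensor VF LA v l))"
      using v l i av zmul_add[of l "vcoord p q r v * x" "vcoord p' q' r' v * y"]
      by (simp add: ha tcoord_ptensor rel zmul_zmul mult.commute)
  qed
qed

lemma act_VL:
  assumes s: "\<sigma> \<in> carrier AF"
  shows act_VL_hom: "act_VL F L \<sigma> \<in> hom TL TL"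
    and act_VL_ptensor: "\<lbrakk>v \<in> carrier VF; l \<in> carrier L\<rbrakk> \<Longrightarrow>
       act_VL F L \<sigma> (ptensor VF LA v l) = ptensor VF LA (act_V F \<sigma> v) l"
  unfolding act_VL_def
  using tensor_map[OF V.is_group V.is_group LA_group LA_group act_V_hom[OF s], of "\<lambda>a. a"]
  by (auto simp: hom_def)

lemma act_VL_closed: "\<lbrakk>\<sigma> \<in> carrier AF; t \<in> carrier TL\<rbrakk> \<Longrightarrow> act_VL F L \<sigma> t \<in> carrier TL"
  using act_VL_hom by (auto simp: hom_def)

lemma tcoord_act2:
  assumes s: "\<sigma> \<in> carrier AF" and "t \<in> carrier TL" "i < n" "p < n" "p' < n"
    and "\<And>v. v \<in> carrier VF \<Longrightarrow> vcoord i j k (act_V F \<sigma> v) = x * vcoord p q r v + y * vcoord p' q' r' v"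
  shows "tcoord i j k (act_VL F L \<sigma> t) = zmul x (tcoord p q r t) \<oplus>\<^bsub>L\<^esub> zmul y (tcoord p' q' r' t)"
  by (rule tcoord_relation[OF act_V_hom[OF s] act_VL_hom[OF s] act_VL_ptensor[OF s]]) (use assms in auto)

lemma tcoord_act1:
  assumes s: "\<sigma> \<in> carrier AF" and t: "t \<in> carrier TL" and i: "i < n" "p < n"
    and r: "\<And>v. v \<in> carrier VF \<Longrightarrow> vcoord i j k (act_V F \<sigma> v) = x * vcoord p q r v"
  shows "tcoord i j k (act_VL F L \<sigma> t) = zmul x (tcoord p q r t)"
  using tcoord_act2[OF s t i(1) i(2) i(2), of j k x q r 0 q r] r
    zmul_closed[of "tcoord p q r t" x]
    tcoord_closed[OF i(2) t, of q r] by simp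

lemma tcoord_swap:
  assumes "i < n" "t \<in> carrier TL"
  shows "tcoord i k j t = \<ominus>\<^bsub>L\<^esub> tcoord i j k t"
proof -
  have "tcoord i k j t = zmul (- 1) (tcoord i j k t) \<oplus>\<^bsub>L\<^esub> zmul 0 (tcoord i j k t)"
    by (rule tcoord_relation[of "\<lambda>v. v" "\<lambda>t. t"]) (use assms vcoord_swap[where i=i and j=j and k=k] in \<open>auto simp: hom_def\<close>)
  then show ?thesis using assms tcoord_closed[of i t j k] by (simp add: zmul_minus_one)
qed

lemma act_VL_mult:
  assumes s: "\<sigma> \<in> carrier AF" "\<tau> \<in> carrier AF" and t: "t \<in> carrier TL"
  shows "act_VL F L (\<sigma> \<otimes>\<^bsub>AF\<^esub> \<tau>) t = act_VL F L \<sigma> (act_VL F L \<tau> t)"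
proof (rule tensor_eqI[OF V.is_group LA_group TL.is_group act_VL_hom _ _ t])
  show "\<sigma> \<otimes>\<^bsub>AF\<^esub> \<tau> \<in> carrier AF" using s by simp
  show "(\<lambda>t. act_VL F L \<sigma> (act_VL F L \<tau> t)) \<in> hom TL TL"
    using hom_compose[OF act_VL_hom[OF s(2)] act_VL_hom[OF s(1)]] by (simp add: comp_def)
qed (use s in \<open>auto simp: act_VL_ptensor act_V_mult act_V_closed\<close>)

text \<open>The action depends only on the matrix of the automorphism. Besides inner automorphisms
  this covers the partial conjugations, which is why they drop out of crossed relations.\<close>

lemma act_VL_trivial:
  assumes s: "\<sigma> \<in> carrier AF" and m: "\<And>i j. i < n \<Longrightarrow> j < n \<Longrightarrow> mat \<sigma> i j = (if i = j then 1 else 0)"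
    and t: "t \<in> carrier TL"
  shows "act_VL F L \<sigma> t = t"
proof -
  have im: "imat \<sigma> i k = (if i = k then 1 else 0)" if "i < n" "k < n" for i k
  proof -
    have "(\<Sum>j<n. mat \<sigma> i j * imat \<sigma> j k) = (\<Sum>j<n. if i = j then imat \<sigma> j k else 0)"
      using that by (intro sum.cong) (auto simp: m)
    also have "\<dots> = imat \<sigma> i k" using that by (simp add: sum.delta)
    finally show ?thesis using mat_imat(1)[OF s that(1), of k] by simp
  qed
  have "vcoord i j k (act_V F \<sigma> v) = vcoord i j k v" if "i < n" "j < k" "k < n" "v \<in> carrier VF" for i j k v
  proof -
    have "j < n" using that by simp
    moreover have "(\<Sum>p<n. mat \<sigma> i p * g p) = 1 * g i" "(\<Sum>q<n. imat \<sigma> q j * g q) = 1 * g j"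
      "(\<Sum>r<n. imat \<sigma> r k * g r) = 1 * g k" for g
      by (rule sum_row1; use that in \<open>auto simp: m im\<close>)+
    ultimately show ?thesis using that by (simp add: vcoord_act_nested[OF s])
  qed
  then have "act_V F \<sigma> v = v" if "v \<in> carrier VF" for v
    using that s by (intro V_eqI) (auto simp: act_V_closed)
  then show ?thesis
    by (intro tensor_eqI[OF V.is_group LA_group TL.is_group act_VL_hom[OF s] _ _ t])
      (auto simp: act_VL_ptensor[OF s] hom_def)
qed

lemma act_VL_conj: "\<lbrakk>g \<in> carrier F; t \<in> carrier TL\<rbrakk> \<Longrightarrow> act_VL F L (conj_aut F g) t = t"
  by (rule act_VL_trivial[OF conj_aut_carrier[OF F.is_group]])
    (auto simp: mat_def conj_aut_def expn_mult expn_inv expn_letter)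

lemma smult_WL: "r \<in> carrier L \<Longrightarrow> (\<lambda>t. r \<odot>\<^bsub>WL\<^esub> t) \<in> hom TL TL"
    "\<lbrakk>r \<in> carrier L; v \<in> carrier VF; l \<in> carrier L\<rbrakk> \<Longrightarrow> r \<odot>\<^bsub>WL\<^esub> ptensor VF LA v l = ptensor VF LA v (r \<otimes>\<^bsub>L\<^esub> l)"
proof -
  have 1: "r \<odot>\<^bsub>WL\<^esub> t = tensor_map VF LA (\<lambda>v. v) (\<lambda>a. r \<otimes>\<^bsub>L\<^esub> a) t" for r t by (simp add: V_mod_def Let_def)
  assume r: "r \<in> carrier L"
  have i: "(\<lambda>v. v) \<in> hom VF VF" by (simp add: hom_def)
  have m: "(\<lambda>a. r \<otimes>\<^bsub>L\<^esub> a) \<in> hom LA LA" using r by (auto simp: hom_def L.r_distr)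
  note tm = tensor_map[OF V.is_group V.is_group LA_group LA_group i m]
  show "(\<lambda>t. r \<odot>\<^bsub>WL\<^esub> t) \<in> hom TL TL" unfolding 1 by (rule tm)
  show "\<lbrakk>v \<in> carrier VF; l \<in> carrier L\<rbrakk> \<Longrightarrow> r \<odot>\<^bsub>WL\<^esub> ptensor VF LA v l = ptensor VF LA v (r \<otimes>\<^bsub>L\<^esub> l)"
    unfolding 1 using tm(2) by simp
qed

lemma smult_WL_closed: "\<lbrakk>r \<in> carrier L; t \<in> carrier TL\<rbrakk> \<Longrightarrow> r \<odot>\<^bsub>WL\<^esub> t \<in> carrier TL"
  using smult_WL(1)[of r] by (auto simp: hom_def)

lemma smult_act:
  assumes s: "\<sigma> \<in> carrier AF" and r: "r \<in> carrier L" and t: "t \<in> carrier TL"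
  shows "act_VL F L \<sigma> (r \<odot>\<^bsub>WL\<^esub> t) = r \<odot>\<^bsub>WL\<^esub> act_VL F L \<sigma> t"
proof (rule tensor_eqI[OF V.is_group LA_group TL.is_group _ _ _ t])
  show "(\<lambda>t. act_VL F L \<sigma> (r \<odot>\<^bsub>WL\<^esub> t)) \<in> hom TL TL"
    using hom_compose[OF smult_WL(1)[OF r] act_VL_hom[OF s]] by (simp add: comp_def)
  show "(\<lambda>t. r \<odot>\<^bsub>WL\<^esub> act_VL F L \<sigma> t) \<in> hom TL TL"
    using hom_compose[OF act_VL_hom[OF s] smult_WL(1)[OF r]] by (simp add: comp_def)
qed (use r s in \<open>auto simp: smult_WL act_VL_ptensor act_V_closed\<close>)

lemma tcoord_smult:
  assumes r: "r \<in> carrier L" and i: "i < n" and t: "t \<in> carrier TL"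
  shows "tcoord i j k (r \<odot>\<^bsub>WL\<^esub> t) = r \<otimes>\<^bsub>L\<^esub> tcoord i j k t"
proof (rule tensor_eqI[OF V.is_group LA_group LA_group _ _ _ t])
  show "(\<lambda>t. tcoord i j k (r \<odot>\<^bsub>WL\<^esub> t)) \<in> hom TL LA"
    using hom_compose[OF smult_WL(1)[OF r] tcoord_hom[OF i]] by (simp add: comp_def)
  have m: "(\<lambda>a. r \<otimes>\<^bsub>L\<^esub> a) \<in> hom LA LA" using r by (auto simp: hom_def L.r_distr)
  then show "(\<lambda>t. r \<otimes>\<^bsub>L\<^esub> tcoord i j k t) \<in> hom TL LA"
    using hom_compose[OF tcoord_hom[OF i] m] by (simp add: comp_def)
  fix v l assume "v \<in> carrier VF" "l \<in> carrier LA"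
  then show "tcoord i j k (r \<odot>\<^bsub>WL\<^esub> ptensor VF LA v l) = r \<otimes>\<^bsub>L\<^esub> tcoord i j k (ptensor VF LA v l)"
    using r i hom_int_pow[OF m _ LA_group LA_group, of l "vcoord i j k v"]
    by (simp add: smult_WL tcoord_ptensor)
qed

end

section \<open>Special automorphisms and relations between them\<close>

declare One_nat_def [simp del]

context free_rank
begin

text \<open>Acts as -1 on H and on its dual, hence as (-1)^3 on V.\<close>

definition iota :: "(nat \<times> bool) list \<Rightarrow> (nat \<times> bool) list" where
  "iota = signed_perm n (\<lambda>i. i) (\<lambda>_. False)"

definition sgn_aut :: "nat \<Rightarrow> (nat \<times> bool) list \<Rightarrow> (nat \<times> bool) list" where
  "sgn_aut p = signed_perm n (\<lambda>i. i) (\<lambda>i. i \<noteq> p)"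

definition perm_aut :: "(nat \<Rightarrow> nat) \<Rightarrow> (nat \<times> bool) list \<Rightarrow> (nat \<times> bool) list" where
  "perm_aut \<pi> = signed_perm n \<pi> (\<lambda>_. True)"

text \<open>Partial conjugation by x_1, trivial on the abelianization when 1 is not in
  \<open>S\<close>. The automorphism K of the overview is \<open>pconj {0}\<close>; all indices
  except 1 together give an inner automorphism.\<close>

definition pconj :: "nat set \<Rightarrow> (nat \<times> bool) list \<Rightarrow> (nat \<times> bool) list" where
  "pconj S = free_aut {..<n} (\<lambda>i. if i \<in> S then [(1, False)] \<otimes>\<^bsub>F\<^esub> [(i, True)] \<otimes>\<^bsub>F\<^esub> [(1, True)] else [(i, True)])"

lemma id_bij: "bij_betw (\<lambda>i. i) {..<n} {..<n}"
  by (simp add: bij_betw_def)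

lemma transpose_bij: "\<lbrakk>p < n; q < n\<rbrakk> \<Longrightarrow> bij_betw (transpose p q) {..<n} {..<n}"
  by (intro permutes_imp_bij permutes_swap_id) auto

lemma one_less: "1 < n" "0 < n"
  using n2 by auto

lemma letter1_inv: "inv\<^bsub>F\<^esub> [(1, True)] = [(1, False)]" "inv\<^bsub>F\<^esub> [(1, False)] = [(1, True)]"
  using one_less by (simp_all add: inv_letter)

lemma special_carrier [simp]:
  "iota \<in> carrier AF" "sgn_aut p \<in> carrier AF" "bij_betw \<pi> {..<n} {..<n} \<Longrightarrow> perm_aut \<pi> \<in> carrier AF"
  by (simp_all add: iota_def sgn_aut_def perm_aut_def signed_perm_carrier id_bij)

lemma pconj_gens: "(\<lambda>i. if i \<in> S then [(1, False)] \<otimes>\<^bsub>F\<^esub> [(i, True)] \<otimes>\<^bsub>F\<^esub> [(1, True)] else [(i, True)]) \<in> {..<n} \<rightarrow> carrier F"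
  using one_less by auto

lemma pconj_letter:
  "\<lbrakk>i < n; i \<notin> S\<rbrakk> \<Longrightarrow> pconj S [(i, s)] = [(i, s)]"
  "\<lbrakk>i < n; i \<in> S\<rbrakk> \<Longrightarrow> pconj S [(i, s)] = [(1, False)] \<otimes>\<^bsub>F\<^esub> [(i, s)] \<otimes>\<^bsub>F\<^esub> [(1, True)]"
  using free_aut_letter[OF pconj_gens, of i S s] one_less
  by (auto simp: pconj_def inv_letter F.inv_mult_group F.m_assoc)

lemma pconj_carrier:
  assumes S: "1 \<notin> S"
  shows "pconj S \<in> carrier AF"
proof -
  let ?g = "\<lambda>i. if i \<in> S then [(1, False)] \<otimes>\<^bsub>F\<^esub> [(i, True)] \<otimes>\<^bsub>F\<^esub> [(1, True)] else [(i, True)]"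
  let ?h = "\<lambda>i. if i \<in> S then [(1, True)] \<otimes>\<^bsub>F\<^esub> [(i, True)] \<otimes>\<^bsub>F\<^esub> [(1, False)] else [(i, True)]"
  have h: "?h \<in> {..<n} \<rightarrow> carrier F" using one_less by auto
  note e = free_ext_hom[OF F.is_group h] free_ext_hom[OF F.is_group pconj_gens]
    free_ext_letter[OF F.is_group h] free_ext_letter[OF F.is_group pconj_gens]
  have c: "[(1, False)] \<otimes>\<^bsub>F\<^esub> ([(1, True)] \<otimes>\<^bsub>F\<^esub> x) = x" "[(1, True)] \<otimes>\<^bsub>F\<^esub> ([(1, False)] \<otimes>\<^bsub>F\<^esub> x) = x"
    if "x \<in> carrier F" for x
    using that one_less cancel_inv[OF F.is_group, of "[(1, True)]" x] letter1_inv by auto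
  have d: "[(1, False)] \<otimes>\<^bsub>F\<^esub> [(1, True)] = []" "[(1, True)] \<otimes>\<^bsub>F\<^esub> [(1, False)] = []"
    using letter_mult_inv[where a="1" and b=False] letter_mult_inv[where a="1" and b=True] by auto
  have "free_ext F ?h (?g a) = [(a, True)]" if "a < n" for a
    using that S one_less c d by (auto simp: hom_mult[OF e(1)] e(3) F.m_assoc inv_letter F.r_one[unfolded one_free_group])
  moreover have "free_ext F ?g (?h a) = [(a, True)]" if "a < n" for a
    using that S one_less c d by (auto simp: hom_mult[OF e(2)] e(4) F.m_assoc inv_letter F.r_one[unfolded one_free_group])
  ultimately show ?thesis unfolding pconj_def by (intro free_aut_carrier[OF pconj_gens h]) auto
qed

lemma aut_mult3:
  assumes "\<sigma> \<in> carrier AF" "i < n"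
  shows "\<sigma> ([(1, False)] \<otimes>\<^bsub>F\<^esub> [(i, s)] \<otimes>\<^bsub>F\<^esub> [(1, True)]) = \<sigma> [(1, False)] \<otimes>\<^bsub>F\<^esub> \<sigma> [(i, s)] \<otimes>\<^bsub>F\<^esub> \<sigma> [(1, True)]"
  using assms one_less by (simp add: aut_mult)

lemma iota_letter: "i < n \<Longrightarrow> iota [(i, s)] = [(i, \<not> s)]"
  by (simp add: iota_def signed_perm_letter[OF id_bij])

lemma sgn_letter: "i < n \<Longrightarrow> sgn_aut p [(i, s)] = [(i, (i \<noteq> p) = s)]"
  by (simp add: sgn_aut_def signed_perm_letter[OF id_bij])

lemma perm_letter: "\<lbrakk>bij_betw \<pi> {..<n} {..<n}; i < n\<rbrakk> \<Longrightarrow> perm_aut \<pi> [(i, s)] = [(\<pi> i, s)]"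
  by (simp add: perm_aut_def signed_perm_letter)

lemma K0_carrier [simp]: "pconj {0} \<in> carrier AF" "i \<noteq> 1 \<Longrightarrow> pconj {i} \<in> carrier AF"
  by (auto intro: pconj_carrier)

lemma aut_eqI:
  assumes "\<sigma> \<in> carrier AF" "\<tau> \<in> carrier AF" "\<And>i. i < n \<Longrightarrow> \<sigma> [(i, True)] = \<tau> [(i, True)]"
  shows "\<sigma> = \<tau>"
  using right_Aut_free_eqI[OF assms(1,2)] assms(3) by simp

text \<open>Inverting letters without reversing the word turns x_0 x_1 into x_0^-1 x_1^-1, whereas
  inverting the word gives x_1^-1 x_0^-1. Conjugating x_0 by x_1 repairs exactly this
  difference.\<close>

lemma rel_transvection_iota:
  "transvection n \<otimes>\<^bsub>AF\<^esub> iota \<otimes>\<^bsub>AF\<^esub> pconj {0} = iota \<otimes>\<^bsub>AF\<^esub> transvection n"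
proof (rule aut_eqI)
  fix i assume i: "i < n"
  let ?x = "[(0, True)]" and ?y = "[(1, True)]"
  have xy: "?x \<in> carrier F" "?y \<in> carrier F" "[(0, False)] = inv\<^bsub>F\<^esub> ?x" "[(1, False)] = inv\<^bsub>F\<^esub> ?y"
    using one_less by (auto simp: inv_letter)
  show "(transvection n \<otimes>\<^bsub>AF\<^esub> iota \<otimes>\<^bsub>AF\<^esub> pconj {0}) [(i, True)] = (iota \<otimes>\<^bsub>AF\<^esub> transvection n) [(i, True)]"
  proof (cases "i = 0")
    case True
    have 1: "iota (?x \<otimes>\<^bsub>F\<^esub> ?y) = inv\<^bsub>F\<^esub> ?x \<otimes>\<^bsub>F\<^esub> inv\<^bsub>F\<^esub> ?y"
      using xy one_less by (simp add: aut_mult iota_letter)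
    have 2: "pconj {0} (inv\<^bsub>F\<^esub> ?x) = inv\<^bsub>F\<^esub> ?y \<otimes>\<^bsub>F\<^esub> inv\<^bsub>F\<^esub> ?x \<otimes>\<^bsub>F\<^esub> ?y"
      using pconj_letter(2)[of 0 "{0}" False] one_less xy by simp
    have 3: "pconj {0} (inv\<^bsub>F\<^esub> ?y) = inv\<^bsub>F\<^esub> ?y"
      using pconj_letter(1)[of 1 "{0}" False] one_less xy by simp
    have 4: "transvection n (inv\<^bsub>F\<^esub> ?x) = inv\<^bsub>F\<^esub> (?x \<otimes>\<^bsub>F\<^esub> ?y)"
      using aut_inv[OF transvection_carrier xy(1)] by (simp add: transvection_0)
    have "(transvection n \<otimes>\<^bsub>AF\<^esub> iota \<otimes>\<^bsub>AF\<^esub> pconj {0}) ?x = pconj {0} (inv\<^bsub>F\<^esub> ?x \<otimes>\<^bsub>F\<^esub> inv\<^bsub>F\<^esub> ?y)"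
      using xy by (simp add: right_Aut_mult transvection_0 1)
    also have "\<dots> = inv\<^bsub>F\<^esub> ?y \<otimes>\<^bsub>F\<^esub> inv\<^bsub>F\<^esub> ?x"
      using xy(1,2) by (simp add: aut_mult 2 3 F.m_assoc F.r_one[unfolded one_free_group])
    also have "\<dots> = inv\<^bsub>F\<^esub> (?x \<otimes>\<^bsub>F\<^esub> ?y)" using xy(1,2) by (simp add: F.inv_mult_group)
    also have "\<dots> = (iota \<otimes>\<^bsub>AF\<^esub> transvection n) ?x"
      using 4 xy one_less by (simp add: right_Aut_mult iota_letter)
    finally show ?thesis using True by simp
  next
    case False
    then show ?thesis using i
      by (simp add: right_Aut_mult transvection_other iota_letter pconj_letter)
  qed
qed (simp_all add: transvection_carrier)

lemma rel_perm_iota: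
  assumes "bij_betw \<pi> {..<n} {..<n}"
  shows "signed_perm n \<pi> b \<otimes>\<^bsub>AF\<^esub> iota = iota \<otimes>\<^bsub>AF\<^esub> signed_perm n \<pi> b"
  using assms bij_betwE[OF assms]
  by (intro aut_eqI) (auto simp: signed_perm_carrier right_Aut_mult iota_letter signed_perm_letter)

lemma rel_sgn_K0:
  assumes "p \<noteq> 1"
  shows "sgn_aut p \<otimes>\<^bsub>AF\<^esub> pconj {0} = pconj {0} \<otimes>\<^bsub>AF\<^esub> sgn_aut p"
proof (rule aut_eqI)
  fix i assume i: "i < n"
  show "(sgn_aut p \<otimes>\<^bsub>AF\<^esub> pconj {0}) [(i, True)] = (pconj {0} \<otimes>\<^bsub>AF\<^esub> sgn_aut p) [(i, True)]"
    using i one_less assms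
    by (cases "i = 0") (auto simp: right_Aut_mult sgn_letter pconj_letter aut_mult3)
qed simp_all

text \<open>Inverting x_1 conjugates K into its inverse; the relation is arranged so that the
  inverse of K need not be written.\<close>

lemma rel_sgn1_K0: "pconj {0} \<otimes>\<^bsub>AF\<^esub> sgn_aut 1 \<otimes>\<^bsub>AF\<^esub> pconj {0} = sgn_aut 1"
proof (rule aut_eqI)
  fix i assume i: "i < n"
  let ?x = "[(0, True)]" and ?y = "[(1, True)]"
  have xy: "?x \<in> carrier F" "?y \<in> carrier F" "[(1, False)] = inv\<^bsub>F\<^esub> ?y"
    using one_less by (auto simp: inv_letter)
  show "(pconj {0} \<otimes>\<^bsub>AF\<^esub> sgn_aut 1 \<otimes>\<^bsub>AF\<^esub> pconj {0}) [(i, True)] = sgn_aut 1 [(i, True)]"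
  proof (cases "i = 0")
    case True
    have "(pconj {0} \<otimes>\<^bsub>AF\<^esub> sgn_aut 1 \<otimes>\<^bsub>AF\<^esub> pconj {0}) ?x
        = pconj {0} (sgn_aut 1 ([(1, False)] \<otimes>\<^bsub>F\<^esub> ?x \<otimes>\<^bsub>F\<^esub> ?y))"
      using one_less by (simp add: right_Aut_mult pconj_letter)
    also have "\<dots> = pconj {0} (?y \<otimes>\<^bsub>F\<^esub> ?x \<otimes>\<^bsub>F\<^esub> [(1, False)])"
      using one_less by (simp add: aut_mult3 sgn_letter)
    also have "\<dots> = ?y \<otimes>\<^bsub>F\<^esub> (inv\<^bsub>F\<^esub> ?y \<otimes>\<^bsub>F\<^esub> ?x \<otimes>\<^bsub>F\<^esub> ?y) \<otimes>\<^bsub>F\<^esub> inv\<^bsub>F\<^esub> ?y"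
      using one_less xy(1,2) by (simp add: aut_mult pconj_letter xy(3)[symmetric])
    also have "\<dots> = ?x"
      using xy(1,2) by (simp add: F.m_assoc cancel_inv[OF F.is_group] F.r_one[unfolded one_free_group])
    finally show ?thesis using True one_less by (simp add: sgn_letter)
  next
    case False
    then show ?thesis using i by (simp add: right_Aut_mult sgn_letter pconj_letter)
  qed
qed simp_all

lemma rel_perm_K:
  assumes p: "bij_betw \<pi> {..<n} {..<n}" and i: "i < n" "i \<noteq> 1" "\<pi> i = 0" "\<pi> 1 = 1"
  shows "perm_aut \<pi> \<otimes>\<^bsub>AF\<^esub> pconj {0} = pconj {i} \<otimes>\<^bsub>AF\<^esub> perm_aut \<pi>"
proof (rule aut_eqI)
  fix l assume l: "l < n"
  show "(perm_aut \<pi> \<otimes>\<^bsub>AF\<^esub> pconj {0}) [(l, True)] = (pconj {i} \<otimes>\<^bsub>AF\<^esub> perm_aut \<pi>) [(l, True)]"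
  proof (cases "l = i")
    case True
    then show ?thesis using assms one_less l
      by (simp add: right_Aut_mult perm_letter pconj_letter aut_mult3)
  next
    case False
    then have "\<pi> l \<noteq> 0" using i l p by (metis bij_betw_imp_inj_on inj_onD lessThan_iff)
    then show ?thesis using False assms l bij_betwE[OF p]
      by (simp add: right_Aut_mult perm_letter pconj_letter)
  qed
qed (use assms in simp_all)

text \<open>The conjugating generator is itself fixed, so conjugations of different generators do
  not interfere.\<close>

lemma pconj_insert:
  assumes "1 \<notin> S" "i \<notin> S" "i \<noteq> 1"
  shows "pconj (insert i S) = pconj S \<otimes>\<^bsub>AF\<^esub> pconj {i}"
proof (rule aut_eqI)
  fix l assume l: "l < n"
  show "pconj (insert i S) [(l, True)] = (pconj S \<otimes>\<^bsub>AF\<^esub> pconj {i}) [(l, True)]"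
    using assms one_less l
    by (cases "l = i"; cases "l \<in> S") (auto simp: right_Aut_mult pconj_letter pconj_carrier aut_mult3)
qed (use assms in \<open>auto simp: pconj_carrier\<close>)

lemma pconj_empty: "pconj {} = \<one>\<^bsub>AF\<^esub>"
  by (rule aut_eqI) (auto simp: pconj_carrier pconj_letter right_Aut_one)

text \<open>Conjugation by x_1 fixes x_1. Together with \<open>pconj_insert\<close> this factors an
  inner automorphism into n - 1 conjugates of K, the source of the relation between the coefficients
  a and b.\<close>

lemma pconj_all: "pconj ({..<n} - {1}) = conj_aut F [(1, True)]"
proof (rule aut_eqI)
  fix i assume i: "i < n"
  show "pconj ({..<n} - {1}) [(i, True)] = conj_aut F [(1, True)] [(i, True)]"
    using i one_less letter1_inv letter_mult_inv[where a=1 and b=False and S="{..<n}"]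
    by (cases "i = 1") (auto simp: pconj_letter conj_aut_def F.l_one[unfolded one_free_group])
qed (use one_less in \<open>auto simp: pconj_carrier conj_aut_carrier[OF F.is_group]\<close>)

lemma mat_pconj: "\<lbrakk>1 \<notin> S; i < n; j < n\<rbrakk> \<Longrightarrow> mat (pconj S) i j = (if i = j then 1 else 0)"
  using one_less by (cases "i \<in> S") (auto simp: mat_def pconj_letter expn_mult expn_letter)

definition sg :: "bool \<Rightarrow> int" where
  "sg b = (if b then 1 else -1)"

lemma mat_signed_perm:
  assumes "bij_betw \<pi> {..<n} {..<n}" "i < n"
  shows "mat (signed_perm n \<pi> b) i p = (if p = \<pi> i then sg (b i) else 0)"
  using assms bij_betwE[OF assms(1)] by (auto simp: mat_def signed_perm_letter expn_letter sg_def)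

lemma imat_signed_perm:
  assumes p: "bij_betw \<pi> {..<n} {..<n}" and q: "q < n" "j < n"
  shows "imat (signed_perm n \<pi> b) q j = (if q = \<pi> j then sg (b j) else 0)"
proof -
  obtain l where l: "l < n" "q = \<pi> l" using q bij_betw_imp_surj_on[OF p] by (metis imageE lessThan_iff)
  have "signed_perm n \<pi> b [(l, b l)] = [(q, True)]" using l by (simp add: signed_perm_letter[OF p])
  then have "(inv\<^bsub>AF\<^esub> signed_perm n \<pi> b) [(q, True)] = [(l, b l)]"
    using right_Aut_inv(1)[OF F.is_group signed_perm_carrier[OF p, of b], of "[(l, b l)]"] l by simp
  moreover have "q = \<pi> j \<longleftrightarrow> l = j" using l q p by (metis bij_betw_imp_inj_on inj_onD lessThan_iff)
  ultimately show ?thesis using l by (auto simp: imat_def mat_def expn_letter sg_def)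
qed

lemma vcoord_signed_perm:
  assumes p: "bij_betw \<pi> {..<n} {..<n}" and i: "i < n" "j < n" "k < n" and v: "v \<in> carrier VF"
  shows "vcoord i j k (act_V F (signed_perm n \<pi> b) v) = (sg (b i) * sg (b j) * sg (b k)) * vcoord (\<pi> i) (\<pi> j) (\<pi> k) v"
proof -
  have l: "\<pi> i < n" "\<pi> j < n" "\<pi> k < n" using bij_betwE[OF p] i by auto
  have "(\<Sum>p<n. mat (signed_perm n \<pi> b) i p * g p) = sg (b i) * g (\<pi> i)"
    "(\<Sum>q<n. imat (signed_perm n \<pi> b) q j * g q) = sg (b j) * g (\<pi> j)"
    "(\<Sum>q<n. imat (signed_perm n \<pi> b) q k * g q) = sg (b k) * g (\<pi> k)" for g
    by (rule sum_row1; use l i in \<open>auto simp: mat_signed_perm[OF p] imat_signed_perm[OF p]\<close>)+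
  then show ?thesis by (simp add: vcoord_act_nested[OF signed_perm_carrier[OF p] i(1) v])
qed

lemma mat_transvection:
  "mat (transvection n) 0 p = (if p = 0 then 1 else if p = 1 then 1 else 0)"
  "\<lbrakk>i < n; i \<noteq> 0\<rbrakk> \<Longrightarrow> mat (transvection n) i p = (if p = i then 1 else 0)"
  using one_less by (auto simp: mat_def transvection_0 transvection_other expn_mult expn_letter)

lemma transvection_inv:
  "(inv\<^bsub>AF\<^esub> transvection n) [(0, True)] = [(0, True)] \<otimes>\<^bsub>F\<^esub> [(1, False)]"
  "\<lbrakk>i < n; i \<noteq> 0\<rbrakk> \<Longrightarrow> (inv\<^bsub>AF\<^esub> transvection n) [(i, s)] = [(i, s)]"
proof -
  have "transvection n ([(0, True)] \<otimes>\<^bsub>F\<^esub> [(1, False)]) = [(0, True)] \<otimes>\<^bsub>F\<^esub> [(1, True)] \<otimes>\<^bsub>F\<^esub> [(1, False)]"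
    using one_less by (simp add: aut_mult[OF transvection_carrier] transvection_0 transvection_other)
  also have "\<dots> = [(0, True)]"
    using one_less letter_mult_inv[where a=1 and b=True and S="{..<n}"]
    by (simp add: F.m_assoc F.r_one[unfolded one_free_group])
  finally show "(inv\<^bsub>AF\<^esub> transvection n) [(0, True)] = [(0, True)] \<otimes>\<^bsub>F\<^esub> [(1, False)]"
    using right_Aut_inv(1)[OF F.is_group transvection_carrier, of "[(0, True)] \<otimes>\<^bsub>F\<^esub> [(1, False)]"] one_less by simp
  show "\<lbrakk>i < n; i \<noteq> 0\<rbrakk> \<Longrightarrow> (inv\<^bsub>AF\<^esub> transvection n) [(i, s)] = [(i, s)]"
    using right_Aut_inv(1)[OF F.is_group transvection_carrier, of "[(i, s)]"] by (simp add: transvection_other)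
qed

lemma imat_transvection:
  "q < n \<Longrightarrow> imat (transvection n) q 1 = (if q = 1 then 1 else if q = 0 then -1 else 0)"
  "\<lbrakk>q < n; j \<noteq> 1\<rbrakk> \<Longrightarrow> imat (transvection n) q j = (if q = j then 1 else 0)"
  using one_less by (cases "q = 0"; auto simp: imat_def mat_def transvection_inv expn_mult expn_letter)+

end

section \<open>Crossed homomorphisms that vanish on inner automorphisms\<close>

context out_coeff
begin

text \<open>Membership in 2L, the form in which congruences modulo 2 are stated and later
  halved.\<close>

definition is_double :: "'l \<Rightarrow> bool" where
  "is_double x \<longleftrightarrow> (\<exists>y\<in>carrier L. x = y \<oplus>\<^bsub>L\<^esub> y)"

lemma is_double_closed: "is_double x \<Longrightarrow> x \<in> carrier L"
  by (auto simp: is_double_def)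

lemma is_double_zero: "is_double \<zero>\<^bsub>L\<^esub>"
  by (auto simp: is_double_def intro!: bexI[of _ "\<zero>\<^bsub>L\<^esub>"])

lemma is_double_add: "is_double x \<Longrightarrow> is_double y \<Longrightarrow> is_double (x \<oplus>\<^bsub>L\<^esub> y)"
proof -
  assume "is_double x" "is_double y"
  then obtain a b where ab: "a \<in> carrier L" "b \<in> carrier L" "x = a \<oplus>\<^bsub>L\<^esub> a" "y = b \<oplus>\<^bsub>L\<^esub> b" by (auto simp: is_double_def)
  then show ?thesis unfolding is_double_def by (intro bexI[of _ "a \<oplus>\<^bsub>L\<^esub> b"]) (auto simp: L.a_ac)
qed

lemma is_double_minus: "is_double x \<Longrightarrow> is_double (\<ominus>\<^bsub>L\<^esub> x)"
proof -
  assume "is_double x"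
  then obtain a where ab: "a \<in> carrier L" "x = a \<oplus>\<^bsub>L\<^esub> a" by (auto simp: is_double_def)
  then show ?thesis unfolding is_double_def by (intro bexI[of _ "\<ominus>\<^bsub>L\<^esub> a"]) (auto simp: L.minus_add)
qed

lemma is_double_double: "x \<in> carrier L \<Longrightarrow> is_double (x \<oplus>\<^bsub>L\<^esub> x)"
  by (auto simp: is_double_def)

lemma is_double_cancel:
  assumes "is_double (x \<oplus>\<^bsub>L\<^esub> y)" "is_double y" "x \<in> carrier L"
  shows "is_double x"
proof -
  have "x = (x \<oplus>\<^bsub>L\<^esub> y) \<oplus>\<^bsub>L\<^esub> (\<ominus>\<^bsub>L\<^esub> y)"
    using assms is_double_closed[OF assms(2)] by (simp add: L.a_assoc L.r_neg)
  then show ?thesis using is_double_add[OF assms(1) is_double_minus[OF assms(2)]] by simp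
qed

lemma eq_minus_self: "\<lbrakk>x \<in> carrier L; x = \<ominus>\<^bsub>L\<^esub> x\<rbrakk> \<Longrightarrow> x = \<zero>\<^bsub>L\<^esub>"
  using no_two_torsion L.r_neg by metis

lemma double_inj:
  assumes "x \<in> carrier L" "y \<in> carrier L" "x \<oplus>\<^bsub>L\<^esub> x = y \<oplus>\<^bsub>L\<^esub> y"
  shows "x = y"
proof -
  have "(x \<oplus>\<^bsub>L\<^esub> \<ominus>\<^bsub>L\<^esub> y) \<oplus>\<^bsub>L\<^esub> (x \<oplus>\<^bsub>L\<^esub> \<ominus>\<^bsub>L\<^esub> y) = (x \<oplus>\<^bsub>L\<^esub> x) \<oplus>\<^bsub>L\<^esub> \<ominus>\<^bsub>L\<^esub> (y \<oplus>\<^bsub>L\<^esub> y)"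
    using assms(1,2) by (simp add: L.minus_add L.a_ac)
  also have "\<dots> = \<zero>\<^bsub>L\<^esub>" using assms(1,2) by (simp add: assms(3) L.r_neg)
  finally have z: "(x \<oplus>\<^bsub>L\<^esub> \<ominus>\<^bsub>L\<^esub> y) \<oplus>\<^bsub>L\<^esub> (x \<oplus>\<^bsub>L\<^esub> \<ominus>\<^bsub>L\<^esub> y) = \<zero>\<^bsub>L\<^esub>" .
  have "x \<oplus>\<^bsub>L\<^esub> \<ominus>\<^bsub>L\<^esub> y = \<zero>\<^bsub>L\<^esub>" by (rule no_two_torsion[OF _ z]) (simp add: assms(1,2))
  then show ?thesis using assms(1,2) L.minus_equality[of x "\<ominus>\<^bsub>L\<^esub> y"] by simp
qed

lemma zmul_sg: "a \<in> carrier L \<Longrightarrow> zmul (sg b) a = (if b then a else \<ominus>\<^bsub>L\<^esub> a)"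
  by (simp add: sg_def zmul_one zmul_minus_one)

lemma tcoord_signed_perm:
  assumes p: "bij_betw \<pi> {..<n} {..<n}" and i: "i < n" "j < n" "k < n" and t: "t \<in> carrier TL"
  shows "tcoord i j k (act_VL F L (signed_perm n \<pi> b) t)
    = (if (b i = b j) = b k then tcoord (\<pi> i) (\<pi> j) (\<pi> k) t else \<ominus>\<^bsub>L\<^esub> tcoord (\<pi> i) (\<pi> j) (\<pi> k) t)"
proof -
  have l: "\<pi> i < n" using bij_betwE[OF p] i by auto
  have "sg (b i) * sg (b j) * sg (b k) = sg ((b i = b j) = b k)" by (simp add: sg_def)
  then have "tcoord i j k (act_VL F L (signed_perm n \<pi> b) t) = zmul (sg ((b i = b j) = b k)) (tcoord (\<pi> i) (\<pi> j) (\<pi> k) t)"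
    using vcoord_signed_perm[OF p i, of _ b] by (intro tcoord_act1[OF signed_perm_carrier[OF p] t i(1) l]) simp
  then show ?thesis using tcoord_closed[OF l t] by (simp add: zmul_sg)
qed

lemma small_less: "0 < n" "1 < n" "2 < n" "3 < n" "4 < n"
  using n5 by auto

lemma vcoord_diag: "i < n \<Longrightarrow> v \<in> carrier VF \<Longrightarrow> vcoord i j j v = 0"
  using vcoord_swap[of i v j j] by simp

lemma tcoord_diag: "i < n \<Longrightarrow> t \<in> carrier TL \<Longrightarrow> tcoord i j j t = \<zero>\<^bsub>L\<^esub>"
  using tcoord_swap[of i t j j] eq_minus_self tcoord_closed by blast

text \<open>Subtracting the original coordinate leaves, up to sign, one coordinate of each needed
  shape: (1; 2, 3) with distinct indices, (2; 0, 2) and (1; 0, 1). These become the congruences for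
  f(\<iota>).\<close>

lemma vcoord_transvection:
  assumes v: "v \<in> carrier VF"
  shows "vcoord 0 2 3 (act_V F (transvection n) v) = vcoord 0 2 3 v + vcoord 1 2 3 v"
    and "vcoord 2 1 2 (act_V F (transvection n) v) = vcoord 2 1 2 v - vcoord 2 0 2 v"
    and "vcoord 0 0 1 (act_V F (transvection n) v) = vcoord 0 0 1 v + vcoord 1 0 1 v"
proof -
  note m = mat_transvection imat_transvection and s = small_less
  have r0: "(\<Sum>p<n. mat (transvection n) 0 p * g p) = 1 * g 0 + 1 * g 1" for g
    by (rule sum_row2) (use s in \<open>auto simp: m\<close>)
  have r2: "(\<Sum>p<n. mat (transvection n) 2 p * g p) = 1 * g 2" for g
    by (rule sum_row1) (use s in \<open>auto simp: m\<close>)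
  have c: "(\<Sum>p<n. imat (transvection n) p 0 * g p) = 1 * g 0" "(\<Sum>p<n. imat (transvection n) p 2 * g p) = 1 * g 2"
    "(\<Sum>p<n. imat (transvection n) p 3 * g p) = 1 * g 3" for g
    by (rule sum_row1; use s in \<open>auto simp: m\<close>)+
  have c1: "(\<Sum>p<n. imat (transvection n) p 1 * g p) = 1 * g 1 + (-1) * g 0" for g
    by (rule sum_row2) (use s in \<open>auto simp: m\<close>)
  show "vcoord 0 2 3 (act_V F (transvection n) v) = vcoord 0 2 3 v + vcoord 1 2 3 v"
    "vcoord 2 1 2 (act_V F (transvection n) v) = vcoord 2 1 2 v - vcoord 2 0 2 v"
    "vcoord 0 0 1 (act_V F (transvection n) v) = vcoord 0 0 1 v + vcoord 1 0 1 v"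
    using v s by (simp_all add: vcoord_act_nested[OF transvection_carrier] r0 r2 c c1 vcoord_diag)
qed

lemma tcoord_transvection:
  assumes t: "t \<in> carrier TL"
  shows "tcoord 0 2 3 (act_VL F L (transvection n) t) = tcoord 0 2 3 t \<oplus>\<^bsub>L\<^esub> tcoord 1 2 3 t"
    and "tcoord 2 1 2 (act_VL F L (transvection n) t) = tcoord 2 1 2 t \<ominus>\<^bsub>L\<^esub> tcoord 2 0 2 t"
    and "tcoord 0 0 1 (act_VL F L (transvection n) t) = tcoord 0 0 1 t \<oplus>\<^bsub>L\<^esub> tcoord 1 0 1 t"
proof -
  note s = small_less and c = tcoord_closed[OF _ t]
  have "tcoord 0 2 3 (act_VL F L (transvection n) t) = zmul 1 (tcoord 0 2 3 t) \<oplus>\<^bsub>L\<^esub> zmul 1 (tcoord 1 2 3 t)"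
    "tcoord 2 1 2 (act_VL F L (transvection n) t) = zmul 1 (tcoord 2 1 2 t) \<oplus>\<^bsub>L\<^esub> zmul (-1) (tcoord 2 0 2 t)"
    "tcoord 0 0 1 (act_VL F L (transvection n) t) = zmul 1 (tcoord 0 0 1 t) \<oplus>\<^bsub>L\<^esub> zmul 1 (tcoord 1 0 1 t)"
    by (rule tcoord_act2[OF transvection_carrier t]; use s in \<open>simp add: vcoord_transvection\<close>)+
  then show "tcoord 0 2 3 (act_VL F L (transvection n) t) = tcoord 0 2 3 t \<oplus>\<^bsub>L\<^esub> tcoord 1 2 3 t"
    "tcoord 2 1 2 (act_VL F L (transvection n) t) = tcoord 2 1 2 t \<ominus>\<^bsub>L\<^esub> tcoord 2 0 2 t"
    "tcoord 0 0 1 (act_VL F L (transvection n) t) = tcoord 0 0 1 t \<oplus>\<^bsub>L\<^esub> tcoord 1 0 1 t"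
    using c s by (simp_all add: zmul_one zmul_minus_one L.minus_eq)
qed

text \<open>Inner automorphisms act trivially on V_L, so vanishing on them is what lets a crossed
  homomorphism of Aut F_n descend to Out F_n. Computing with automorphisms avoids classes until the
  end.\<close>

definition crossed :: "(((nat \<times> bool) list \<Rightarrow> (nat \<times> bool) list) \<Rightarrow> ((nat \<times> bool) list, 'l) VL_elem) \<Rightarrow> bool" where
  "crossed f \<longleftrightarrow> (\<forall>\<sigma>\<in>carrier AF. f \<sigma> \<in> carrier TL) \<and>
     (\<forall>\<sigma>\<in>carrier AF. \<forall>\<tau>\<in>carrier AF. f (\<sigma> \<otimes>\<^bsub>AF\<^esub> \<tau>) = f \<sigma> \<otimes>\<^bsub>TL\<^esub> act_VL F L \<sigma> (f \<tau>)) \<and>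
     (\<forall>g\<in>carrier F. f (conj_aut F g) = \<one>\<^bsub>TL\<^esub>)"

context
  fixes f
  assumes f: "crossed f"
begin

lemma f_closed: "\<sigma> \<in> carrier AF \<Longrightarrow> f \<sigma> \<in> carrier TL"
  and f_mult: "\<lbrakk>\<sigma> \<in> carrier AF; \<tau> \<in> carrier AF\<rbrakk> \<Longrightarrow> f (\<sigma> \<otimes>\<^bsub>AF\<^esub> \<tau>) = f \<sigma> \<otimes>\<^bsub>TL\<^esub> act_VL F L \<sigma> (f \<tau>)"
  and f_conj: "g \<in> carrier F \<Longrightarrow> f (conj_aut F g) = \<one>\<^bsub>TL\<^esub>"
  using f by (auto simp: crossed_def)

lemma f_one: "f \<one>\<^bsub>AF\<^esub> = \<one>\<^bsub>TL\<^esub>"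
  using f_conj[OF F.one_closed] conj_aut_one[OF F.is_group] by simp

lemma act_one: "t \<in> carrier TL \<Longrightarrow> act_VL F L \<one>\<^bsub>AF\<^esub> t = t"
  by (rule act_VL_trivial) (auto simp: mat_one)

lemma act_pconj: "\<lbrakk>1 \<notin> S; t \<in> carrier TL\<rbrakk> \<Longrightarrow> act_VL F L (pconj S) t = t"
  by (rule act_VL_trivial) (auto simp: mat_pconj pconj_carrier)

lemma act_inv: "\<lbrakk>\<sigma> \<in> carrier AF; t \<in> carrier TL\<rbrakk> \<Longrightarrow> act_VL F L \<sigma> (inv\<^bsub>TL\<^esub> t) = inv\<^bsub>TL\<^esub> (act_VL F L \<sigma> t)"
  using group_hom.hom_inv[of TL TL "act_VL F L \<sigma>" t] act_VL_hom[of \<sigma>]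
  by (simp add: group_hom_def group_hom_axioms_def TL.is_group)

lemma act_TL_mult: "\<lbrakk>\<sigma> \<in> carrier AF; t \<in> carrier TL; u \<in> carrier TL\<rbrakk> \<Longrightarrow>
    act_VL F L \<sigma> (t \<otimes>\<^bsub>TL\<^esub> u) = act_VL F L \<sigma> t \<otimes>\<^bsub>TL\<^esub> act_VL F L \<sigma> u"
  using hom_mult[OF act_VL_hom[of \<sigma>]] by simp

lemma act_iota: "t \<in> carrier TL \<Longrightarrow> act_VL F L iota t = inv\<^bsub>TL\<^esub> t"
  by (rule TL_eqI) (auto simp: iota_def signed_perm_carrier act_VL_closed id_bij tcoord_signed_perm tcoord_inv)

abbreviation (input) "k0 \<equiv> f (pconj {0})"
abbreviation (input) "c i j k \<equiv> tcoord i j k (f (pconj {0}))"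

lemma k0_closed: "k0 \<in> carrier TL"
  by (simp add: f_closed)

lemma c_closed: "i < n \<Longrightarrow> c i j k \<in> carrier L"
  using tcoord_closed k0_closed by simp

text \<open>In f(\<pi>K) = f(K_i \<pi>) the term f(\<pi>) cancels, because the partial conjugation
  K_i acts trivially on it.\<close>

lemma f_K_perm:
  assumes "bij_betw \<pi> {..<n} {..<n}" "i < n" "i \<noteq> 1" "\<pi> i = 0" "\<pi> 1 = 1"
  shows "f (pconj {i}) = act_VL F L (perm_aut \<pi>) k0"
proof -
  have "f (perm_aut \<pi>) \<otimes>\<^bsub>TL\<^esub> act_VL F L (perm_aut \<pi>) k0 = f (pconj {i}) \<otimes>\<^bsub>TL\<^esub> f (perm_aut \<pi>)"
    using rel_perm_K[OF assms] f_mult[of "perm_aut \<pi>" "pconj {0}"] f_mult[of "pconj {i}" "perm_aut \<pi>"]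
      assms act_pconj[of "{i}"] f_closed by simp
  then show ?thesis
    using assms f_closed act_VL_closed TL.m_comm[of "f (perm_aut \<pi>)" "f (pconj {i})"] k0_closed
    by (metis K0_carrier(2) TL.l_cancel special_carrier(3))
qed

lemma k0_sgn:
  assumes "p \<noteq> 1"
  shows "act_VL F L (sgn_aut p) k0 = k0"
proof -
  have "f (sgn_aut p) \<otimes>\<^bsub>TL\<^esub> act_VL F L (sgn_aut p) k0 = k0 \<otimes>\<^bsub>TL\<^esub> f (sgn_aut p)"
    using rel_sgn_K0[OF assms] f_mult[of "sgn_aut p" "pconj {0}"] f_mult[of "pconj {0}" "sgn_aut p"]
      act_pconj[of "{0}"] f_closed by simp
  then show ?thesis
    using f_closed[of "sgn_aut p"] act_VL_closed[of "sgn_aut p" k0] TL.m_comm[of "f (sgn_aut p)" k0] k0_closed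
    by (metis TL.l_cancel special_carrier(2))
qed

lemma k0_sgn1: "act_VL F L (sgn_aut 1) k0 = inv\<^bsub>TL\<^esub> k0"
proof -
  have c: "f (sgn_aut 1) \<in> carrier TL" "act_VL F L (sgn_aut 1) k0 \<in> carrier TL"
    using f_closed act_VL_closed k0_closed by auto
  have "f (sgn_aut 1) = k0 \<otimes>\<^bsub>TL\<^esub> f (sgn_aut 1) \<otimes>\<^bsub>TL\<^esub> act_VL F L (sgn_aut 1) k0"
    using arg_cong[OF rel_sgn1_K0, of f] f_mult[of "pconj {0} \<otimes>\<^bsub>AF\<^esub> sgn_aut 1" "pconj {0}"]
      f_mult[of "pconj {0}" "sgn_aut 1"] act_pconj[of "{0}"] c k0_closed
      act_VL_mult[of "pconj {0}" "sgn_aut 1" k0] by simp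
  also have "\<dots> = f (sgn_aut 1) \<otimes>\<^bsub>TL\<^esub> (act_VL F L (sgn_aut 1) k0 \<otimes>\<^bsub>TL\<^esub> k0)"
    using c k0_closed by (simp add: TL.m_ac)
  finally have "act_VL F L (sgn_aut 1) k0 \<otimes>\<^bsub>TL\<^esub> k0 = \<one>\<^bsub>TL\<^esub>"
    using c k0_closed TL.l_cancel_one' by (metis TL.m_closed)
  then show ?thesis using TL.inv_equality[of "act_VL F L (sgn_aut 1) k0" k0] c k0_closed by simp
qed

text \<open>The sign change at \<open>p\<close> multiplies a coordinate by -1 once for each index
  equal to \<open>p\<close>. It fixes f(K) for p \<noteq> 1 and negates it for p = 1, so a
  coordinate survives only if each p \<noteq> 1 occurs evenly often and 1 oddly often; otherwise it
  equals its own negative and vanishes for want of 2-torsion.\<close>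

lemma c_sgn:
  assumes "i < n" "j < n" "k < n"
  shows "((i = p) = (j = p)) \<noteq> (k \<noteq> p) \<Longrightarrow> p \<noteq> 1 \<Longrightarrow> c i j k = \<zero>\<^bsub>L\<^esub>"
    and "((i = 1) = (j = 1)) = (k \<noteq> 1) \<Longrightarrow> c i j k = \<zero>\<^bsub>L\<^esub>"
proof -
  have 1: "tcoord i j k (act_VL F L (sgn_aut p) k0) = (if ((i = p) = (j = p)) = (k \<noteq> p) then c i j k else \<ominus>\<^bsub>L\<^esub> c i j k)" for p
    using tcoord_signed_perm[OF id_bij assms k0_closed, of "\<lambda>i. i \<noteq> p"] unfolding sgn_aut_def by auto
  note cl = c_closed[OF assms(1), of j k]
  show "((i = p) = (j = p)) \<noteq> (k \<noteq> p) \<Longrightarrow> p \<noteq> 1 \<Longrightarrow> c i j k = \<zero>\<^bsub>L\<^esub>"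
    using 1[of p] k0_sgn[of p] eq_minus_self[OF cl] by simp
  show "((i = 1) = (j = 1)) = (k \<noteq> 1) \<Longrightarrow> c i j k = \<zero>\<^bsub>L\<^esub>"
    using 1[of 1] k0_sgn1 eq_minus_self[OF cl] assms k0_closed by (simp add: tcoord_inv)
qed

text \<open>For j \<noteq> k the parities of \<open>c_sgn\<close> leave only one shape: an index 1
  in the wedge, and another index that occurs once in the wedge and once in the dual slot.\<close>

lemma c_zero:
  assumes "i < n" "j < n" "k < n" "\<not> (i \<noteq> 1 \<and> (j = i \<and> k = 1 \<or> j = 1 \<and> k = i))"
  shows "c i j k = \<zero>\<^bsub>L\<^esub>"
proof (cases "((i = 1) = (j = 1)) = (k \<noteq> 1)")
  case True
  then show ?thesis using c_sgn(2) assms by simp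
next
  case False
  show ?thesis
  proof (cases "j = k")
    case True
    then show ?thesis using tcoord_diag k0_closed assms by simp
  next
    case jk: False
    have "\<exists>p. p \<noteq> 1 \<and> ((i = p) = (j = p)) \<noteq> (k \<noteq> p)"
    proof (cases "j = 1")
      case True
      then show ?thesis using False assms(4) jk by (intro exI[of _ k]) auto
    next
      case j1: False
      then show ?thesis using False assms(4) jk by (intro exI[of _ j]) auto
    qed
    then show ?thesis using c_sgn(1) assms by blast
  qed
qed

lemma transpose_perm_coord:
  assumes "p < n" "q < n" "t \<in> carrier TL" "i < n" "j < n" "k < n"
  shows "tcoord i j k (act_VL F L (perm_aut (transpose p q)) t)
    = tcoord (transpose p q i) (transpose p q j) (transpose p q k) t"
  unfolding perm_aut_def using tcoord_signed_perm[OF transpose_bij[OF assms(1,2)] assms(4-6,3)] by simp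

lemma c_perm: "\<lbrakk>i < n; 2 \<le> i\<rbrakk> \<Longrightarrow> c i i 1 = c 2 2 1"
proof -
  assume i: "i < n" "2 \<le> i"
  have "k0 = act_VL F L (perm_aut (transpose 2 i)) k0"
    using i small_less by (intro f_K_perm transpose_bij) (auto simp: transpose_def)
  then have "c 2 2 1 = tcoord 2 2 1 (act_VL F L (perm_aut (transpose 2 i)) k0)" by simp
  also have "\<dots> = c i i 1"
    using i small_less k0_closed by (simp add: transpose_perm_coord)
  finally show ?thesis by simp
qed

text \<open>The transposition of 0 and \<open>i\<close> relates K to the conjugation of x_i, which
  moves the coordinate (0; 0, 1) to (i; i, 1), where f(K) has the coefficient b.\<close>

lemma f_K_coord: "\<lbrakk>i < n; 2 \<le> i\<rbrakk> \<Longrightarrow> tcoord 0 0 1 (f (pconj {i})) = c 2 2 1"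
proof -
  assume i: "i < n" "2 \<le> i"
  have "f (pconj {i}) = act_VL F L (perm_aut (transpose 0 i)) k0"
    using i small_less by (intro f_K_perm transpose_bij) (auto simp: transpose_def)
  then have "tcoord 0 0 1 (f (pconj {i})) = c i i 1"
    using i small_less k0_closed by (simp add: transpose_perm_coord)
  then show ?thesis using c_perm[OF i] by simp
qed

lemma f_pconj_coord: "2 + m \<le> n \<Longrightarrow> tcoord 0 0 1 (f (pconj {2..<2 + m})) = zmul (int m) (c 2 2 1)"
proof (induction m)
  case 0
  then show ?case using small_less by (simp add: pconj_empty f_one tcoord_one)
next
  case (Suc m)
  have i: "2 + m < n" using Suc.prems by simp
  have "{2..<2 + Suc m} = insert (2 + m) {2..<2 + m}" by auto
  then have "f (pconj {2..<2 + Suc m}) = f (pconj {2..<2 + m}) \<otimes>\<^bsub>TL\<^esub> f (pconj {2 + m})"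
    using pconj_insert[of "{2..<2 + m}" "2 + m"] f_mult[of "pconj {2..<2 + m}" "pconj {2 + m}"]
      act_pconj[of "{2..<2 + m}"] f_closed[of "pconj {2 + m}"] by (simp add: pconj_carrier)
  then have "tcoord 0 0 1 (f (pconj {2..<2 + Suc m})) = zmul (int m) (c 2 2 1) \<oplus>\<^bsub>L\<^esub> zmul 1 (c 2 2 1)"
    using Suc small_less f_K_coord[OF i] c_closed[of 2 2 1] by (simp add: tcoord_mult f_closed pconj_carrier zmul_one)
  also have "\<dots> = zmul (int (Suc m)) (c 2 2 1)"
    using zmul_add[of "c 2 2 1" "int m" 1] c_closed[of 2 2 1] small_less by (simp add: add.commute)
  finally show ?case .
qed

text \<open>Conjugation by x_1 is the product of K and the conjugations of the n - 2 generators with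
  index at least 2, each contributing b at (0; 0, 1). As \<open>c 0 0 1\<close> is a + b, this is
  the equation a = -(n-1)b.\<close>

lemma c_inner: "c 0 0 1 \<oplus>\<^bsub>L\<^esub> zmul (int n - 2) (c 2 2 1) = \<zero>\<^bsub>L\<^esub>"
proof -
  have nn: "2 + (n - 2) = n" using n5 by simp
  have "{..<n} - {1} = insert 0 {2..<n}" using n5 by auto
  then have "f (conj_aut F [(1, True)]) = f (pconj {2..<n}) \<otimes>\<^bsub>TL\<^esub> k0"
    using pconj_all pconj_insert[of "{2..<n}" 0] f_mult[of "pconj {2..<n}" "pconj {0}"]
      act_pconj[of "{2..<n}" k0] k0_closed by (simp add: pconj_carrier)
  then have "\<one>\<^bsub>TL\<^esub> = f (pconj {2..<n}) \<otimes>\<^bsub>TL\<^esub> k0" using f_conj[of "[(1, True)]"] small_less by simp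
  then have "\<zero>\<^bsub>L\<^esub> = tcoord 0 0 1 (f (pconj {2..<n}) \<otimes>\<^bsub>TL\<^esub> k0)" using tcoord_one[of 0 0 1] small_less by simp
  also have "\<dots> = zmul (int n - 2) (c 2 2 1) \<oplus>\<^bsub>L\<^esub> c 0 0 1"
    using f_pconj_coord[of "n - 2"] nn n5 small_less k0_closed by (simp add: tcoord_mult f_closed pconj_carrier of_nat_diff)
  finally show ?thesis
    using c_closed small_less zmul_closed[of "c 2 2 1" "int n - 2"] by (simp add: L.a_comm)
qed

abbreviation (input) "m \<equiv> f iota"

lemma m_closed: "m \<in> carrier TL"
  by (simp add: f_closed)

text \<open>Write U for the transvection. Since \<open>iota\<close> acts as -1, applying
  \<open>f\<close> to U\<iota>K = \<iota>U gives f(U) + Um - Uf(K) = m - f(U), which is solved for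
  2f(U).\<close>

lemma double_transvection:
  "f (transvection n) \<otimes>\<^bsub>TL\<^esub> f (transvection n)
    = m \<otimes>\<^bsub>TL\<^esub> inv\<^bsub>TL\<^esub> (act_VL F L (transvection n) m) \<otimes>\<^bsub>TL\<^esub> act_VL F L (transvection n) k0"
proof -
  let ?U = "transvection n"
  note U = transvection_carrier
  have c: "f ?U \<in> carrier TL" "act_VL F L ?U m \<in> carrier TL" "act_VL F L ?U k0 \<in> carrier TL" "m \<in> carrier TL"
    using f_closed act_VL_closed k0_closed m_closed U by auto
  have "f (?U \<otimes>\<^bsub>AF\<^esub> iota \<otimes>\<^bsub>AF\<^esub> pconj {0}) = f ?U \<otimes>\<^bsub>TL\<^esub> act_VL F L ?U m \<otimes>\<^bsub>TL\<^esub> inv\<^bsub>TL\<^esub> (act_VL F L ?U k0)"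
    using f_mult[of "?U \<otimes>\<^bsub>AF\<^esub> iota" "pconj {0}"] f_mult[of ?U iota] act_VL_mult[of ?U iota k0] U k0_closed
    by (simp add: act_iota act_inv)
  moreover have "f (iota \<otimes>\<^bsub>AF\<^esub> ?U) = m \<otimes>\<^bsub>TL\<^esub> inv\<^bsub>TL\<^esub> (f ?U)"
    using f_mult[of iota ?U] U c by (simp add: act_iota)
  ultimately have e: "f ?U \<otimes>\<^bsub>TL\<^esub> act_VL F L ?U m \<otimes>\<^bsub>TL\<^esub> inv\<^bsub>TL\<^esub> (act_VL F L ?U k0) = m \<otimes>\<^bsub>TL\<^esub> inv\<^bsub>TL\<^esub> (f ?U)"
    using rel_transvection_iota by simp
  have "f ?U \<otimes>\<^bsub>TL\<^esub> f ?U = (f ?U \<otimes>\<^bsub>TL\<^esub> act_VL F L ?U m \<otimes>\<^bsub>TL\<^esub> inv\<^bsub>TL\<^esub> (act_VL F L ?U k0))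
      \<otimes>\<^bsub>TL\<^esub> f ?U \<otimes>\<^bsub>TL\<^esub> inv\<^bsub>TL\<^esub> (act_VL F L ?U m) \<otimes>\<^bsub>TL\<^esub> act_VL F L ?U k0"
  proof -
    have "x \<otimes>\<^bsub>TL\<^esub> x = (x \<otimes>\<^bsub>TL\<^esub> y \<otimes>\<^bsub>TL\<^esub> inv\<^bsub>TL\<^esub> z) \<otimes>\<^bsub>TL\<^esub> x \<otimes>\<^bsub>TL\<^esub> inv\<^bsub>TL\<^esub> y \<otimes>\<^bsub>TL\<^esub> z"
      if "x \<in> carrier TL" "y \<in> carrier TL" "z \<in> carrier TL" for x y z
    proof -
      have "(x \<otimes>\<^bsub>TL\<^esub> y \<otimes>\<^bsub>TL\<^esub> inv\<^bsub>TL\<^esub> z) \<otimes>\<^bsub>TL\<^esub> x \<otimes>\<^bsub>TL\<^esub> inv\<^bsub>TL\<^esub> y \<otimes>\<^bsub>TL\<^esub> z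
          = x \<otimes>\<^bsub>TL\<^esub> x \<otimes>\<^bsub>TL\<^esub> (y \<otimes>\<^bsub>TL\<^esub> inv\<^bsub>TL\<^esub> y) \<otimes>\<^bsub>TL\<^esub> (inv\<^bsub>TL\<^esub> z \<otimes>\<^bsub>TL\<^esub> z)"
        using that by (simp only: TL.m_ac TL.m_closed TL.inv_closed)
      then show ?thesis using that by simp
    qed
    from this[OF c(1-3)] show ?thesis .
  qed
  also have "\<dots> = (m \<otimes>\<^bsub>TL\<^esub> inv\<^bsub>TL\<^esub> (f ?U)) \<otimes>\<^bsub>TL\<^esub> f ?U \<otimes>\<^bsub>TL\<^esub> inv\<^bsub>TL\<^esub> (act_VL F L ?U m) \<otimes>\<^bsub>TL\<^esub> act_VL F L ?U k0"
    by (simp only: e)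
  also have "\<dots> = m \<otimes>\<^bsub>TL\<^esub> inv\<^bsub>TL\<^esub> (act_VL F L ?U m) \<otimes>\<^bsub>TL\<^esub> act_VL F L ?U k0"
    using c by (simp add: TL.m_assoc)
  finally show ?thesis .
qed

text \<open>Signed permutations commute with \<open>iota\<close> exactly, so no term with K
  appears.\<close>

lemma double_signed_perm:
  fixes b :: "nat \<Rightarrow> bool"
  assumes p: "bij_betw \<pi> {..<n} {..<n}"
  defines "g \<equiv> signed_perm n \<pi> b"
  shows "f g \<otimes>\<^bsub>TL\<^esub> f g = m \<otimes>\<^bsub>TL\<^esub> inv\<^bsub>TL\<^esub> (act_VL F L g m)"
proof -
  have g: "g \<in> carrier AF" using signed_perm_carrier[OF p] by (simp add: g_def)
  have c: "f g \<in> carrier TL" "act_VL F L g m \<in> carrier TL" "m \<in> carrier TL"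
    using f_closed act_VL_closed m_closed g by auto
  have "f g \<otimes>\<^bsub>TL\<^esub> act_VL F L g m = m \<otimes>\<^bsub>TL\<^esub> inv\<^bsub>TL\<^esub> (f g)"
    using rel_perm_iota[OF p, of b] f_mult[of g iota] f_mult[of iota g] g c by (simp add: act_iota g_def)
  then have "f g \<otimes>\<^bsub>TL\<^esub> act_VL F L g m \<otimes>\<^bsub>TL\<^esub> inv\<^bsub>TL\<^esub> (act_VL F L g m) \<otimes>\<^bsub>TL\<^esub> f g
      = m \<otimes>\<^bsub>TL\<^esub> inv\<^bsub>TL\<^esub> (f g) \<otimes>\<^bsub>TL\<^esub> inv\<^bsub>TL\<^esub> (act_VL F L g m) \<otimes>\<^bsub>TL\<^esub> f g" by simp
  moreover have "m \<otimes>\<^bsub>TL\<^esub> inv\<^bsub>TL\<^esub> (f g) \<otimes>\<^bsub>TL\<^esub> inv\<^bsub>TL\<^esub> (act_VL F L g m) \<otimes>\<^bsub>TL\<^esub> f g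
      = m \<otimes>\<^bsub>TL\<^esub> inv\<^bsub>TL\<^esub> (act_VL F L g m) \<otimes>\<^bsub>TL\<^esub> (inv\<^bsub>TL\<^esub> (f g) \<otimes>\<^bsub>TL\<^esub> f g)"
    using c by (simp only: TL.m_ac TL.m_closed TL.inv_closed)
  ultimately show ?thesis using c by (simp add: TL.m_assoc)
qed

lemma is_double_cong:
  assumes "is_double (x \<ominus>\<^bsub>L\<^esub> y)" "x \<in> carrier L" "y \<in> carrier L"
  shows "is_double x \<longleftrightarrow> is_double y"
proof
  assume "is_double y"
  then have "is_double ((x \<ominus>\<^bsub>L\<^esub> y) \<oplus>\<^bsub>L\<^esub> y)" using is_double_add assms(1) by blast
  then show "is_double x" using assms by (simp add: L.minus_eq L.a_assoc L.l_neg)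
next
  assume "is_double x"
  then have "is_double (x \<oplus>\<^bsub>L\<^esub> \<ominus>\<^bsub>L\<^esub> (x \<ominus>\<^bsub>L\<^esub> y))" using is_double_add is_double_minus assms(1) by blast
  moreover have "x \<oplus>\<^bsub>L\<^esub> \<ominus>\<^bsub>L\<^esub> (x \<ominus>\<^bsub>L\<^esub> y) = y"
    using assms(2,3) by (simp add: L.minus_eq L.minus_add L.a_assoc[symmetric] L.r_neg)
  ultimately show "is_double y" by simp
qed

lemma is_double_trans:
  assumes "is_double (x \<ominus>\<^bsub>L\<^esub> y)" "is_double (y \<ominus>\<^bsub>L\<^esub> z)" "x \<in> carrier L" "y \<in> carrier L" "z \<in> carrier L"
  shows "is_double (x \<ominus>\<^bsub>L\<^esub> z)"
proof -
  have "(x \<ominus>\<^bsub>L\<^esub> y) \<oplus>\<^bsub>L\<^esub> (y \<ominus>\<^bsub>L\<^esub> z) = x \<oplus>\<^bsub>L\<^esub> (\<ominus>\<^bsub>L\<^esub> y \<oplus>\<^bsub>L\<^esub> y) \<oplus>\<^bsub>L\<^esub> \<ominus>\<^bsub>L\<^esub> z"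
    using assms(3-5) by (simp only: L.minus_eq L.a_assoc L.a_closed L.a_inv_closed)
  then have "(x \<ominus>\<^bsub>L\<^esub> y) \<oplus>\<^bsub>L\<^esub> (y \<ominus>\<^bsub>L\<^esub> z) = x \<ominus>\<^bsub>L\<^esub> z"
    using assms(3-5) by (simp add: L.l_neg L.minus_eq)
  then show ?thesis using is_double_add[OF assms(1,2)] by simp
qed

text \<open>With U the transvection, every coordinate of m - Um + Uf(K) is twice a coordinate of
  f(U). By \<open>c_zero\<close> little of f(K) remains, and the three coordinates of m are
  congruent modulo 2 to 0, to b and to a + b.\<close>

lemma is_double_transvection:
  shows "is_double (tcoord 1 2 3 m)" and "is_double (tcoord 2 0 2 m \<ominus>\<^bsub>L\<^esub> c 2 2 1)" and "is_double (c 0 0 1 \<ominus>\<^bsub>L\<^esub> tcoord 1 0 1 m)"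
proof -
  let ?U = "transvection n"
  note s = small_less and U = transvection_carrier
  have cl: "f ?U \<in> carrier TL" "act_VL F L ?U m \<in> carrier TL" "act_VL F L ?U k0 \<in> carrier TL" "m \<in> carrier TL"
    using f_closed act_VL_closed k0_closed m_closed U by auto
  have *: "is_double (tcoord i j k m \<oplus>\<^bsub>L\<^esub> \<ominus>\<^bsub>L\<^esub> tcoord i j k (act_VL F L ?U m) \<oplus>\<^bsub>L\<^esub> tcoord i j k (act_VL F L ?U k0))"
    if "i < n" for i j k
    using arg_cong[OF double_transvection, of "tcoord i j k"] that cl
      is_double_double[OF tcoord_closed[OF that cl(1)], of j k] by (simp add: tcoord_mult tcoord_inv)
  note tc = tcoord_closed[OF _ m_closed] c_closed
  have red: "x \<oplus>\<^bsub>L\<^esub> \<ominus>\<^bsub>L\<^esub> (x \<oplus>\<^bsub>L\<^esub> y) = \<ominus>\<^bsub>L\<^esub> y" if "x \<in> carrier L" "y \<in> carrier L" for x y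
    using that by (simp add: L.minus_add L.a_assoc[symmetric] L.r_neg)
  have "is_double (\<ominus>\<^bsub>L\<^esub> tcoord 1 2 3 m)"
    using *[of 0 2 3] s c_zero[of 0 2 3] c_zero[of 1 2 3]
    by (simp add: tcoord_transvection[OF m_closed] tcoord_transvection[OF k0_closed] red tc)
  from is_double_minus[OF this] show "is_double (tcoord 1 2 3 m)" using tc s by simp
  have "c 2 1 2 = \<ominus>\<^bsub>L\<^esub> c 2 2 1" by (rule tcoord_swap[OF _ k0_closed]) (rule s)
  then show "is_double (tcoord 2 0 2 m \<ominus>\<^bsub>L\<^esub> c 2 2 1)"
    using *[of 2 1 2] s c_zero[of 2 0 2] tc
    by (simp add: tcoord_transvection[OF m_closed] tcoord_transvection[OF k0_closed] red tc L.minus_eq)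
  have "is_double (\<ominus>\<^bsub>L\<^esub> tcoord 1 0 1 m \<oplus>\<^bsub>L\<^esub> c 0 0 1)"
    using *[of 0 0 1] s c_zero[of 1 0 1]
    by (simp add: tcoord_transvection[OF m_closed] tcoord_transvection[OF k0_closed] red tc)
  then show "is_double (c 0 0 1 \<ominus>\<^bsub>L\<^esub> tcoord 1 0 1 m)" using tc s by (simp add: L.minus_eq L.a_comm)
qed

text \<open>Twice the value of \<open>f\<close> at a transposition is m minus its transform; so
  modulo 2 the coordinates of m do not change when indices are interchanged.\<close>

lemma is_double_transpose:
  assumes "p < n" "q < n" "i < n" "j < n" "k < n"
  shows "is_double (tcoord i j k m \<ominus>\<^bsub>L\<^esub> tcoord (transpose p q i) (transpose p q j) (transpose p q k) m)"
proof -
  let ?g = "perm_aut (transpose p q)"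
  have g: "?g \<in> carrier AF" using transpose_bij[OF assms(1,2)] by simp
  have cl: "f ?g \<in> carrier TL" "act_VL F L ?g m \<in> carrier TL" using f_closed act_VL_closed m_closed g by auto
  have "f ?g \<otimes>\<^bsub>TL\<^esub> f ?g = m \<otimes>\<^bsub>TL\<^esub> inv\<^bsub>TL\<^esub> (act_VL F L ?g m)"
    unfolding perm_aut_def by (rule double_signed_perm[OF transpose_bij[OF assms(1,2)]])
  from arg_cong[OF this, of "tcoord i j k"] show ?thesis
    using assms cl m_closed is_double_double[OF tcoord_closed[OF assms(3) cl(1)], of j k]
    by (simp add: tcoord_mult tcoord_inv transpose_perm_coord L.minus_eq)
qed

text \<open>Interchanging 1 and 2 makes the coordinates (1; 0, 1) and (2; 0, 2) of m congruent, and
  these are congruent to \<open>c 0 0 1\<close> and to b. The difference is the coefficient a of the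
  overview.\<close>

lemma is_double_a_minus_b: "is_double (c 0 0 1 \<ominus>\<^bsub>L\<^esub> c 2 2 1)"
proof -
  note s = small_less and tc = tcoord_closed[OF _ m_closed] c_closed
  have "is_double (tcoord 1 0 1 m \<ominus>\<^bsub>L\<^esub> tcoord 2 0 2 m)"
    using is_double_transpose[of 1 2 1 0 1] s by (simp add: transpose_def)
  then show ?thesis
    using is_double_trans[OF is_double_transvection(3)] is_double_trans[OF _ is_double_transvection(2)] tc s by blast
qed

lemma zmul_even: "x \<in> carrier L \<Longrightarrow> even k \<Longrightarrow> is_double (zmul k x)"
proof -
  assume x: "x \<in> carrier L" and "even k"
  then obtain l where "k = l + l" by (metis evenE mult_2)
  then show ?thesis using zmul_add[of x l l] x zmul_closed[of x l] by (simp add: is_double_double)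
qed

text \<open>For even n the factor n - 2 in \<open>c_inner\<close> makes \<open>c 0 0 1\<close> even,
  and b is congruent to it.\<close>

lemma is_double_b:
  assumes "even n" shows "is_double (c 2 2 1)"
proof -
  note s = small_less
  have "is_double (zmul (int n - 2) (c 2 2 1))" using assms c_closed s by (intro zmul_even) auto
  then have "is_double (c 0 0 1)"
    using c_inner is_double_cancel[of "c 0 0 1" "zmul (int n - 2) (c 2 2 1)"] is_double_zero c_closed[of 0 0 1] s by simp
  then show ?thesis using is_double_cong[OF is_double_a_minus_b] c_closed s by simp
qed

section \<open>Crossed homomorphisms with b = 0 are principal\<close>

context
  assumes b0: "c 2 2 1 = \<zero>\<^bsub>L\<^esub>"
begin

lemma a0: "c 0 0 1 = \<zero>\<^bsub>L\<^esub>"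
  using c_inner b0 c_closed[of 0 0 1] small_less comm_group.axioms(2)[OF LA_comm] group.int_pow_one[OF LA_group, of "int n - 2"] by simp

lemma k0_one: "k0 = \<one>\<^bsub>TL\<^esub>"
proof (rule TL_eqI[OF k0_closed])
  fix i j k assume i: "i < n" "j < k" "k < n"
  have d: "c l l 1 = \<zero>\<^bsub>L\<^esub>" if "l < n" "l \<noteq> 1" for l
    using a0 b0 c_perm[of l] that by (cases "l = 0") auto
  have "c i j k = \<zero>\<^bsub>L\<^esub>"
  proof (cases "i \<noteq> 1 \<and> (j = i \<and> k = 1 \<or> j = 1 \<and> k = i)")
    case True
    then show ?thesis using d[of i] tcoord_swap[OF i(1) k0_closed, where k=1 and j=i] i by auto
  next
    case False
    then show ?thesis using c_zero i by simp
  qed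
  then show "c i j k = tcoord i j k \<one>\<^bsub>TL\<^esub>" using i by (simp add: tcoord_one)
qed simp

lemma is_double_m_transpose:
  assumes "p < n" "q < n" "i < n" "j < n" "k < n"
  shows "is_double (tcoord i j k m) \<longleftrightarrow> is_double (tcoord (transpose p q i) (transpose p q j) (transpose p q k) m)"
  using is_double_cong[OF is_double_transpose[OF assms]] tcoord_closed[OF _ m_closed] assms by (simp add: transpose_def)

text \<open>Three transpositions carry the indices to (1; 2, 3), one slot at a time;
  \<open>j'\<close>, \<open>k'\<close> and \<open>k''\<close> record where the remaining indices
  have gone.\<close>

lemma is_double_m_distinct:
  assumes i: "i < n" "j < n" "k < n" "i \<noteq> j" "i \<noteq> k" "j \<noteq> k"
  shows "is_double (tcoord i j k m)"
proof -
  note s = small_less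
  have lt: "transpose p q x < n" if "p < n" "q < n" "x < n" for p q x using that by (simp add: transpose_def)
  have inj: "transpose p q x \<noteq> transpose p q y" if "x \<noteq> y" for p q x y :: nat using that by (metis transpose_involutory)
  define j' k' where "j' = transpose 1 i j" and "k' = transpose 1 i k"
  have 1: "j' < n" "k' < n" "j' \<noteq> 1" "k' \<noteq> 1" "j' \<noteq> k'"
    using i s lt inj[of j i 1 i] inj[of k i 1 i] inj[of j k 1 i] by (auto simp: j'_def k'_def)
  define k'' where "k'' = transpose 2 j' k'"
  have 2: "k'' < n" "k'' \<noteq> 2" "k'' \<noteq> 1" "transpose 2 j' 1 = 1"
    using 1 s lt inj[of k' j' 2 j'] inj[of k' 1 2 j'] by (auto simp: k''_def)
  have "is_double (tcoord i j k m) \<longleftrightarrow> is_double (tcoord 1 j' k' m)"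
    using is_double_m_transpose[of 1 i i j k] i s by (simp add: j'_def k'_def)
  also have "\<dots> \<longleftrightarrow> is_double (tcoord 1 2 k'' m)"
    using is_double_m_transpose[of 2 j' 1 j' k'] 1 2 s by (simp add: k''_def)
  also have "\<dots> \<longleftrightarrow> is_double (tcoord 1 2 3 m)"
    using is_double_m_transpose[of 3 k'' 1 2 k''] 1 2 s by simp
  finally show ?thesis using is_double_transvection(1) by simp
qed

text \<open>Two transpositions lead to (1; 1, 0), the negative of the coordinate (1; 0, 1), which is
  congruent to \<open>c 0 0 1\<close> and hence to zero here.\<close>

lemma is_double_m_pair:
  assumes i: "i < n" "k < n" "i \<noteq> k"
  shows "is_double (tcoord i i k m)"
proof -
  note s = small_less
  define k' where "k' = transpose 1 i k"
  have 1: "k' < n" "k' \<noteq> 1" using i s by (auto simp: k'_def transpose_def)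
  have "is_double (tcoord i i k m) \<longleftrightarrow> is_double (tcoord 1 1 k' m)"
    using is_double_m_transpose[of 1 i i i k] i s by (simp add: k'_def)
  also have "\<dots> \<longleftrightarrow> is_double (tcoord 1 1 0 m)"
    using is_double_m_transpose[of 0 k' 1 1 k'] 1 s by simp
  finally have e: "is_double (tcoord i i k m) \<longleftrightarrow> is_double (tcoord 1 1 0 m)" .
  have "is_double (tcoord 1 0 1 m)"
    using is_double_minus[OF is_double_transvection(3)] a0 tcoord_closed[OF _ m_closed, of 1 0 1] s
    by (simp add: L.minus_eq)
  then show ?thesis using e tcoord_swap[OF _ m_closed, where i=1 and k=1 and j=0] s is_double_minus by simp
qed

lemma is_double_m: "\<lbrakk>i < n; j < n; k < n\<rbrakk> \<Longrightarrow> is_double (tcoord i j k m)"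
proof -
  assume i: "i < n" "j < n" "k < n"
  consider "j = k" | "i = j" "j \<noteq> k" | "i = k" "j \<noteq> k" | "i \<noteq> j" "i \<noteq> k" "j \<noteq> k" by blast
  then show ?thesis
  proof cases
    case 1 then show ?thesis using i by (simp add: tcoord_diag m_closed is_double_zero)
  next
    case 2 then show ?thesis using i is_double_m_pair by simp
  next
    case 3 then show ?thesis
      using i is_double_minus[OF is_double_m_pair[of i j]] tcoord_swap[OF i(1) m_closed, where k=j and j=i] by simp
  next
    case 4 then show ?thesis using i is_double_m_distinct by simp
  qed
qed

lemma TL_double_inj:
  assumes "t \<in> carrier TL" "u \<in> carrier TL" "t \<otimes>\<^bsub>TL\<^esub> t = u \<otimes>\<^bsub>TL\<^esub> u"
  shows "t = u"
proof (rule TL_eqI[OF assms(1,2)])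
  fix i j k assume i: "i < n" "j < k" "k < n"
  show "tcoord i j k t = tcoord i j k u"
  proof (rule double_inj)
    show "tcoord i j k t \<oplus>\<^bsub>L\<^esub> tcoord i j k t = tcoord i j k u \<oplus>\<^bsub>L\<^esub> tcoord i j k u"
      using arg_cong[OF assms(3), of "tcoord i j k"] i assms(1,2) by (simp add: tcoord_mult)
  qed (use i assms(1,2) tcoord_closed in auto)
qed

text \<open>Halving m = 2u gives 2f(\<sigma>) = 2(u - \<sigma>u) on Nielsen generators, and doubling
  is injective on V_L. Both f(\<sigma>) and u - \<sigma>u obey the crossed product rule, so the
  equality spreads to the whole group.\<close>

lemma crossed_principal:
  obtains t where "t \<in> carrier TL" "\<And>\<sigma>. \<sigma> \<in> carrier AF \<Longrightarrow> f \<sigma> = act_VL F L \<sigma> t \<otimes>\<^bsub>TL\<^esub> inv\<^bsub>TL\<^esub> t"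
proof -
  have "\<exists>y. \<forall>i j k. i < n \<longrightarrow> j < n \<longrightarrow> k < n \<longrightarrow> y i j k \<in> carrier L \<and> tcoord i j k m = y i j k \<oplus>\<^bsub>L\<^esub> y i j k"
    using is_double_m unfolding is_double_def by metis
  then obtain y where y: "\<And>i j k. \<lbrakk>i < n; j < n; k < n\<rbrakk> \<Longrightarrow> y i j k \<in> carrier L \<and> tcoord i j k m = y i j k \<oplus>\<^bsub>L\<^esub> y i j k"
    by blast
  obtain u where u: "u \<in> carrier TL" "\<And>i j k. \<lbrakk>i < n; j < k; k < n\<rbrakk> \<Longrightarrow> tcoord i j k u = y i j k"
    by (rule TL_exists[of y]) (use y in auto)
  have mu: "m = u \<otimes>\<^bsub>TL\<^esub> u"
    by (rule TL_eqI) (use m_closed u y in \<open>auto simp: tcoord_mult\<close>)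
  have gen: "f \<sigma> = u \<otimes>\<^bsub>TL\<^esub> inv\<^bsub>TL\<^esub> (act_VL F L \<sigma> u)"
    if \<sigma>: "\<sigma> \<in> carrier AF" and d: "f \<sigma> \<otimes>\<^bsub>TL\<^esub> f \<sigma> = m \<otimes>\<^bsub>TL\<^esub> inv\<^bsub>TL\<^esub> (act_VL F L \<sigma> m)" for \<sigma>
  proof (rule TL_double_inj)
    have c: "u \<in> carrier TL" "act_VL F L \<sigma> u \<in> carrier TL" using u act_VL_closed \<sigma> by auto
    then show "u \<otimes>\<^bsub>TL\<^esub> inv\<^bsub>TL\<^esub> (act_VL F L \<sigma> u) \<in> carrier TL" by simp
    have "f \<sigma> \<otimes>\<^bsub>TL\<^esub> f \<sigma> = (u \<otimes>\<^bsub>TL\<^esub> u) \<otimes>\<^bsub>TL\<^esub> inv\<^bsub>TL\<^esub> (act_VL F L \<sigma> u \<otimes>\<^bsub>TL\<^esub> act_VL F L \<sigma> u)"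
      unfolding d mu act_TL_mult[OF \<sigma> u(1) u(1)] ..
    then show "f \<sigma> \<otimes>\<^bsub>TL\<^esub> f \<sigma> = u \<otimes>\<^bsub>TL\<^esub> inv\<^bsub>TL\<^esub> (act_VL F L \<sigma> u) \<otimes>\<^bsub>TL\<^esub> (u \<otimes>\<^bsub>TL\<^esub> inv\<^bsub>TL\<^esub> (act_VL F L \<sigma> u))"
      using c by (simp add: TL.inv_mult TL.m_ac)
  qed (use f_closed \<sigma> in simp)
  have ng: "f \<sigma> = u \<otimes>\<^bsub>TL\<^esub> inv\<^bsub>TL\<^esub> (act_VL F L \<sigma> u)" if "\<sigma> \<in> nielsen_gens n" for \<sigma>
  proof (rule gen)
    show "\<sigma> \<in> carrier AF" using that nielsen_gens_carrier by auto
    have k: "act_VL F L (transvection n) k0 = \<one>\<^bsub>TL\<^esub>"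
      using k0_one hom_one[OF act_VL_hom[OF transvection_carrier] TL.is_group TL.is_group] by simp
    show "f \<sigma> \<otimes>\<^bsub>TL\<^esub> f \<sigma> = m \<otimes>\<^bsub>TL\<^esub> inv\<^bsub>TL\<^esub> (act_VL F L \<sigma> m)"
      using that double_transvection double_signed_perm k m_closed act_VL_closed[OF transvection_carrier m_closed]
      by (auto simp: nielsen_gens_def)
  qed
  have all: "f \<sigma> = u \<otimes>\<^bsub>TL\<^esub> inv\<^bsub>TL\<^esub> (act_VL F L \<sigma> u)" if "\<sigma> \<in> generate AF (nielsen_gens n)" for \<sigma>
    using that
  proof (induction rule: generate.induct)
    case one
    then show ?case using f_one act_one u by simp
  next
    case (incl h)
    then show ?case by (rule ng)
  next
    \<comment> \<open>The value at the inverse is solved from 0 = f(h^-1) + h^-1 f(h).\<close>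
    case (inv h)
    have h: "h \<in> carrier AF" "inv\<^bsub>AF\<^esub> h \<in> carrier AF" using inv nielsen_gens_carrier by auto
    have c: "act_VL F L h u \<in> carrier TL" "act_VL F L (inv\<^bsub>AF\<^esub> h) u \<in> carrier TL" "f (inv\<^bsub>AF\<^esub> h) \<in> carrier TL"
      using h u act_VL_closed f_closed by auto
    have "\<one>\<^bsub>TL\<^esub> = f (inv\<^bsub>AF\<^esub> h) \<otimes>\<^bsub>TL\<^esub> act_VL F L (inv\<^bsub>AF\<^esub> h) (f h)"
      using f_mult[OF h(2,1)] h f_one by simp
    also have "act_VL F L (inv\<^bsub>AF\<^esub> h) (f h) = act_VL F L (inv\<^bsub>AF\<^esub> h) u \<otimes>\<^bsub>TL\<^esub> inv\<^bsub>TL\<^esub> u"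
      using ng[OF inv] h c u act_VL_mult[OF h(2,1) u(1)] by (simp add: act_TL_mult act_inv act_one)
    finally have "f (inv\<^bsub>AF\<^esub> h) = inv\<^bsub>TL\<^esub> (act_VL F L (inv\<^bsub>AF\<^esub> h) u \<otimes>\<^bsub>TL\<^esub> inv\<^bsub>TL\<^esub> u)"
      using c u by (intro TL.inv_equality[symmetric]) auto
    then show ?case using c u by (simp add: TL.inv_mult TL.m_comm)
  next
    case (eng g h)
    have gh: "g \<in> carrier AF" "h \<in> carrier AF" using eng.hyps NG_subgroup subgroup.mem_carrier by fastforce+
    have c: "act_VL F L g u \<in> carrier TL" "act_VL F L h u \<in> carrier TL" "act_VL F L g (act_VL F L h u) \<in> carrier TL"
      using gh u act_VL_closed by auto
    have "f (g \<otimes>\<^bsub>AF\<^esub> h) = u \<otimes>\<^bsub>TL\<^esub> (inv\<^bsub>TL\<^esub> (act_VL F L g u) \<otimes>\<^bsub>TL\<^esub> act_VL F L g u) \<otimes>\<^bsub>TL\<^esub> inv\<^bsub>TL\<^esub> (act_VL F L g (act_VL F L h u))"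
      unfolding f_mult[OF gh] eng.IH using gh u c by (simp add: act_TL_mult act_inv TL.m_assoc cancel_inv[OF TL.is_group])
    then show ?case using gh u c by (simp add: act_VL_mult)
  qed
  show thesis
  \<comment> \<open>Principal crossed homomorphisms are normalised as \<sigma>t - t, so t =
    -u.\<close>
  proof (rule that[of "inv\<^bsub>TL\<^esub> u"])
    fix \<sigma> assume \<sigma>: "\<sigma> \<in> carrier AF"
    then have "act_VL F L \<sigma> u \<in> carrier TL" using act_VL_closed u by simp
    then show "f \<sigma> = act_VL F L \<sigma> (inv\<^bsub>TL\<^esub> u) \<otimes>\<^bsub>TL\<^esub> inv\<^bsub>TL\<^esub> (inv\<^bsub>TL\<^esub> u)"
      using all[of \<sigma>] \<sigma> u nielsen_generation by (simp add: act_inv TL.m_comm)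
  qed (use u in simp)
qed

end

end

end

section \<open>The Johnson-Morita crossed homomorphism\<close>

context free_rank
begin

text \<open>The action on H \<otimes> H for bare coordinate arrays; \<open>ract\<close> adds the
  dual slot. On the coordinates of an element of V the result is the formula of
  \<open>vcoord_act\<close>.\<close>

definition eact :: "((nat \<times> bool) list \<Rightarrow> (nat \<times> bool) list) \<Rightarrow> (nat \<Rightarrow> nat \<Rightarrow> int) \<Rightarrow> nat \<Rightarrow> nat \<Rightarrow> int" where
  "eact \<sigma> P j k = (\<Sum>q<n. \<Sum>r<n. imat \<sigma> q j * imat \<sigma> r k * P q r)"

text \<open>The coordinates of \<open>\<sigma> \<cdot> \<lambda>(x\<^sup>\<sigma>) - \<lambda>(x)\<close> at the generators \<open>x\<close>, where \<open>\<lambda>\<close> vanishes.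
  On \<open>IA\<close>-automorphisms this is twice the Johnson homomorphism.\<close>

definition johnson :: "((nat \<times> bool) list \<Rightarrow> (nat \<times> bool) list) \<Rightarrow> nat \<Rightarrow> nat \<Rightarrow> nat \<Rightarrow> int" where
  "johnson \<sigma> i = eact \<sigma> (\<lambda>q r. lam q r (\<sigma> [(i, True)]))"

lemma eact_add: "eact \<sigma> (\<lambda>q r. P q r + Q q r) j k = eact \<sigma> P j k + eact \<sigma> Q j k"
  by (simp add: eact_def distrib_left sum.distrib)

lemma eact_diff: "eact \<sigma> (\<lambda>q r. P q r - Q q r) j k = eact \<sigma> P j k - eact \<sigma> Q j k"
  by (simp add: eact_def right_diff_distrib sum_subtractf)

lemma eact_sum: "eact \<sigma> (\<lambda>q r. \<Sum>p<n. a p * P p q r) j k = (\<Sum>p<n. a p * eact \<sigma> (P p) j k)"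
proof -
  have "eact \<sigma> (\<lambda>q r. \<Sum>p<n. a p * P p q r) j k
      = (\<Sum>q<n. \<Sum>r<n. \<Sum>p<n. a p * (imat \<sigma> q j * imat \<sigma> r k * P p q r))"
    unfolding eact_def sum_distrib_left by (intro sum.cong refl) simp
  also have "\<dots> = (\<Sum>q<n. \<Sum>p<n. \<Sum>r<n. a p * (imat \<sigma> q j * imat \<sigma> r k * P p q r))"
    by (rule sum.cong[OF refl], rule sum.swap)
  also have "\<dots> = (\<Sum>p<n. \<Sum>q<n. \<Sum>r<n. a p * (imat \<sigma> q j * imat \<sigma> r k * P p q r))"
    by (rule sum.swap)
  finally show ?thesis by (simp add: eact_def sum_distrib_left)
qed

lemma eact_product: "eact \<sigma> (\<lambda>q r. a q * b r) j k = (\<Sum>q<n. a q * imat \<sigma> q j) * (\<Sum>r<n. b r * imat \<sigma> r k)"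
  unfolding eact_def sum_product by (intro sum.cong refl) simp

lemma eact_cong: "(\<And>q r. q < n \<Longrightarrow> r < n \<Longrightarrow> P q r = Q q r) \<Longrightarrow> eact \<sigma> P = eact \<sigma> Q"
  by (auto simp: eact_def fun_eq_iff)

lemma eact_mult:
  assumes "\<sigma> \<in> carrier AF" "\<tau> \<in> carrier AF"
  shows "eact (\<sigma> \<otimes>\<^bsub>AF\<^esub> \<tau>) P j k = eact \<sigma> (eact \<tau> P) j k"
proof -
  let ?t = "\<lambda>q r s t. (imat \<sigma> s j * imat \<sigma> t k) * (imat \<tau> q s * imat \<tau> r t * P q r)"
  have e: "imat (\<sigma> \<otimes>\<^bsub>AF\<^esub> \<tau>) q j * imat (\<sigma> \<otimes>\<^bsub>AF\<^esub> \<tau>) r k * P q r = (\<Sum>s<n. \<Sum>t<n. ?t q r s t)"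
    if "q < n" "r < n" for q r
    unfolding imat_mult[OF assms that(1)] imat_mult[OF assms that(2)]
    unfolding sum_product unfolding sum_distrib_right
    by (intro sum.cong refl) simp
  have "eact (\<sigma> \<otimes>\<^bsub>AF\<^esub> \<tau>) P j k = (\<Sum>q<n. \<Sum>r<n. \<Sum>s<n. \<Sum>t<n. ?t q r s t)"
    unfolding eact_def by (rule sum.cong[OF refl], rule sum.cong[OF refl], rule e) auto
  also have "\<dots> = (\<Sum>q<n. \<Sum>s<n. \<Sum>r<n. \<Sum>t<n. ?t q r s t)"
    by (rule sum.cong[OF refl], rule sum.swap)
  also have "\<dots> = (\<Sum>q<n. \<Sum>s<n. \<Sum>t<n. \<Sum>r<n. ?t q r s t)"
    by (rule sum.cong[OF refl], rule sum.cong[OF refl], rule sum.swap)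
  also have "\<dots> = (\<Sum>s<n. \<Sum>q<n. \<Sum>t<n. \<Sum>r<n. ?t q r s t)"
    by (rule sum.swap)
  also have "\<dots> = (\<Sum>s<n. \<Sum>t<n. \<Sum>q<n. \<Sum>r<n. ?t q r s t)"
    by (rule sum.cong[OF refl], rule sum.swap)
  finally show ?thesis by (simp add: eact_def sum_distrib_left)
qed

lemma expn_imat:
  assumes "\<sigma> \<in> carrier AF" "w \<in> carrier F"
  shows "(\<Sum>q<n. expn q (\<sigma> w) * imat \<sigma> q j) = expn j w"
  using expn_aut[OF A.inv_closed[OF assms(1)] right_AutD(2)[OF assms], of j] right_Aut_inv(1)[OF F.is_group assms]
  by (simp add: imat_def)

text \<open>The defect of additivity of \<lambda> is [x] \<and> [y], and the action of \<sigma>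
  turns the class of the image of x back into [x]. The defects therefore cancel in the difference
  with \<open>lam j k w\<close>, which is additive in \<open>w\<close> and determined at
  generators.\<close>

lemma eact_lam:
  assumes s: "\<sigma> \<in> carrier AF" and w: "w \<in> carrier F"
  shows "eact \<sigma> (\<lambda>q r. lam q r (\<sigma> w)) j k = lam j k w + (\<Sum>p<n. expn p w * johnson \<sigma> p j k)"
proof -
  let ?u = "\<lambda>w. eact \<sigma> (\<lambda>q r. lam q r (\<sigma> w)) j k - lam j k w"
  have "?u w = (\<Sum>p<n. expn p w * ?u [(p, True)])"
  proof (rule additive_expand[OF _ w])
    fix x y assume x: "x \<in> carrier F" and y: "y \<in> carrier F"
    have "eact \<sigma> (\<lambda>q r. lam q r (\<sigma> (x \<otimes>\<^bsub>F\<^esub> y))) j k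
        = eact \<sigma> (\<lambda>q r. ((lam q r (\<sigma> x) + lam q r (\<sigma> y)) + expn q (\<sigma> x) * expn r (\<sigma> y)) - expn q (\<sigma> y) * expn r (\<sigma> x)) j k"
      using s x y by (intro eact_cong[THEN fun_cong, THEN fun_cong]) (simp add: aut_mult lam_mult right_AutD(2))
    also have "\<dots> = eact \<sigma> (\<lambda>q r. lam q r (\<sigma> x)) j k + eact \<sigma> (\<lambda>q r. lam q r (\<sigma> y)) j k
        + expn j x * expn k y - expn j y * expn k x"
      using s x y by (simp only: eact_diff eact_add eact_product expn_imat)
    finally show "?u (x \<otimes>\<^bsub>F\<^esub> y) = ?u x + ?u y" using x y by (simp add: lam_mult)
  qed
  also have "\<dots> = (\<Sum>p<n. expn p w * johnson \<sigma> p j k)"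
    by (intro sum.cong refl) (simp add: johnson_def lam_letter)
  finally show ?thesis by simp
qed

definition ract :: "((nat \<times> bool) list \<Rightarrow> (nat \<times> bool) list) \<Rightarrow> (nat \<Rightarrow> nat \<Rightarrow> nat \<Rightarrow> int) \<Rightarrow> nat \<Rightarrow> nat \<Rightarrow> nat \<Rightarrow> int" where
  "ract \<sigma> v i j k = (\<Sum>p<n. mat \<sigma> i p * eact \<sigma> (v p) j k)"

text \<open>Here \<open>eact_lam\<close> for \<open>\<tau>\<close> is applied to the word that is
  the image of x_i under \<open>\<sigma>\<close>; on such a word \<lambda> need not vanish, and its
  value supplies the first summand.\<close>

lemma johnson_mult:
  assumes s: "\<sigma> \<in> carrier AF" and t: "\<tau> \<in> carrier AF" and i: "i < n"
  shows "johnson (\<sigma> \<otimes>\<^bsub>AF\<^esub> \<tau>) i j k = johnson \<sigma> i j k + ract \<sigma> (johnson \<tau>) i j k"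
proof -
  have x: "\<sigma> [(i, True)] \<in> carrier F" using right_AutD(2)[OF s] i by simp
  have "johnson (\<sigma> \<otimes>\<^bsub>AF\<^esub> \<tau>) i j k = eact \<sigma> (eact \<tau> (\<lambda>q r. lam q r (\<tau> (\<sigma> [(i, True)])))) j k"
    using s t i by (simp add: johnson_def eact_mult right_Aut_mult)
  also have "\<dots> = eact \<sigma> (\<lambda>q r. lam q r (\<sigma> [(i, True)]) + (\<Sum>p<n. expn p (\<sigma> [(i, True)]) * johnson \<tau> p q r)) j k"
    using eact_lam[OF t x] by (simp add: fun_eq_iff eact_def)
  also have "\<dots> = johnson \<sigma> i j k + ract \<sigma> (johnson \<tau>) i j k"
    by (simp add: eact_add eact_sum johnson_def ract_def mat_def)
  finally show ?thesis .
qed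

lemma johnson_swap:
  assumes s: "\<sigma> \<in> carrier AF" and i: "i < n"
  shows "johnson \<sigma> i k j = - johnson \<sigma> i j k"
proof -
  have x: "\<sigma> [(i, True)] \<in> carrier F" using right_AutD(2)[OF s] i by simp
  have "johnson \<sigma> i k j = (\<Sum>q<n. \<Sum>r<n. - (imat \<sigma> r j * imat \<sigma> q k * lam r q (\<sigma> [(i, True)])))"
    unfolding johnson_def eact_def by (intro sum.cong refl) (subst lam_swap[OF x], simp)
  also have "\<dots> = (\<Sum>r<n. \<Sum>q<n. - (imat \<sigma> r j * imat \<sigma> q k * lam r q (\<sigma> [(i, True)])))"
    by (rule sum.swap)
  also have "\<dots> = - johnson \<sigma> i j k"
    by (simp add: johnson_def eact_def sum_negf)
  finally show ?thesis .
qed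

text \<open>The contraction of the crossed homomorphism, changed by the coboundary of the sum of the basis
  vectors, so that it becomes even.\<close>

definition contracted :: "((nat \<times> bool) list \<Rightarrow> (nat \<times> bool) list) \<Rightarrow> nat \<Rightarrow> int" where
  "contracted \<sigma> k = (\<Sum>i<n. johnson \<sigma> i i k) - ((\<Sum>r<n. imat \<sigma> r k) - 1)"

lemma eact_nested: "eact \<sigma> P j k = (\<Sum>q<n. imat \<sigma> q j * (\<Sum>r<n. imat \<sigma> r k * P q r))"
  by (simp add: eact_def sum_distrib_left mult.assoc)

text \<open>Contraction is equivariant: in the two contracted slots \<open>mat\<close> and
  \<open>imat\<close> multiply to the identity.\<close>

lemma contract_ract:
  assumes s: "\<sigma> \<in> carrier AF"
  shows "(\<Sum>i<n. ract \<sigma> v i i k) = (\<Sum>r<n. imat \<sigma> r k * (\<Sum>p<n. v p p r))"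
proof -
  define R where "R = (\<lambda>p q. \<Sum>r<n. imat \<sigma> r k * v p q r)"
  have R: "(\<Sum>r<n. imat \<sigma> r k * v p q r) = R p q" for p q by (simp add: R_def)
  have "(\<Sum>i<n. ract \<sigma> v i i k) = (\<Sum>i<n. \<Sum>p<n. \<Sum>q<n. (imat \<sigma> q i * mat \<sigma> i p) * R p q)"
    unfolding ract_def eact_nested R sum_distrib_left by (intro sum.cong refl) simp
  also have "\<dots> = (\<Sum>p<n. \<Sum>i<n. \<Sum>q<n. (imat \<sigma> q i * mat \<sigma> i p) * R p q)"
    by (rule sum.swap)
  also have "\<dots> = (\<Sum>p<n. \<Sum>q<n. \<Sum>i<n. (imat \<sigma> q i * mat \<sigma> i p) * R p q)"
    by (rule sum.cong[OF refl], rule sum.swap)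
  also have "\<dots> = (\<Sum>p<n. \<Sum>q<n. (if q = p then 1 else 0) * R p q)"
    using s by (intro sum.cong refl) (simp only: sum_distrib_right[symmetric] mat_imat(2) lessThan_iff)
  also have "\<dots> = (\<Sum>p<n. R p p)"
    by (intro sum.cong refl) (simp add: sum_row1[of _ n "\<lambda>q. if q = _ then 1 else 0" 1])
  also have "\<dots> = (\<Sum>r<n. imat \<sigma> r k * (\<Sum>p<n. v p p r))"
    unfolding R_def sum_distrib_left by (rule sum.swap)
  finally show ?thesis .
qed

lemma contracted_mult:
  assumes s: "\<sigma> \<in> carrier AF" and t: "\<tau> \<in> carrier AF"
  shows "contracted (\<sigma> \<otimes>\<^bsub>AF\<^esub> \<tau>) k = contracted \<sigma> k + (\<Sum>r<n. imat \<sigma> r k * contracted \<tau> r)"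
proof -
  have 1: "(\<Sum>i<n. johnson (\<sigma> \<otimes>\<^bsub>AF\<^esub> \<tau>) i i k) = (\<Sum>i<n. johnson \<sigma> i i k) + (\<Sum>r<n. imat \<sigma> r k * (\<Sum>p<n. johnson \<tau> p p r))"
    using s t by (simp add: johnson_mult sum.distrib contract_ract)
  have "(\<Sum>r<n. imat (\<sigma> \<otimes>\<^bsub>AF\<^esub> \<tau>) r k) = (\<Sum>r<n. \<Sum>j<n. imat \<tau> r j * imat \<sigma> j k)"
    using s t by (intro sum.cong refl) (simp add: imat_mult)
  also have "\<dots> = (\<Sum>j<n. imat \<sigma> j k * (\<Sum>r<n. imat \<tau> r j))"
    unfolding sum_distrib_left by (subst sum.swap) (simp add: mult.commute)
  finally have 2: "(\<Sum>r<n. imat (\<sigma> \<otimes>\<^bsub>AF\<^esub> \<tau>) r k) = (\<Sum>j<n. imat \<sigma> j k * (\<Sum>r<n. imat \<tau> r j))" .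
  show ?thesis
    unfolding contracted_def 1 2 by (simp add: algebra_simps sum.distrib sum_subtractf)
qed

lemma contracted_one: "contracted \<one>\<^bsub>AF\<^esub> k = 0" if "k < n"
proof -
  have "imat \<one>\<^bsub>AF\<^esub> r k = (if r = k then 1 else 0)" if "r < n" for r
    using that by (simp add: imat_def mat_one)
  then have "(\<Sum>r<n. imat \<one>\<^bsub>AF\<^esub> r k * contracted \<one>\<^bsub>AF\<^esub> r) = 1 * contracted \<one>\<^bsub>AF\<^esub> k"
    using that by (intro sum_row1) auto
  then show ?thesis using contracted_mult[OF A.one_closed A.one_closed, of k] by simp
qed

text \<open>For a signed permutation \<open>johnson\<close> vanishes and the column sum is 1 or -1,
  giving 0 or -2. For the transvection the bare contraction is 1 at k = 1, which is odd; there the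
  column sum is 0 and the correction raises the value to 2. At the other indices the total is
  0.\<close>

lemma contracted_even_gens:
  assumes "\<sigma> \<in> nielsen_gens n" "k < n"
  shows "even (contracted \<sigma> k)"
  using assms(1) unfolding nielsen_gens_def
proof (elim insertE CollectE exE conjE)
  fix \<pi> b assume s: "\<sigma> = signed_perm n \<pi> b" and p: "bij_betw \<pi> {..<n} {..<n}"
  have l: "\<pi> i < n" if "i < n" for i using bij_betwE[OF p] that by auto
  have "johnson \<sigma> i i k = 0" if "i < n" for i
    using that l by (simp add: s johnson_def eact_def signed_perm_letter[OF p] lam_letter)
  moreover have "(\<Sum>r<n. imat \<sigma> r k * 1) = sg (b k) * 1"
    by (rule sum_row1[of "\<pi> k"]) (use assms(2) l in \<open>auto simp: s imat_signed_perm[OF p]\<close>)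
  ultimately show ?thesis by (simp add: contracted_def sg_def)
next
  assume s: "\<sigma> = transvection n"
  note o = one_less
  \<comment> \<open>\<lambda>(x_0 x_1) is [x_0] \<and> [x_1]; the other generators are fixed and
    contribute nothing.\<close>
  have lam0: "lam q r (transvection n [(0, True)]) = (if q = 0 then 1 else 0) * (if r = 1 then 1 else 0) - (if q = 1 then 1 else 0) * (if r = 0 then 1 else 0)" for q r
    using o by (simp add: transvection_0 lam_mult lam_letter expn_letter)
  have d: "(\<Sum>q<n. (if q = i then 1 else 0) * imat \<sigma> q j) = imat \<sigma> i j" if "i < n" for i j
    using sum_row1[OF that, of "\<lambda>q. if q = i then 1 else 0" 1 "\<lambda>q. imat \<sigma> q j"] by simp
  have "johnson \<sigma> 0 0 k = imat \<sigma> 0 0 * imat \<sigma> 1 k - imat \<sigma> 1 0 * imat \<sigma> 0 k"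
    unfolding johnson_def s lam0 eact_diff eact_product unfolding s[symmetric] using o by (simp only: d)
  then have j0: "johnson \<sigma> 0 0 k = (if k = 1 then 1 else 0)"
    using o assms(2) imat_transvection by (auto simp: s)
  have ji: "johnson \<sigma> i i k = 0" if "i < n" "i \<noteq> 0" for i
    using that by (simp add: s johnson_def eact_def transvection_other lam_letter)
  have "(\<Sum>i<n. johnson \<sigma> i i k) = johnson \<sigma> 0 0 k"
    using sum.remove[of "{..<n}" 0 "\<lambda>i. johnson \<sigma> i i k"] o ji by simp
  moreover have "(\<Sum>r<n. imat \<sigma> r k * 1) = (if k = 1 then 0 else 1)"
  proof (cases "k = 1")
    case True
    have "(\<Sum>r<n. imat \<sigma> r k * 1) = 1 * 1 + (-1) * 1"
      by (rule sum_row2[of 1 n 0]) (use o True in \<open>auto simp: s imat_transvection\<close>)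
    then show ?thesis using True by simp
  next
    case False
    have "(\<Sum>r<n. imat \<sigma> r k * 1) = 1 * 1"
      by (rule sum_row1[of k]) (use assms(2) False in \<open>auto simp: s imat_transvection\<close>)
    then show ?thesis using False by simp
  qed
  ultimately show ?thesis by (simp add: contracted_def j0)
qed

text \<open>The crossed product rule \<open>contracted_mult\<close> has integral matrix entries, so
  evenness passes from generators to inverses and products.\<close>

lemma contracted_even:
  assumes "\<sigma> \<in> carrier AF" "k < n"
  shows "even (contracted \<sigma> k)"
proof -
  have "\<sigma> \<in> generate AF (nielsen_gens n)" using assms nielsen_generation by simp
  then have "\<forall>k<n. even (contracted \<sigma> k)"
  proof (induction rule: generate.induct)
    case one
    then show ?case by (simp add: contracted_one)
  next
    case (incl h)
    then show ?case by (simp add: contracted_even_gens)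
  next
    case (inv h)
    have h: "h \<in> carrier AF" using inv nielsen_gens_carrier by auto
    show ?case
    proof (intro allI impI)
      fix k assume k: "k < n"
      have "contracted (inv\<^bsub>AF\<^esub> h) k + (\<Sum>r<n. imat (inv\<^bsub>AF\<^esub> h) r k * contracted h r) = 0"
        using contracted_mult[OF A.inv_closed[OF h] h, of k] contracted_one[OF k] h by simp
      moreover have "even (\<Sum>r<n. imat (inv\<^bsub>AF\<^esub> h) r k * contracted h r)"
        using contracted_even_gens[OF inv] by (intro dvd_sum) auto
      ultimately show "even (contracted (inv\<^bsub>AF\<^esub> h) k)" by presburger
    qed
  next
    case (eng g h)
    have gh: "g \<in> carrier AF" "h \<in> carrier AF" using eng.hyps NG_subgroup subgroup.mem_carrier by fastforce+
    show ?case using eng.IH by (auto simp: contracted_mult[OF gh] intro!: dvd_add dvd_sum)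
  qed
  then show ?thesis using assms by simp
qed

text \<open>The greatest common divisor of 2 and n - 1, hence a common divisor of both terms in
  \<open>base\<close>.\<close>

definition divisor :: int where
  "divisor = (if odd n then 2 else 1)"

lemma divisor_dvd: "divisor dvd int n - 1" "\<sigma> \<in> carrier AF \<Longrightarrow> k < n \<Longrightarrow> divisor dvd contracted \<sigma> k"
  using contracted_even n2 by (auto simp: divisor_def)

text \<open>The coordinates of the sum over all basis vectors of e_i^* \<otimes> (e_i \<and> x), the
  insertion \<Omega> of the overview.\<close>

definition omega :: "(nat \<Rightarrow> int) \<Rightarrow> nat \<Rightarrow> nat \<Rightarrow> nat \<Rightarrow> int" where
  "omega x i j k = (if i = j then x k else 0) - (if i = k then x j else 0)"

text \<open>The integral crossed homomorphism \<Omega>Cg - (n-1)g, with Cg changed by a coboundary,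
  divided by \<open>divisor\<close>. The division is exact by \<open>base_divisor\<close>, and
  identities are proved after multiplying back.\<close>

definition base :: "((nat \<times> bool) list \<Rightarrow> (nat \<times> bool) list) \<Rightarrow> nat \<Rightarrow> nat \<Rightarrow> nat \<Rightarrow> int" where
  "base \<sigma> i j k = (omega (contracted \<sigma>) i j k - (int n - 1) * johnson \<sigma> i j k) div divisor"

lemma base_divisor:
  assumes "\<sigma> \<in> carrier AF" "j < n" "k < n"
  shows "divisor * base \<sigma> i j k = omega (contracted \<sigma>) i j k - (int n - 1) * johnson \<sigma> i j k"
proof -
  have "divisor dvd omega (contracted \<sigma>) i j k" using assms divisor_dvd(2) by (auto simp: omega_def)
  then have "divisor dvd omega (contracted \<sigma>) i j k - (int n - 1) * johnson \<sigma> i j k"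
    by (rule dvd_diff) (rule dvd_mult2[OF divisor_dvd(1)])
  then show ?thesis unfolding base_def by (rule dvd_mult_div_cancel)
qed

lemma ract_cong: "(\<And>p q r. \<lbrakk>p < n; q < n; r < n\<rbrakk> \<Longrightarrow> v p q r = w p q r) \<Longrightarrow> ract \<sigma> v i j k = ract \<sigma> w i j k"
  unfolding ract_def by (intro sum.cong refl arg_cong2[where f="(*)"] eact_cong[THEN fun_cong, THEN fun_cong]) auto

lemma ract_diff: "ract \<sigma> (\<lambda>p q r. v p q r - w p q r) i j k = ract \<sigma> v i j k - ract \<sigma> w i j k"
  by (simp add: ract_def eact_diff right_diff_distrib sum_subtractf)

lemma ract_scale: "ract \<sigma> (\<lambda>p q r. a * v p q r) i j k = a * ract \<sigma> v i j k"
  by (simp add: ract_def eact_def sum_distrib_left mult_ac)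

text \<open>The sum of e_i^* \<otimes> e_i is invariant, so inserting it commutes with the action;
  in matrices, \<open>mat\<close> and \<open>imat\<close> cancel in the sum over
  \<open>p\<close>.\<close>

lemma ract_omega:
  assumes s: "\<sigma> \<in> carrier AF" and i: "i < n"
  shows "ract \<sigma> (omega x) i j k = omega (\<lambda>k. \<Sum>r<n. imat \<sigma> r k * x r) i j k"
proof -
  have d: "(\<Sum>q<n. (if p = q then 1 else 0) * imat \<sigma> q j) = imat \<sigma> p j" if "p < n" for p j
  proof -
    have "(\<Sum>q<n. (if p = q then 1 else 0) * imat \<sigma> q j) = 1 * imat \<sigma> p j" by (rule sum_row1[OF that]) auto
    then show ?thesis by simp
  qed
  have e: "eact \<sigma> (omega x p) j k = imat \<sigma> p j * (\<Sum>r<n. x r * imat \<sigma> r k) - (\<Sum>r<n. x r * imat \<sigma> r j) * imat \<sigma> p k"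
    if "p < n" for p
  proof -
    have o: "omega x p = (\<lambda>q r. (if p = q then 1 else 0) * x r - x q * (if p = r then 1 else 0))"
      by (auto simp: omega_def fun_eq_iff)
    show ?thesis unfolding o eact_diff eact_product using that by (simp only: d)
  qed
  have "ract \<sigma> (omega x) i j k = (\<Sum>p<n. mat \<sigma> i p * imat \<sigma> p j) * (\<Sum>r<n. x r * imat \<sigma> r k)
      - (\<Sum>r<n. x r * imat \<sigma> r j) * (\<Sum>p<n. mat \<sigma> i p * imat \<sigma> p k)"
    unfolding ract_def sum_distrib_right[where f="\<lambda>p. mat \<sigma> i p * imat \<sigma> p j"] sum_distrib_left[where f="\<lambda>p. mat \<sigma> i p * imat \<sigma> p k"] sum_subtractf[symmetric]
    by (intro sum.cong refl) (simp add: e algebra_simps)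
  then show ?thesis using mat_imat(1)[OF s i] by (simp add: omega_def mult.commute)
qed

lemma base_mult:
  assumes s: "\<sigma> \<in> carrier AF" and t: "\<tau> \<in> carrier AF" and i: "i < n" "j < n" "k < n"
  shows "base (\<sigma> \<otimes>\<^bsub>AF\<^esub> \<tau>) i j k = base \<sigma> i j k + ract \<sigma> (base \<tau>) i j k"
proof -
  have st: "\<sigma> \<otimes>\<^bsub>AF\<^esub> \<tau> \<in> carrier AF" using s t by simp
  have "divisor * ract \<sigma> (base \<tau>) i j k = ract \<sigma> (\<lambda>p q r. omega (contracted \<tau>) p q r - (int n - 1) * johnson \<tau> p q r) i j k"
    unfolding ract_scale[symmetric] by (rule ract_cong) (simp add: base_divisor[OF t])
  also have "\<dots> = omega (\<lambda>k. \<Sum>r<n. imat \<sigma> r k * contracted \<tau> r) i j k - (int n - 1) * ract \<sigma> (johnson \<tau>) i j k"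
    using ract_omega[OF s i(1)] by (simp add: ract_diff ract_scale)
  finally have e: "divisor * ract \<sigma> (base \<tau>) i j k
      = omega (\<lambda>k. \<Sum>r<n. imat \<sigma> r k * contracted \<tau> r) i j k - (int n - 1) * ract \<sigma> (johnson \<tau>) i j k" .
  have "divisor * base (\<sigma> \<otimes>\<^bsub>AF\<^esub> \<tau>) i j k = divisor * (base \<sigma> i j k + ract \<sigma> (base \<tau>) i j k)"
    unfolding distrib_left base_divisor[OF s i(2,3)] base_divisor[OF st i(2,3)] e
    using s t i by (simp add: johnson_mult contracted_mult omega_def algebra_simps)
  then show ?thesis by (simp add: divisor_def split: if_splits)
qed

lemma base_swap:
  assumes s: "\<sigma> \<in> carrier AF" and i: "i < n" "j < n" "k < n"
  shows "base \<sigma> i k j = - base \<sigma> i j k"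
proof -
  have "divisor * base \<sigma> i k j = divisor * (- base \<sigma> i j k)"
    using base_divisor[OF s i(2,3), of i] base_divisor[OF s i(3,2), of i] johnson_swap[OF s i(1), of k j]
    by (simp add: omega_def algebra_simps)
  then show ?thesis by (simp add: divisor_def split: if_splits)
qed

lemma eact_trivial:
  assumes "\<And>r k. r < n \<Longrightarrow> k < n \<Longrightarrow> imat \<sigma> r k = (if r = k then 1 else 0)" "j < n" "k < n"
  shows "eact \<sigma> P j k = P j k"
proof -
  have "(\<Sum>q<n. imat \<sigma> q j * g q) = 1 * g j" "(\<Sum>q<n. imat \<sigma> q k * g q) = 1 * g k" for g
    by (rule sum_row1; use assms in auto)+
  then show ?thesis by (simp add: eact_nested)
qed

lemma imat_trivial:
  assumes s: "\<sigma> \<in> carrier AF" and m: "\<And>i j. i < n \<Longrightarrow> j < n \<Longrightarrow> mat \<sigma> i j = (if i = j then 1 else 0)"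
    and "i < n" "k < n"
  shows "imat \<sigma> i k = (if i = k then 1 else 0)"
proof -
  have "(\<Sum>j<n. mat \<sigma> i j * imat \<sigma> j k) = 1 * imat \<sigma> i k"
    by (rule sum_row1) (use assms in \<open>auto simp: m\<close>)
  then show ?thesis using mat_imat(1)[OF s assms(3), of k] by simp
qed

text \<open>On conjugation by \<open>g\<close> the value of \<open>johnson\<close> is 2\<Omega>[g].
  The matrix is the identity, so the coboundary correction vanishes, and C\<Omega> is multiplication
  by n - 1; hence both terms of \<open>base\<close> equal 2(n-1)\<Omega>[g].\<close>

lemma base_conj:
  assumes g: "g \<in> carrier F" and i: "i < n" "j < n" "k < n"
  shows "base (conj_aut F g) i j k = 0"
proof -
  let ?\<sigma> = "conj_aut F g"
  have s: "?\<sigma> \<in> carrier AF" by (rule conj_aut_carrier[OF F.is_group g])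
  have im: "imat ?\<sigma> r k = (if r = k then 1 else 0)" if "r < n" "k < n" for r k
    by (rule imat_trivial[OF s _ that]) (use g in \<open>auto simp: mat_def conj_aut_def expn_mult expn_inv expn_letter\<close>)
  have johnson: "johnson ?\<sigma> i j k = 2 * omega (\<lambda>k. expn k g) i j k" if "i < n" "j < n" "k < n" for i j k
  proof -
    have "johnson ?\<sigma> i j k = lam j k (?\<sigma> [(i, True)])"
      unfolding johnson_def by (rule eact_trivial) (use im that in auto)
    then show ?thesis
      using g that by (auto simp: conj_aut_def lam_mult lam_inv lam_letter expn_mult expn_inv expn_letter omega_def algebra_simps)
  qed
  have contracted: "contracted ?\<sigma> k = (int n - 1) * (2 * expn k g)" if k: "k < n" for k
  proof -
    have "(\<Sum>i<n. johnson ?\<sigma> i i k) = (\<Sum>i<n. 2 * expn k g - (if i = k then 2 * expn k g else 0))"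
      using k by (intro sum.cong refl) (auto simp: johnson omega_def)
    also have "\<dots> = (int n - 1) * (2 * expn k g)"
      using k by (simp add: sum_subtractf sum.delta algebra_simps)
    finally have 1: "(\<Sum>i<n. johnson ?\<sigma> i i k) = (int n - 1) * (2 * expn k g)" .
    have "(\<Sum>r<n. imat ?\<sigma> r k * 1) = 1 * 1" by (rule sum_row1[OF k]) (use im k in auto)
    then show ?thesis by (simp add: contracted_def 1)
  qed
  have "divisor * base ?\<sigma> i j k = 0"
    unfolding base_divisor[OF s i(2,3)] using i by (simp add: omega_def contracted johnson algebra_simps)
  then show ?thesis by (simp add: divisor_def split: if_splits)
qed

text \<open>K changes only x_0, where \<open>johnson\<close> is 2 e_0^* \<otimes> (e_0 \<and> e_1).
  Contraction gives 2 e_1, and insertion puts 2 at (2; 2, 1), where \<open>johnson\<close> itself is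
  0. After division b is 1 for odd n and 2 for even n, so its multiples exhaust the admissible
  values.\<close>

lemma base_K0:
  assumes "2 < n"
  shows "divisor * base (pconj {0}) 2 2 1 = 2"
proof -
  let ?\<sigma> = "pconj {0}"
  note o = one_less assms
  have s: "?\<sigma> \<in> carrier AF" by simp
  have im: "imat ?\<sigma> r k = (if r = k then 1 else 0)" if "r < n" "k < n" for r k
    by (rule imat_trivial[OF s _ that]) (simp add: mat_pconj)
  have johnson: "johnson ?\<sigma> i j k = lam j k (?\<sigma> [(i, True)])" if "i < n" "j < n" "k < n" for i j k
    unfolding johnson_def by (rule eact_trivial) (use im that in auto)
  have ji: "johnson ?\<sigma> i j k = 0" if "i < n" "j < n" "k < n" "i \<noteq> 0" for i j k
    using that by (simp add: johnson pconj_letter lam_letter)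
  have "johnson ?\<sigma> 0 0 1 = 2"
    using o by (simp add: johnson pconj_letter lam_mult lam_letter expn_mult expn_letter)
  then have "(\<Sum>i<n. johnson ?\<sigma> i i 1) = 2"
    using sum.remove[of "{..<n}" 0 "\<lambda>i. johnson ?\<sigma> i i 1"] o ji by simp
  moreover have "(\<Sum>r<n. imat ?\<sigma> r 1 * 1) = 1 * 1" by (rule sum_row1[OF o(1)]) (use im o in auto)
  ultimately have "contracted ?\<sigma> 1 = 2" by (simp add: contracted_def)
  then show ?thesis using base_divisor[OF s, of 2 1 2] o ji[of 2 2 1] by (simp add: omega_def)
qed

end

section \<open>The first cohomology group\<close>

text \<open>First isomorphism theorem for the concrete quotient: the cosets of the kernel are the
  fibres \<open>K a\<close> of \<open>h\<close>, and the isomorphism sends a fibre to its common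
  value.\<close>

lemma mod_isomorphic_quotI:
  fixes M :: "('l, 'm, 'c) module_scheme" and L :: "('l, 'd) ring_scheme"
  assumes L: "abelian_group L" and M: "abelian_group M"
    and sm: "\<And>r x. \<lbrakk>r \<in> carrier L; x \<in> carrier M\<rbrakk> \<Longrightarrow> r \<odot>\<^bsub>M\<^esub> x \<in> carrier M"
    and h: "h \<in> carrier M \<rightarrow> carrier L"
    and add: "\<And>x y. \<lbrakk>x \<in> carrier M; y \<in> carrier M\<rbrakk> \<Longrightarrow> h (x \<oplus>\<^bsub>M\<^esub> y) = h x \<oplus>\<^bsub>L\<^esub> h y"
    and lin: "\<And>r x. \<lbrakk>r \<in> carrier L; x \<in> carrier M\<rbrakk> \<Longrightarrow> h (r \<odot>\<^bsub>M\<^esub> x) = r \<otimes>\<^bsub>L\<^esub> h x"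
    and surj: "carrier L \<subseteq> h ` carrier M"
    and ker: "N = {x \<in> carrier M. h x = \<zero>\<^bsub>L\<^esub>}"
  shows "mod_isomorphic L (quot_module M N) (regular_module L)"
proof -
  interpret L: abelian_group L by fact
  interpret M: abelian_group M by fact
  have hc: "h x \<in> carrier L" if "x \<in> carrier M" for x using h that by auto
  have hz: "h \<zero>\<^bsub>M\<^esub> = \<zero>\<^bsub>L\<^esub>"
  proof -
    have "h \<zero>\<^bsub>M\<^esub> \<oplus>\<^bsub>L\<^esub> h \<zero>\<^bsub>M\<^esub> = h \<zero>\<^bsub>M\<^esub>" using add[of "\<zero>\<^bsub>M\<^esub>" "\<zero>\<^bsub>M\<^esub>"] by simp
    then show ?thesis using hc[of "\<zero>\<^bsub>M\<^esub>"] by (metis L.add.r_cancel_one M.zero_closed)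
  qed
  have hm: "h (\<ominus>\<^bsub>M\<^esub> x) = \<ominus>\<^bsub>L\<^esub> h x" if "x \<in> carrier M" for x
  proof -
    have "h (\<ominus>\<^bsub>M\<^esub> x) \<oplus>\<^bsub>L\<^esub> h x = \<zero>\<^bsub>L\<^esub>" using add[of "\<ominus>\<^bsub>M\<^esub> x" x] that by (simp add: M.l_neg hz)
    then show ?thesis using L.minus_equality[of "h (\<ominus>\<^bsub>M\<^esub> x)" "h x"] hc that by simp
  qed
  define K where "K a = {y \<in> carrier M. h y = a}" for a
  have coset: "N +>\<^bsub>M\<^esub> x = K (h x)" if x: "x \<in> carrier M" for x
  proof
    show "N +>\<^bsub>M\<^esub> x \<subseteq> K (h x)"
      using x hc by (auto simp: a_r_coset_def r_coset_def ker K_def add)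
    show "K (h x) \<subseteq> N +>\<^bsub>M\<^esub> x"
    proof
      fix y assume "y \<in> K (h x)"
      then have y: "y \<in> carrier M" "h y = h x" by (auto simp: K_def)
      have "y \<ominus>\<^bsub>M\<^esub> x \<in> N" using x y hc[OF x] by (simp add: ker M.minus_eq add hm L.r_neg)
      moreover have "(y \<ominus>\<^bsub>M\<^esub> x) \<oplus>\<^bsub>M\<^esub> x = y" using x y by (simp add: M.minus_eq M.a_assoc M.l_neg)
      ultimately show "y \<in> N +>\<^bsub>M\<^esub> x" by (force simp: a_r_coset_def r_coset_def)
    qed
  qed
  have KI: "h x = a \<Longrightarrow> x \<in> carrier M \<Longrightarrow> x \<in> K a" for x a by (simp add: K_def)
  have car: "carrier (quot_module M N) = K ` carrier L"
  proof -
    have "carrier (quot_module M N) = (\<lambda>x. K (h x)) ` carrier M"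
      by (auto simp: quot_module_def A_RCOSETS_def RCOSETS_def a_r_coset_def[symmetric] coset)
    also have "\<dots> = K ` carrier L" using surj h by (auto simp: image_iff)
    finally show ?thesis .
  qed
  have ne: "\<exists>x\<in>carrier M. h x = a" if "a \<in> carrier L" for a using surj that by auto
  define g where "g C = the_elem (h ` C)" for C
  have gK: "g (K a) = a" if "a \<in> carrier L" for a
  proof -
    have "h ` K a = {a}" using ne[OF that] by (auto simp: K_def)
    then show ?thesis by (simp add: g_def)
  qed
  have addK: "K a \<oplus>\<^bsub>quot_module M N\<^esub> K b = K (a \<oplus>\<^bsub>L\<^esub> b)" if a: "a \<in> carrier L" and b: "b \<in> carrier L" for a b
  proof
    show "K a \<oplus>\<^bsub>quot_module M N\<^esub> K b \<subseteq> K (a \<oplus>\<^bsub>L\<^esub> b)"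
      by (auto simp: quot_module_def set_add_def set_mult_def K_def add)
    show "K (a \<oplus>\<^bsub>L\<^esub> b) \<subseteq> K a \<oplus>\<^bsub>quot_module M N\<^esub> K b"
    proof
      fix z assume "z \<in> K (a \<oplus>\<^bsub>L\<^esub> b)"
      then have z: "z \<in> carrier M" "h z = a \<oplus>\<^bsub>L\<^esub> b" by (auto simp: K_def)
      obtain x where x: "x \<in> carrier M" "h x = a" using ne[OF a] by auto
      have "\<ominus>\<^bsub>M\<^esub> x \<oplus>\<^bsub>M\<^esub> z \<in> K b"
        using x z a b by (simp add: K_def add hm L.a_assoc[symmetric] L.l_neg)
      moreover have "z = x \<oplus>\<^bsub>M\<^esub> (\<ominus>\<^bsub>M\<^esub> x \<oplus>\<^bsub>M\<^esub> z)" using x z by (simp add: M.a_assoc[symmetric] M.r_neg)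
      moreover have "x \<in> K a" using x by (simp add: K_def)
      ultimately show "z \<in> K a \<oplus>\<^bsub>quot_module M N\<^esub> K b"
        by (auto simp: quot_module_def set_add_def set_mult_def)
    qed
  qed
  have smK: "r \<odot>\<^bsub>quot_module M N\<^esub> K a = K (r \<otimes>\<^bsub>L\<^esub> a)" if r: "r \<in> carrier L" and a: "a \<in> carrier L" for r a
  proof -
    have "(\<lambda>x. N +>\<^bsub>M\<^esub> (r \<odot>\<^bsub>M\<^esub> x)) ` K a = {K (r \<otimes>\<^bsub>L\<^esub> a)}"
      using ne[OF a] by (auto simp: K_def coset sm r lin image_iff)
    then show ?thesis by (simp add: quot_module_def)
  qed
  have lc: "r \<otimes>\<^bsub>L\<^esub> a \<in> carrier L" if "r \<in> carrier L" "a \<in> carrier L" for r a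
    using ne[OF that(2)] lin[OF that(1)] hc sm[OF that(1)] by metis
  have "g \<in> mod_hom L (quot_module M N) (regular_module L)"
    unfolding mod_hom_def car by (auto simp: regular_module_def gK addK smK lc)
  moreover have "bij_betw g (carrier (quot_module M N)) (carrier (regular_module L))"
    unfolding car by (rule bij_betw_byWitness[of _ K]) (auto simp: gK regular_module_def)
  ultimately show ?thesis unfolding mod_isomorphic_def by blast
qed

lemma abelian_group_crossed_homs:
  assumes "group G" "abelian_group M" and \<rho>: "\<And>x. x \<in> carrier G \<Longrightarrow> \<rho> x \<in> hom (add_monoid M) (add_monoid M)"
  shows "abelian_group (crossed_homs G M \<rho>)"
proof -
  interpret G: group G by fact
  interpret M: abelian_group M by fact
  let ?C = "crossed_homs G M \<rho>"
  have \<rho>c: "\<rho> x a \<in> carrier M" if "x \<in> carrier G" "a \<in> carrier M" for x a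
    using \<rho>[OF that(1)] that by (auto simp: hom_def)
  have \<rho>a: "\<rho> x (a \<oplus>\<^bsub>M\<^esub> b) = \<rho> x a \<oplus>\<^bsub>M\<^esub> \<rho> x b"
    if "x \<in> carrier G" "a \<in> carrier M" "b \<in> carrier M" for x a b
    using \<rho>[OF that(1)] that by (auto simp: hom_def)
  have \<rho>z: "\<rho> x \<zero>\<^bsub>M\<^esub> = \<zero>\<^bsub>M\<^esub>" if "x \<in> carrier G" for x
    using hom_one[OF \<rho>[OF that] M.a_group M.a_group] by simp
  have \<rho>m: "\<rho> x (\<ominus>\<^bsub>M\<^esub> a) = \<ominus>\<^bsub>M\<^esub> \<rho> x a" if "x \<in> carrier G" "a \<in> carrier M" for x a
    using \<rho>a[OF that(1), of "\<ominus>\<^bsub>M\<^esub> a" a] that \<rho>z M.minus_equality[of "\<rho> x (\<ominus>\<^bsub>M\<^esub> a)" "\<rho> x a"] \<rho>c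
    by (simp add: M.l_neg)
  have cf: "f x \<in> carrier M" if "f \<in> carrier ?C" "x \<in> carrier G" for f x
    using that by (auto simp: crossed_homs_def)
  have cm: "f (x \<otimes>\<^bsub>G\<^esub> y) = f x \<oplus>\<^bsub>M\<^esub> \<rho> x (f y)" if "f \<in> carrier ?C" "x \<in> carrier G" "y \<in> carrier G" for f x y
    using that by (auto simp: crossed_homs_def)
  have ce: "f \<in> extensional (carrier G)" if "f \<in> carrier ?C" for f
    using that by (auto simp: crossed_homs_def PiE_def)
  have ci: "(\<lambda>x\<in>carrier G. f x) \<in> carrier ?C"
    if "\<And>x. x \<in> carrier G \<Longrightarrow> f x \<in> carrier M"
      "\<And>x y. \<lbrakk>x \<in> carrier G; y \<in> carrier G\<rbrakk> \<Longrightarrow> f (x \<otimes>\<^bsub>G\<^esub> y) = f x \<oplus>\<^bsub>M\<^esub> \<rho> x (f y)" for f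
    using that by (auto simp: crossed_homs_def)
  have ad: "f \<oplus>\<^bsub>?C\<^esub> g = (\<lambda>x\<in>carrier G. f x \<oplus>\<^bsub>M\<^esub> g x)" and ze: "\<zero>\<^bsub>?C\<^esub> = (\<lambda>x\<in>carrier G. \<zero>\<^bsub>M\<^esub>)" for f g
    by (simp_all add: crossed_homs_def)
  show ?thesis
  proof (rule abelian_groupI)
    fix f g assume f: "f \<in> carrier ?C" and g: "g \<in> carrier ?C"
    show "f \<oplus>\<^bsub>?C\<^esub> g \<in> carrier ?C"
      unfolding ad using f g by (intro ci) (auto simp: cf cm \<rho>a \<rho>c M.a_ac)
    show "f \<oplus>\<^bsub>?C\<^esub> g = g \<oplus>\<^bsub>?C\<^esub> f"
      unfolding ad using f g by (intro restrict_ext) (simp add: cf M.a_comm)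
    fix k assume k: "k \<in> carrier ?C"
    show "f \<oplus>\<^bsub>?C\<^esub> g \<oplus>\<^bsub>?C\<^esub> k = f \<oplus>\<^bsub>?C\<^esub> (g \<oplus>\<^bsub>?C\<^esub> k)"
      unfolding ad using f g k by (intro restrict_ext) (simp add: cf M.a_assoc)
  next
    show "\<zero>\<^bsub>?C\<^esub> \<in> carrier ?C" unfolding ze by (rule ci) (auto simp: \<rho>z)
  next
    fix f assume f: "f \<in> carrier ?C"
    show "\<zero>\<^bsub>?C\<^esub> \<oplus>\<^bsub>?C\<^esub> f = f"
      unfolding ad ze using f ce[OF f] by (intro extensionalityI[of _ "carrier G"]) (auto simp: cf)
    show "\<exists>g\<in>carrier ?C. g \<oplus>\<^bsub>?C\<^esub> f = \<zero>\<^bsub>?C\<^esub>"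
    proof
      show "(\<lambda>x\<in>carrier G. \<ominus>\<^bsub>M\<^esub> f x) \<in> carrier ?C"
        using f by (intro ci) (auto simp: cf cm \<rho>m \<rho>c M.minus_add)
      show "(\<lambda>x\<in>carrier G. \<ominus>\<^bsub>M\<^esub> f x) \<oplus>\<^bsub>?C\<^esub> f = \<zero>\<^bsub>?C\<^esub>"
        unfolding ad ze using f by (intro restrict_ext) (simp add: cf M.l_neg)
    qed
  qed
qed

section \<open>Explicit crossed homomorphisms with values in V_L\<close>

context out_coeff
begin

definition vbase :: "((nat \<times> bool) list \<Rightarrow> (nat \<times> bool) list) \<Rightarrow> (nat \<times> bool) list V_elem" where
  "vbase \<sigma> = (SOME v. v \<in> carrier VF \<and> (\<forall>i<n. \<forall>j<n. \<forall>k<n. vcoord i j k v = base \<sigma> i j k))"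

text \<open>Only coordinates with j < k can be prescribed; the others agree because
  \<open>base\<close> is antisymmetric, as the coordinates of V are.\<close>

lemma vbase:
  assumes s: "\<sigma> \<in> carrier AF"
  shows vbase_closed: "vbase \<sigma> \<in> carrier VF"
    and vcoord_vbase: "\<lbrakk>i < n; j < n; k < n\<rbrakk> \<Longrightarrow> vcoord i j k (vbase \<sigma>) = base \<sigma> i j k"
proof -
  obtain v where v: "v \<in> carrier VF" "\<And>i j k. \<lbrakk>i < n; j < k; k < n\<rbrakk> \<Longrightarrow> vcoord i j k v = base \<sigma> i j k"
    using V_exists[of "base \<sigma>"] by blast
  have "vcoord i j k v = base \<sigma> i j k" if i: "i < n" "j < n" "k < n" for i j k
  proof -
    consider "j < k" | "j = k" | "k < j" by fastforce
    then show ?thesis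
    proof cases
      case 1 then show ?thesis using v i by simp
    next
      case 2 then show ?thesis using vcoord_diag[OF i(1) v(1)] base_swap[OF s i(1) i(2) i(2)] by simp
    next
      case 3
      then show ?thesis
        using v(2)[OF i(1) 3 i(2)] vcoord_swap[OF i(1) v(1), where k=j and j=k] base_swap[OF s i(1) i(2,3)] by simp
    qed
  qed
  then have "\<exists>v. v \<in> carrier VF \<and> (\<forall>i<n. \<forall>j<n. \<forall>k<n. vcoord i j k v = base \<sigma> i j k)" using v(1) by blast
  then have "vbase \<sigma> \<in> carrier VF \<and> (\<forall>i<n. \<forall>j<n. \<forall>k<n. vcoord i j k (vbase \<sigma>) = base \<sigma> i j k)"
    unfolding vbase_def by (rule someI_ex)
  then show "vbase \<sigma> \<in> carrier VF" "\<lbrakk>i < n; j < n; k < n\<rbrakk> \<Longrightarrow> vcoord i j k (vbase \<sigma>) = base \<sigma> i j k" by auto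
qed

lemma vbase_mult:
  assumes s: "\<sigma> \<in> carrier AF" and t: "\<tau> \<in> carrier AF"
  shows "vbase (\<sigma> \<otimes>\<^bsub>AF\<^esub> \<tau>) = vbase \<sigma> \<otimes>\<^bsub>VF\<^esub> act_V F \<sigma> (vbase \<tau>)"
proof (rule V_eqI)
  have st: "\<sigma> \<otimes>\<^bsub>AF\<^esub> \<tau> \<in> carrier AF" using s t by simp
  show "vbase (\<sigma> \<otimes>\<^bsub>AF\<^esub> \<tau>) \<in> carrier VF" by (rule vbase_closed[OF st])
  show "vbase \<sigma> \<otimes>\<^bsub>VF\<^esub> act_V F \<sigma> (vbase \<tau>) \<in> carrier VF" using s t vbase_closed act_V_closed by simp
  fix i j k assume i: "i < n" "j < k" "k < n"
  then have j: "j < n" by simp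
  have "vcoord i j k (act_V F \<sigma> (vbase \<tau>)) = ract \<sigma> (base \<tau>) i j k"
    unfolding vcoord_act[OF s i(1) vbase_closed[OF t]] ract_def eact_def sum_distrib_left
    by (intro sum.cong refl) (simp add: vcoord_vbase[OF t])
  then show "vcoord i j k (vbase (\<sigma> \<otimes>\<^bsub>AF\<^esub> \<tau>)) = vcoord i j k (vbase \<sigma> \<otimes>\<^bsub>VF\<^esub> act_V F \<sigma> (vbase \<tau>))"
    using s t i j vbase_closed act_V_closed[OF s vbase_closed[OF t]]
    by (simp add: hom_mult[OF vcoord_hom] vcoord_vbase[OF st] vcoord_vbase[OF s] base_mult)
qed

text \<open>The map v \<mapsto> v \<otimes> l is an equivariant homomorphism, so it carries the
  integral crossed homomorphism to V_L; varying \<open>l\<close> realises every admissible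
  b.\<close>

lemma crossed_base:
  assumes l: "l \<in> carrier L"
  shows "crossed (\<lambda>\<sigma>. ptensor VF LA (vbase \<sigma>) l)"
    and "tcoord 2 2 1 (ptensor VF LA (vbase (pconj {0})) l) = (if odd n then l else l \<oplus>\<^bsub>L\<^esub> l)"
proof -
  have pl: "(\<lambda>v. ptensor VF LA v l) \<in> hom VF TL"
    using bilinear_left[OF bilinear_ptensor[OF V.is_group LA_group]] l by simp
  show "crossed (\<lambda>\<sigma>. ptensor VF LA (vbase \<sigma>) l)"
    unfolding crossed_def
  proof (intro conjI ballI)
    fix \<sigma> \<tau> assume s: "\<sigma> \<in> carrier AF" and t: "\<tau> \<in> carrier AF"
    show "ptensor VF LA (vbase (\<sigma> \<otimes>\<^bsub>AF\<^esub> \<tau>)) l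
        = ptensor VF LA (vbase \<sigma>) l \<otimes>\<^bsub>TL\<^esub> act_VL F L \<sigma> (ptensor VF LA (vbase \<tau>) l)"
      using s t l by (simp add: vbase_mult hom_mult[OF pl] vbase_closed act_V_closed act_VL_ptensor)
  next
    fix g assume g: "g \<in> carrier F"
    have s: "conj_aut F g \<in> carrier AF" by (rule conj_aut_carrier[OF F.is_group g])
    have "vbase (conj_aut F g) = \<one>\<^bsub>VF\<^esub>"
      using base_conj[OF g] hom_one[OF vcoord_hom V.is_group group_integer_group]
      by (intro V_eqI) (auto simp: vbase_closed[OF s] vcoord_vbase[OF s])
    then show "ptensor VF LA (vbase (conj_aut F g)) l = \<one>\<^bsub>TL\<^esub>"
      using hom_one[OF pl V.is_group TL.is_group] by simp
  qed (use l in \<open>auto intro!: ptensor_TL_closed vbase_closed\<close>)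
  have K: "pconj {0} \<in> carrier AF" by simp
  have b: "base (pconj {0}) 2 2 1 = (if odd n then 1 else 2)"
    using base_K0[OF small_less(3)] by (auto simp: divisor_def)
  have "tcoord 2 2 1 (ptensor VF LA (vbase (pconj {0})) l) = zmul (base (pconj {0}) 2 2 1) l"
    using small_less l vbase_closed[OF K] vcoord_vbase[OF K, of 2 2 1] by (simp add: tcoord_ptensor)
  also have "\<dots> = (if odd n then l else l \<oplus>\<^bsub>L\<^esub> l)"
    using zmul_add[of l 1 1] l by (simp add: b zmul_one)
  finally show "tcoord 2 2 1 (ptensor VF LA (vbase (pconj {0})) l) = (if odd n then l else l \<oplus>\<^bsub>L\<^esub> l)" .
qed

section \<open>Passage between Aut F_n and Out F_n\<close>

abbreviation (input) "IF \<equiv> Inn F"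
abbreviation (input) "OutF \<equiv> Out F"
abbreviation (input) "rho \<equiv> out_act_VL F L"
abbreviation (input) "ZF \<equiv> crossed_homs (Out F) (V_mod F L) (out_act_VL F L)"

definition ocls :: "((nat \<times> bool) list \<Rightarrow> (nat \<times> bool) list) \<Rightarrow> ((nat \<times> bool) list \<Rightarrow> (nat \<times> bool) list) set" where
  "ocls \<sigma> = Inn F #>\<^bsub>AF\<^esub> \<sigma>"

sublocale I: normal IF AF by (rule Inn_normal[OF F.is_group])
sublocale O: group OutF unfolding Out_def by (rule I.factorgroup_is_group)

lemma carrier_Out: "carrier OutF = ocls ` carrier AF"
  by (auto simp: Out_def carrier_FactGroup ocls_def)

lemma ocls_mult: "\<lbrakk>\<sigma> \<in> carrier AF; \<tau> \<in> carrier AF\<rbrakk> \<Longrightarrow> ocls \<sigma> \<otimes>\<^bsub>OutF\<^esub> ocls \<tau> = ocls (\<sigma> \<otimes>\<^bsub>AF\<^esub> \<tau>)"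
  by (simp add: Out_def ocls_def I.rcos_sum)

lemma ocls_elem: "\<sigma> \<in> carrier AF \<Longrightarrow> ocls \<sigma> = (\<lambda>g. conj_aut F g \<otimes>\<^bsub>AF\<^esub> \<sigma>) ` carrier F"
  by (auto simp: ocls_def r_coset_def Inn_conj_aut[OF F.is_group])

text \<open>Resolves \<open>the_elem\<close> on a class, both for the action and for crossed
  homomorphisms: neither changes under an inner factor on the left.\<close>

lemma ocls_const:
  assumes "\<sigma> \<in> carrier AF" "\<And>g. g \<in> carrier F \<Longrightarrow> \<phi> (conj_aut F g \<otimes>\<^bsub>AF\<^esub> \<sigma>) = y"
  shows "the_elem (\<phi> ` ocls \<sigma>) = y"
proof -
  have "\<phi> ` ocls \<sigma> = {y}"
    unfolding ocls_elem[OF assms(1)] using assms(2) F.one_closed by (auto simp: image_iff)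
  then show ?thesis by simp
qed

lemma rho_ocls: "\<lbrakk>\<sigma> \<in> carrier AF; t \<in> carrier TL\<rbrakk> \<Longrightarrow> rho (ocls \<sigma>) t = act_VL F L \<sigma> t"
  unfolding out_act_VL_def
  by (rule ocls_const) (auto simp: act_VL_mult act_VL_conj act_VL_closed conj_aut_carrier[OF F.is_group])

lemma rho_hom: "S \<in> carrier OutF \<Longrightarrow> rho S \<in> hom (add_monoid WL) (add_monoid WL)"
  using hom_mult[OF act_VL_hom] by (auto simp: carrier_Out hom_def WL_simps rho_ocls act_VL_closed)

lemma abelian_group_ZF: "abelian_group ZF"
  by (rule abelian_group_crossed_homs[OF O.is_group abelian_group_WL rho_hom])

lemma ZF_D:
  assumes "\<phi> \<in> carrier ZF"
  shows "\<sigma> \<in> carrier AF \<Longrightarrow> \<phi> (ocls \<sigma>) \<in> carrier TL"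
    and "\<lbrakk>\<sigma> \<in> carrier AF; \<tau> \<in> carrier AF\<rbrakk> \<Longrightarrow> \<phi> (ocls (\<sigma> \<otimes>\<^bsub>AF\<^esub> \<tau>)) = \<phi> (ocls \<sigma>) \<otimes>\<^bsub>TL\<^esub> act_VL F L \<sigma> (\<phi> (ocls \<tau>))"
proof -
  show c: "\<phi> (ocls \<sigma>) \<in> carrier TL" if "\<sigma> \<in> carrier AF" for \<sigma>
    using assms that by (auto simp: crossed_homs_def carrier_Out WL_simps)
  show "\<phi> (ocls (\<sigma> \<otimes>\<^bsub>AF\<^esub> \<tau>)) = \<phi> (ocls \<sigma>) \<otimes>\<^bsub>TL\<^esub> act_VL F L \<sigma> (\<phi> (ocls \<tau>))"
    if "\<sigma> \<in> carrier AF" "\<tau> \<in> carrier AF"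
    using assms that c by (simp add: crossed_homs_def carrier_Out WL_simps ocls_mult[symmetric] rho_ocls)
qed

text \<open>An inner automorphism lies in the trivial class, and the value at that class equals its
  own double, hence is zero.\<close>

lemma crossed_pull:
  assumes p: "\<phi> \<in> carrier ZF"
  shows "crossed (\<lambda>\<sigma>. \<phi> (ocls \<sigma>))"
  unfolding crossed_def
proof (intro conjI ballI ZF_D[OF p])
  fix g assume g: "g \<in> carrier F"
  have s: "conj_aut F g \<in> carrier AF" by (rule conj_aut_carrier[OF F.is_group g])
  have "conj_aut F g \<in> Inn F" using g by (auto simp: Inn_conj_aut[OF F.is_group])
  then have e: "ocls (conj_aut F g) = ocls \<one>\<^bsub>AF\<^esub>"
    using A.coset_join2[OF s I.subgroup_axioms] A.coset_join2[OF A.one_closed I.subgroup_axioms] by (simp add: ocls_def)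
  have c: "\<phi> (ocls \<one>\<^bsub>AF\<^esub>) \<in> carrier TL" by (rule ZF_D[OF p A.one_closed])
  have "act_VL F L \<one>\<^bsub>AF\<^esub> t = t" if "t \<in> carrier TL" for t
    using that by (intro act_VL_trivial) (auto simp: mat_one)
  then have "\<phi> (ocls \<one>\<^bsub>AF\<^esub>) = \<phi> (ocls \<one>\<^bsub>AF\<^esub>) \<otimes>\<^bsub>TL\<^esub> \<phi> (ocls \<one>\<^bsub>AF\<^esub>)"
    using ZF_D(2)[OF p A.one_closed A.one_closed] c by simp
  then have "\<phi> (ocls \<one>\<^bsub>AF\<^esub>) = \<one>\<^bsub>TL\<^esub>" using c TL.l_cancel_one' by blast
  then show "\<phi> (ocls (conj_aut F g)) = \<one>\<^bsub>TL\<^esub>" by (simp add: e)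
qed

text \<open>Let c be conjugation by some word. Then f(c\<sigma>) = f(c) + cf(\<sigma>) =
  f(\<sigma>), so \<open>f\<close> is constant on classes.\<close>

lemma crossed_push:
  assumes f: "crossed f"
  obtains \<phi> where "\<phi> \<in> carrier ZF" "\<And>\<sigma>. \<sigma> \<in> carrier AF \<Longrightarrow> \<phi> (ocls \<sigma>) = f \<sigma>"
proof
  let ?\<phi> = "\<lambda>S\<in>carrier OutF. the_elem (f ` S)"
  have fc: "f \<sigma> \<in> carrier TL" if "\<sigma> \<in> carrier AF" for \<sigma> using f that by (simp add: crossed_def)
  show e: "?\<phi> (ocls \<sigma>) = f \<sigma>" if s: "\<sigma> \<in> carrier AF" for \<sigma>
  proof -
    have "the_elem (f ` ocls \<sigma>) = f \<sigma>"
      using f s fc[OF s] by (intro ocls_const[OF s]) (auto simp: crossed_def act_VL_conj conj_aut_carrier[OF F.is_group])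
    then show ?thesis using s by (simp add: carrier_Out)
  qed
  have m: "?\<phi> (ocls \<sigma> \<otimes>\<^bsub>OutF\<^esub> ocls \<tau>) = ?\<phi> (ocls \<sigma>) \<oplus>\<^bsub>WL\<^esub> rho (ocls \<sigma>) (?\<phi> (ocls \<tau>))"
    if s: "\<sigma> \<in> carrier AF" and t: "\<tau> \<in> carrier AF" for \<sigma> \<tau>
    using f s t by (simp only: ocls_mult e A.m_closed rho_ocls fc WL_simps) (simp add: crossed_def)
  have c: "?\<phi> (ocls \<sigma>) \<in> carrier WL" if "\<sigma> \<in> carrier AF" for \<sigma>
    using that by (simp only: e fc WL_simps)
  have "?\<phi> \<in> carrier OutF \<rightarrow>\<^sub>E carrier WL"
  proof (rule PiE_I)
    fix S assume "S \<in> carrier OutF"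
    then obtain \<sigma> where "\<sigma> \<in> carrier AF" "S = ocls \<sigma>" by (auto simp: carrier_Out)
    then show "?\<phi> S \<in> carrier WL" using c by simp
  qed simp
  moreover have "\<forall>x\<in>carrier OutF. \<forall>y\<in>carrier OutF. ?\<phi> (x \<otimes>\<^bsub>OutF\<^esub> y) = ?\<phi> x \<oplus>\<^bsub>WL\<^esub> rho x (?\<phi> y)"
  proof (intro ballI)
    fix x y assume "x \<in> carrier OutF" "y \<in> carrier OutF"
    then obtain \<sigma> \<tau> where "\<sigma> \<in> carrier AF" "x = ocls \<sigma>" "\<tau> \<in> carrier AF" "y = ocls \<tau>"
      by (auto simp: carrier_Out)
    then show "?\<phi> (x \<otimes>\<^bsub>OutF\<^esub> y) = ?\<phi> x \<oplus>\<^bsub>WL\<^esub> rho x (?\<phi> y)" using m by simp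
  qed
  ultimately show "?\<phi> \<in> carrier ZF" by (simp add: crossed_homs_def)
qed

text \<open>The coefficient b of f(K) from the overview.\<close>

definition h1_obs :: "(((nat \<times> bool) list \<Rightarrow> (nat \<times> bool) list) set \<Rightarrow> ((nat \<times> bool) list, 'l) VL_elem) \<Rightarrow> 'l" where
  "h1_obs \<phi> = tcoord 2 2 1 (\<phi> (ocls (pconj {0})))"

text \<open>\<open>h1_obs\<close> identifies the first cohomology with \<open>L\<close> for odd \<open>n\<close> and with \<open>2L\<close> for even \<open>n\<close>.\<close>

definition h1_coord :: "(((nat \<times> bool) list \<Rightarrow> (nat \<times> bool) list) set \<Rightarrow> ((nat \<times> bool) list, 'l) VL_elem) \<Rightarrow> 'l" where
  "h1_coord \<phi> = (if odd n then h1_obs \<phi> else SOME y. y \<in> carrier L \<and> h1_obs \<phi> = y \<oplus>\<^bsub>L\<^esub> y)"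

definition double_if_even :: "'l \<Rightarrow> 'l" where
  "double_if_even y = (if odd n then y else y \<oplus>\<^bsub>L\<^esub> y)"

text \<open>For even n the element chosen in \<open>h1_coord\<close> exists by
  \<open>is_double_b\<close>.\<close>

lemma h1_coord: "\<phi> \<in> carrier ZF \<Longrightarrow> h1_coord \<phi> \<in> carrier L \<and> h1_obs \<phi> = double_if_even (h1_coord \<phi>)"
proof -
  assume p: "\<phi> \<in> carrier ZF"
  note f = crossed_pull[OF p]
  show ?thesis
  proof (cases "odd n")
    case True
    then show ?thesis using tcoord_closed[of 2] ZF_D(1)[OF p] small_less by (simp add: h1_coord_def h1_obs_def double_if_even_def)
  next
    case False
    then have "\<exists>y. y \<in> carrier L \<and> h1_obs \<phi> = y \<oplus>\<^bsub>L\<^esub> y" using is_double_b[OF f] by (auto simp: is_double_def h1_obs_def)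
    then show ?thesis using False someI_ex[of "\<lambda>y. y \<in> carrier L \<and> h1_obs \<phi> = y \<oplus>\<^bsub>L\<^esub> y"] by (simp add: h1_coord_def double_if_even_def)
  qed
qed

lemma double_if_even_inj: "\<lbrakk>x \<in> carrier L; y \<in> carrier L; double_if_even x = double_if_even y\<rbrakk> \<Longrightarrow> x = y"
  using double_inj[of x y] by (simp add: double_if_even_def split: if_splits)

lemma h1_coord_eqI: "\<lbrakk>\<phi> \<in> carrier ZF; y \<in> carrier L; h1_obs \<phi> = double_if_even y\<rbrakk> \<Longrightarrow> h1_coord \<phi> = y"
  using h1_coord[of \<phi>] double_if_even_inj by simp

lemma ZF_add: "\<phi> \<oplus>\<^bsub>ZF\<^esub> \<psi> = (\<lambda>S\<in>carrier OutF. \<phi> S \<otimes>\<^bsub>TL\<^esub> \<psi> S)"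
  and ZF_smult: "r \<odot>\<^bsub>ZF\<^esub> \<phi> = (\<lambda>S\<in>carrier OutF. r \<odot>\<^bsub>WL\<^esub> \<phi> S)"
  by (simp_all add: crossed_homs_def WL_simps)

lemma ocls_closed: "\<sigma> \<in> carrier AF \<Longrightarrow> ocls \<sigma> \<in> carrier OutF"
  by (simp add: carrier_Out)

lemma h1_coord_zero_imp_principal:
  assumes p: "\<phi> \<in> carrier ZF" and h: "h1_coord \<phi> = \<zero>\<^bsub>L\<^esub>"
  shows "\<phi> \<in> principal_crossed_homs OutF WL rho"
proof -
  interpret W: abelian_group WL by (rule abelian_group_WL)
  have "h1_obs \<phi> = \<zero>\<^bsub>L\<^esub>" using h1_coord[OF p] h by (simp add: double_if_even_def)
  then obtain t where t: "t \<in> carrier TL"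
    "\<And>\<sigma>. \<sigma> \<in> carrier AF \<Longrightarrow> \<phi> (ocls \<sigma>) = act_VL F L \<sigma> t \<otimes>\<^bsub>TL\<^esub> inv\<^bsub>TL\<^esub> t"
    using crossed_principal[OF crossed_pull[OF p]] unfolding h1_obs_def by blast
  have "\<phi> = (\<lambda>x\<in>carrier OutF. rho x t \<ominus>\<^bsub>WL\<^esub> t)"
  proof (rule extensionalityI)
    show "\<phi> \<in> extensional (carrier OutF)" using p by (auto simp: crossed_homs_def PiE_def)
    fix S assume S: "S \<in> carrier OutF"
    then obtain \<sigma> where "\<sigma> \<in> carrier AF" "S = ocls \<sigma>" by (auto simp: carrier_Out)
    then show "\<phi> S = (\<lambda>x\<in>carrier OutF. rho x t \<ominus>\<^bsub>WL\<^esub> t) S"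
      using S t by (simp add: rho_ocls a_minus_def a_inv_WL WL_simps)
  qed simp
  then show ?thesis using t(1) by (auto simp: principal_crossed_homs_def WL_simps)
qed

text \<open>K acts trivially on V_L, so \<sigma>t - t vanishes at K and with it the coordinate
  b.\<close>

lemma principal_in_ZF:
  assumes "\<phi> \<in> principal_crossed_homs OutF WL rho"
  shows "\<phi> \<in> carrier ZF" "h1_coord \<phi> = \<zero>\<^bsub>L\<^esub>"
proof -
  obtain t where t: "t \<in> carrier TL" and p: "\<phi> = (\<lambda>x\<in>carrier OutF. rho x t \<ominus>\<^bsub>WL\<^esub> t)"
    using assms by (auto simp: principal_crossed_homs_def WL_simps)
  have e: "\<phi> (ocls \<sigma>) = act_VL F L \<sigma> t \<otimes>\<^bsub>TL\<^esub> inv\<^bsub>TL\<^esub> t" if "\<sigma> \<in> carrier AF" for \<sigma>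
    using that t ocls_closed[OF that] by (simp add: p rho_ocls a_minus_def a_inv_WL WL_simps)
  have ac: "act_VL F L \<sigma> t \<in> carrier TL" if "\<sigma> \<in> carrier AF" for \<sigma> using act_VL_closed that t by simp
  have "\<phi> \<in> carrier OutF \<rightarrow>\<^sub>E carrier WL"
  proof (rule PiE_I)
    fix S assume "S \<in> carrier OutF"
    then show "\<phi> S \<in> carrier WL" using e ac t by (auto simp: carrier_Out WL_simps)
  qed (simp add: p)
  moreover have "\<phi> (ocls \<sigma> \<otimes>\<^bsub>OutF\<^esub> ocls \<tau>) = \<phi> (ocls \<sigma>) \<oplus>\<^bsub>WL\<^esub> rho (ocls \<sigma>) (\<phi> (ocls \<tau>))"
    if s: "\<sigma> \<in> carrier AF" and u: "\<tau> \<in> carrier AF" for \<sigma> \<tau>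
  proof -
    have i: "act_VL F L \<sigma> (inv\<^bsub>TL\<^esub> t) = inv\<^bsub>TL\<^esub> act_VL F L \<sigma> t"
      using group_hom.hom_inv[of TL TL "act_VL F L \<sigma>" t] act_VL_hom[OF s] t
      by (simp add: group_hom_def group_hom_axioms_def TL.is_group)
    have c: "act_VL F L \<sigma> (act_VL F L \<tau> t) \<in> carrier TL" using act_VL_closed[OF s ac[OF u]] .
    have "\<phi> (ocls \<sigma>) \<oplus>\<^bsub>WL\<^esub> rho (ocls \<sigma>) (\<phi> (ocls \<tau>))
        = (act_VL F L \<sigma> t \<otimes>\<^bsub>TL\<^esub> inv\<^bsub>TL\<^esub> t) \<otimes>\<^bsub>TL\<^esub> (act_VL F L \<sigma> (act_VL F L \<tau> t) \<otimes>\<^bsub>TL\<^esub> inv\<^bsub>TL\<^esub> act_VL F L \<sigma> t)"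
      using s u t ac by (simp add: e rho_ocls WL_simps hom_mult[OF act_VL_hom[OF s]] i)
    also have "\<dots> = act_VL F L \<sigma> (act_VL F L \<tau> t) \<otimes>\<^bsub>TL\<^esub> inv\<^bsub>TL\<^esub> t \<otimes>\<^bsub>TL\<^esub> (act_VL F L \<sigma> t \<otimes>\<^bsub>TL\<^esub> inv\<^bsub>TL\<^esub> act_VL F L \<sigma> t)"
      using s u t ac c by (simp only: TL.m_ac TL.m_closed TL.inv_closed)
    also have "\<dots> = \<phi> (ocls \<sigma> \<otimes>\<^bsub>OutF\<^esub> ocls \<tau>)"
      using s u t ac c by (simp add: ocls_mult e act_VL_mult)
    finally show ?thesis ..
  qed
  ultimately show z: "\<phi> \<in> carrier ZF" by (auto simp: crossed_homs_def carrier_Out)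
  have "act_VL F L (pconj {0}) t = t"
    by (rule act_VL_trivial) (use t in \<open>auto simp: mat_pconj\<close>)
  then have "h1_obs \<phi> = \<zero>\<^bsub>L\<^esub>" using t small_less by (simp add: h1_obs_def e tcoord_one)
  then show "h1_coord \<phi> = \<zero>\<^bsub>L\<^esub>" by (intro h1_coord_eqI[OF z]) (simp_all add: double_if_even_def)
qed

text \<open>\<open>h1_coord\<close> is linear because \<open>h1_obs\<close> is and
  \<open>double_if_even\<close> is linear and injective. Its kernel is identified by
  \<open>crossed_principal\<close>, and \<open>crossed_base\<close> makes it surjective.\<close>

theorem H1_isomorphic: "mod_isomorphic L (H1 OutF WL rho) (regular_module L)"
  unfolding H1_def
proof (rule mod_isomorphic_quotI[where h=h1_coord])
  interpret Z: abelian_group ZF by (rule abelian_group_ZF)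
  note K = K0_carrier(1)
  show "abelian_group L" by (rule L.abelian_group_axioms)
  show "abelian_group ZF" by (rule abelian_group_ZF)
  show "h1_coord \<in> carrier ZF \<rightarrow> carrier L" using h1_coord by auto
  show sm: "r \<odot>\<^bsub>ZF\<^esub> \<phi> \<in> carrier ZF" if r: "r \<in> carrier L" and p: "\<phi> \<in> carrier ZF" for r \<phi>
  proof -
    have "crossed (\<lambda>\<sigma>. r \<odot>\<^bsub>WL\<^esub> \<phi> (ocls \<sigma>))"
      using crossed_pull[OF p] r hom_mult[OF smult_WL(1)[OF r]] hom_one[OF smult_WL(1)[OF r] TL.is_group TL.is_group]
      by (auto simp: crossed_def smult_WL_closed smult_act act_VL_closed)
    then obtain \<psi> where q: "\<psi> \<in> carrier ZF" "\<And>\<sigma>. \<sigma> \<in> carrier AF \<Longrightarrow> \<psi> (ocls \<sigma>) = r \<odot>\<^bsub>WL\<^esub> \<phi> (ocls \<sigma>)"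
      using crossed_push by blast
    have "r \<odot>\<^bsub>ZF\<^esub> \<phi> = \<psi>"
    proof (rule extensionalityI)
      show "r \<odot>\<^bsub>ZF\<^esub> \<phi> \<in> extensional (carrier OutF)" by (simp add: ZF_smult)
      show "\<psi> \<in> extensional (carrier OutF)" using q(1) by (auto simp: crossed_homs_def PiE_def)
      fix S assume "S \<in> carrier OutF"
      then show "(r \<odot>\<^bsub>ZF\<^esub> \<phi>) S = \<psi> S" using q(2) by (auto simp: ZF_smult carrier_Out)
    qed
    then show ?thesis using q(1) by simp
  qed
  show "h1_coord (\<phi> \<oplus>\<^bsub>ZF\<^esub> \<psi>) = h1_coord \<phi> \<oplus>\<^bsub>L\<^esub> h1_coord \<psi>" if p: "\<phi> \<in> carrier ZF" and q: "\<psi> \<in> carrier ZF" for \<phi> \<psi>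
  proof (rule h1_coord_eqI)
    show "\<phi> \<oplus>\<^bsub>ZF\<^esub> \<psi> \<in> carrier ZF" using p q by simp
    have "h1_obs (\<phi> \<oplus>\<^bsub>ZF\<^esub> \<psi>) = h1_obs \<phi> \<oplus>\<^bsub>L\<^esub> h1_obs \<psi>"
      using ZF_D(1)[OF p K] ZF_D(1)[OF q K] small_less ocls_closed[OF K] by (simp add: h1_obs_def ZF_add tcoord_mult)
    then show "h1_obs (\<phi> \<oplus>\<^bsub>ZF\<^esub> \<psi>) = double_if_even (h1_coord \<phi> \<oplus>\<^bsub>L\<^esub> h1_coord \<psi>)"
      using h1_coord[OF p] h1_coord[OF q] by (simp add: double_if_even_def L.a_ac)
  qed (use h1_coord[OF p] h1_coord[OF q] in simp)
  show "h1_coord (r \<odot>\<^bsub>ZF\<^esub> \<phi>) = r \<otimes>\<^bsub>L\<^esub> h1_coord \<phi>" if r: "r \<in> carrier L" and p: "\<phi> \<in> carrier ZF" for r \<phi>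
  proof (rule h1_coord_eqI[OF sm[OF r p]])
    have "h1_obs (r \<odot>\<^bsub>ZF\<^esub> \<phi>) = r \<otimes>\<^bsub>L\<^esub> h1_obs \<phi>"
      using ZF_D(1)[OF p K] small_less ocls_closed[OF K] r by (simp add: h1_obs_def ZF_smult tcoord_smult)
    then show "h1_obs (r \<odot>\<^bsub>ZF\<^esub> \<phi>) = double_if_even (r \<otimes>\<^bsub>L\<^esub> h1_coord \<phi>)"
      using h1_coord[OF p] r by (simp add: double_if_even_def L.r_distr)
  qed (use h1_coord[OF p] r in simp)
  show "carrier L \<subseteq> h1_coord ` carrier ZF"
  proof
    fix l assume l: "l \<in> carrier L"
    obtain \<phi> where p: "\<phi> \<in> carrier ZF" "\<And>\<sigma>. \<sigma> \<in> carrier AF \<Longrightarrow> \<phi> (ocls \<sigma>) = ptensor VF LA (vbase \<sigma>) l"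
      using crossed_push[OF crossed_base(1)[OF l]] by blast
    have "h1_coord \<phi> = l"
      using p(2)[OF K] crossed_base(2)[OF l] by (intro h1_coord_eqI[OF p(1) l]) (simp add: h1_obs_def double_if_even_def)
    then show "l \<in> h1_coord ` carrier ZF" using p(1) by blast
  qed
  show "principal_crossed_homs OutF WL rho = {\<phi> \<in> carrier ZF. h1_coord \<phi> = \<zero>\<^bsub>L\<^esub>}"
      proof
    show "principal_crossed_homs OutF WL rho \<subseteq> {\<phi> \<in> carrier ZF. h1_coord \<phi> = \<zero>\<^bsub>L\<^esub>}"
      using principal_in_ZF by (intro subsetI CollectI conjI)
    show "{\<phi> \<in> carrier ZF. h1_coord \<phi> = \<zero>\<^bsub>L\<^esub>} \<subseteq> principal_crossed_homs OutF WL rho"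
      by (intro subsetI) (elim CollectE conjE, rule h1_coord_zero_imp_principal)
  qed
qed

end

theorem proposition1:
  fixes L :: "('l, 'd) ring_scheme" and n :: nat
  assumes "principal_domain L"
    and "\<And>a. a \<in> carrier L \<Longrightarrow> a \<oplus>\<^bsub>L\<^esub> a = \<zero>\<^bsub>L\<^esub> \<Longrightarrow> a = \<zero>\<^bsub>L\<^esub>"
    and "n \<ge> 5"
  shows "mod_isomorphic L
           (H1 (Out (free_group {..<n})) (V_mod (free_group {..<n}) L)
               (out_act_VL (free_group {..<n}) L))
           (regular_module L)"
proof -
  interpret L: principal_domain L by fact
  interpret out_coeff n L
  proof unfold_locales
    show "2 \<le> n" "5 \<le> n" using assms(3) by auto
  qed (rule assms(2))
  show ?thesis by (rule H1_isomorphic)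
qed

end
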